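(* (i) $\mathcal H[W]$ and $\mathcal H^W$ are simple rings. These rings are Morita equivalent via the functors $$\mathbf F:\ \mathcal H[W]\text{-mod}\to\mathcal H^W\text{-mod},\quad M\mapsto\mathcal H^r\otimes_{\mathcal H[W]}M,\qquad \mathbf I:\ \mathcal H^W\text{-mod}\to\mathcal H[W]\text{-mod},\quad N\mapsto\mathcal H^l\otimes_{\mathcal H^W}N.$$ (ii) There are functorial isomorphisms $\mathbf F(M)\cong\mathrm{Hom}_{\mathcal H[W]}(\mathcal H^l,M)\cong M^W$.
   Context: Let $\Delta\subset\mathfrak h$ be a finite reduced root system with Weyl group $W$, and let $\mathbf X\subset\mathfrak h^\vee$, $\mathbf Y\subset\mathfrak h$ be $W$-invariant lattices associated with $\Delta$ (such as the (co)root and weight lattices), with the natural $W$-invariant non-degenerate pairing $\langle\,,\rangle:\mathbf X\times\mathbf Y\to\frac1n\mathbb Z$, $n$ a positive integer. Fix $q\in\mathbb C^*$, not a root of unity, together with an $n$-th root $q^{1/n}$, and put $q^{a/n}:=(q^{1/n})^a$ for $a\in\mathbb Z$. The quantum torus $\mathcal H$ is the $\mathbb C$-algebra with basis $\{e^xe^y : x\in\mathbf X,y\in\mathbf Y\}$, containing the group algebras $\mathbb C\mathbf X$ and $\mathbb C\mathbf Y$ as subalgebras, with $e^xe^y=q^{\langle x,y\rangle}e^ye^x$. $W$ acts on $\mathcal H$ by algebra automorphisms $h\mapsto{}^wh$, with ${}^w(e^x)=e^{w(x)}$, ${}^w(e^y)=e^{w(y)}$; $\mathcal H^W$ is the subalgebra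 of $W$-invariants. The twisted group algebra $\mathcal H[W]$ is $\mathcal H\otimes_{\mathbb C}\mathbb C[W]$ with product $(f\otimes w)(g\otimes u)=(f\cdot{}^wg)\otimes(wu)$. $\mathcal H^l$ denotes $\mathcal H$ viewed as an $(\mathcal H[W],\mathcal H^W)$-bimodule: $(f\otimes w)\cdot h=f\cdot{}^wh$, with $\mathcal H^W$ acting by right multiplication. $\mathcal H^r$ denotes $\mathcal H$ viewed as an $(\mathcal H^W,\mathcal H[W])$-bimodule: $h\cdot(f\otimes w)={}^{w^{-1}}(hf)$, with $\mathcal H^W$ acting by left multiplication. *)

theory Defs
  imports
    Complex_Main
    "HOL-Library.Poly_Mapping"
    "HOL-Library.Function_Algebras"
    "HOL-Algebra.Bij"
    "HOL-Algebra.Ideal"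
    "HOL-Algebra.Module"
    "HOL-Algebra.Free_Abelian_Groups"
begin

section \<open>Root systems, lattices and the pairing\<close>

text \<open>
  The space \<open>\<hh>\<close> is the whole type \<open>'v\<close>, a vector space over a field \<open>'k\<close> of characteristic
  \<open>0\<close>; this covers the real and the complex setting.  Elements of the dual space
  \<open>\<hh>\<^sup>\<or>\<close> are linear functions \<open>'v \<Rightarrow> 'k\<close>.
\<close>

definition dual_space :: "('k::field_char_0 \<Rightarrow> 'v::ab_group_add \<Rightarrow> 'v) \<Rightarrow> ('v \<Rightarrow> 'k) set" where
  "dual_space scale = {f. Vector_Spaces.linear scale (*) f}"

definition dual_scale :: "'k::field_char_0 \<Rightarrow> ('v \<Rightarrow> 'k) \<Rightarrow> ('v \<Rightarrow> 'k)" where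
  "dual_scale c f = (\<lambda>v. c * f v)"

definition reflection ::
    "('k::field_char_0 \<Rightarrow> 'v::ab_group_add \<Rightarrow> 'v) \<Rightarrow> ('v \<Rightarrow> 'v \<Rightarrow> 'k) \<Rightarrow> 'v \<Rightarrow> 'v \<Rightarrow> 'v" where
  "reflection scale coroot \<alpha> v = v - scale (coroot \<alpha> v) \<alpha>"

text \<open>
  The coroots are carried along as part of the data; for a finite spanning set \<open>\<Delta>\<close> the
  axioms determine \<open>coroot \<alpha>\<close> uniquely for every \<open>\<alpha> \<in> \<Delta>\<close>.
\<close>

locale reduced_root_system = vector_space scale
  for scale :: "'k::field_char_0 \<Rightarrow> 'v::ab_group_add \<Rightarrow> 'v" +
  fixes \<Delta> :: "'v set" and coroot :: "'v \<Rightarrow> 'v \<Rightarrow> 'k"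
  assumes finite_roots: "finite \<Delta>"
    and zero_not_root: "0 \<notin> \<Delta>"
    and roots_span: "module.span scale \<Delta> = UNIV"
    and coroot_linear: "\<alpha> \<in> \<Delta> \<Longrightarrow> coroot \<alpha> \<in> dual_space scale"
    and coroot_self: "\<alpha> \<in> \<Delta> \<Longrightarrow> coroot \<alpha> \<alpha> = 2"
    and reflection_root: "\<alpha> \<in> \<Delta> \<Longrightarrow> \<beta> \<in> \<Delta> \<Longrightarrow> reflection scale coroot \<alpha> \<beta> \<in> \<Delta>"
    and coroot_integral: "\<alpha> \<in> \<Delta> \<Longrightarrow> \<beta> \<in> \<Delta> \<Longrightarrow> coroot \<alpha> \<beta> \<in> \<int>"
    and reduced: "\<alpha> \<in> \<Delta> \<Longrightarrow> scale c \<alpha> \<in> \<Delta> \<Longrightarrow> c = 1 \<or> c = - 1"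

definition weyl_group ::
    "('k::field_char_0 \<Rightarrow> 'v::ab_group_add \<Rightarrow> 'v) \<Rightarrow> 'v set \<Rightarrow> ('v \<Rightarrow> 'v \<Rightarrow> 'k) \<Rightarrow> ('v \<Rightarrow> 'v) set" where
  "weyl_group scale \<Delta> coroot = generate (BijGroup UNIV) (reflection scale coroot ` \<Delta>)"

text \<open>The contragredient action on \<open>\<hh>\<^sup>\<or>\<close>, so that the evaluation pairing is invariant.\<close>

definition dual_act :: "('v \<Rightarrow> 'v) \<Rightarrow> ('v \<Rightarrow> 'k) \<Rightarrow> ('v \<Rightarrow> 'k)" where
  "dual_act w x = x \<circ> inv_into UNIV w"

text \<open>\<open>L\<close> is the \<open>\<int>\<close>-span of a (finite) vector space basis of the subspace \<open>V\<close>.\<close>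

definition lattice_in ::
    "('k::field_char_0 \<Rightarrow> 'u::ab_group_add \<Rightarrow> 'u) \<Rightarrow> 'u set \<Rightarrow> 'u set \<Rightarrow> bool" where
  "lattice_in scale V L \<longleftrightarrow>
     (\<exists>B. finite B \<and> \<not> module.dependent scale B \<and> module.span scale B = V \<and>
          L = {\<Sum>b\<in>B. scale (of_int (c b)) b |c :: 'u \<Rightarrow> int. True})"

text \<open>
  The pairing of \<open>x\<close> and \<open>y\<close> is the evaluation \<open>x y\<close>.  Invariance of the pairing is automatic.
  Nondegeneracy is automatic as well, since the lattices have full rank, but is kept as an
  explicit axiom.  The number \<open>qn\<close> is the chosen \<open>n\<close>-th root of \<open>q\<close>.
\<close>

locale quantum_torus_datum = reduced_root_system scale \<Delta> coroot
  for scale :: "'k::field_char_0 \<Rightarrow> 'v::ab_group_add \<Rightarrow> 'v"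
    and \<Delta> :: "'v set" and coroot :: "'v \<Rightarrow> 'v \<Rightarrow> 'k" +
  fixes X :: "('v \<Rightarrow> 'k) set" and Y :: "'v set" and n :: nat and q qn :: complex
  assumes lattice_X: "lattice_in dual_scale (dual_space scale) X"
    and lattice_Y: "lattice_in scale UNIV Y"
    and X_invariant: "w \<in> weyl_group scale \<Delta> coroot \<Longrightarrow> x \<in> X \<Longrightarrow> dual_act w x \<in> X"
    and Y_invariant: "w \<in> weyl_group scale \<Delta> coroot \<Longrightarrow> y \<in> Y \<Longrightarrow> w y \<in> Y"
    and n_pos: "n > 0"
    and pairing_integral: "x \<in> X \<Longrightarrow> y \<in> Y \<Longrightarrow> of_nat n * x y \<in> \<int>"
    and nondegenerate_left: "x \<in> X \<Longrightarrow> (\<forall>y\<in>Y. x y = 0) \<Longrightarrow> x = 0"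
    and nondegenerate_right: "y \<in> Y \<Longrightarrow> (\<forall>x\<in>X. x y = 0) \<Longrightarrow> y = 0"
    and q_nonzero: "q \<noteq> 0"
    and q_not_root_of_unity: "m > 0 \<Longrightarrow> q ^ m \<noteq> 1"
    and qn_root: "qn ^ n = q"


section \<open>The quantum torus and the rings built from it\<close>

text \<open>
  The element \<open>\<Sum> c\<^bsub>x,y\<^esub> e\<^sup>x e\<^sup>y\<close> is represented by the finitely supported
  function \<open>(x, y) \<mapsto> c\<^bsub>x,y\<^esub>\<close>.
\<close>

type_synonym ('k, 'v) torus = "(('v \<Rightarrow> 'k) \<times> 'v) \<Rightarrow>\<^sub>0 complex"

text \<open>\<open>q_pow n qn t\<close> is \<open>q\<^sup>t\<close> for \<open>t = a/n\<close> with an integer \<open>a\<close>.\<close>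

definition q_pow :: "nat \<Rightarrow> complex \<Rightarrow> 'k::field_char_0 \<Rightarrow> complex" where
  "q_pow n qn t = qn powi (THE a. of_int a = of_nat n * t)"

text \<open>
  From \<open>e\<^sup>x e\<^sup>y = q\<^bsup>\<langle>x,y\<rangle>\<^esup> e\<^sup>y e\<^sup>x\<close> one gets
  \<open>(e\<^sup>x e\<^sup>y) (e\<^bsup>x'\<^esup> e\<^bsup>y'\<^esup>) = q\<^bsup>-\<langle>x',y\<rangle>\<^esup> e\<^bsup>x+x'\<^esup> e\<^bsup>y+y'\<^esup>\<close>.
\<close>

definition torus_mult ::
    "nat \<Rightarrow> complex \<Rightarrow> ('k::field_char_0, 'v::ab_group_add) torus \<Rightarrow> ('k, 'v) torus \<Rightarrow> ('k, 'v) torus" where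
  "torus_mult n qn f g =
     (\<Sum>(x, y)\<in>Poly_Mapping.keys f. \<Sum>(x', y')\<in>Poly_Mapping.keys g.
        Poly_Mapping.single (x + x', y + y')
          (Poly_Mapping.lookup f (x, y) * Poly_Mapping.lookup g (x', y') * q_pow n qn (- x' y)))"

definition quantum_torus ::
    "('v \<Rightarrow> 'k::field_char_0) set \<Rightarrow> 'v::ab_group_add set \<Rightarrow> nat \<Rightarrow> complex \<Rightarrow> ('k, 'v) torus ring" where
  "quantum_torus X Y n qn =
     \<lparr>carrier = {f. Poly_Mapping.keys f \<subseteq> X \<times> Y}, monoid.mult = torus_mult n qn,
      monoid.one = Poly_Mapping.single (0, 0) 1, ring.zero = 0, ring.add = (+)\<rparr>"

definition torus_act :: "('v \<Rightarrow> 'v) \<Rightarrow> ('k, 'v) torus \<Rightarrow> ('k, 'v) torus" where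
  "torus_act w f =
     (\<Sum>(x, y)\<in>Poly_Mapping.keys f.
        Poly_Mapping.single (dual_act w x, w y) (Poly_Mapping.lookup f (x, y)))"

definition invariant_subring ::
    "('k, 'v) torus ring \<Rightarrow> ('v \<Rightarrow> 'v) set \<Rightarrow> ('k, 'v) torus ring" where
  "invariant_subring H W = H\<lparr>carrier := {h \<in> carrier H. \<forall>w\<in>W. torus_act w h = h}\<rparr>"

text \<open>\<open>\<Sum> f\<^sub>w \<otimes> w\<close> is represented by \<open>w \<mapsto> f\<^sub>w\<close>.\<close>

type_synonym ('k, 'v) twisted = "('v \<Rightarrow> 'v) \<Rightarrow>\<^sub>0 ('k, 'v) torus"

definition twisted_group_ring ::
    "('k, 'v) torus ring \<Rightarrow> ('v \<Rightarrow> 'v) set \<Rightarrow> ('k, 'v) twisted ring" where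
  "twisted_group_ring H W =
     \<lparr>carrier = {F. Poly_Mapping.keys F \<subseteq> W \<and> (\<forall>w. Poly_Mapping.lookup F w \<in> carrier H)},
      monoid.mult = (\<lambda>F G. \<Sum>w\<in>Poly_Mapping.keys F. \<Sum>u\<in>Poly_Mapping.keys G.
                Poly_Mapping.single (w \<circ> u)
                  (Poly_Mapping.lookup F w \<otimes>\<^bsub>H\<^esub> torus_act w (Poly_Mapping.lookup G u))),
      monoid.one = Poly_Mapping.single id \<one>\<^bsub>H\<^esub>, ring.zero = 0, ring.add = (+)\<rparr>"

definition simple_ring :: "('a, 'b) ring_scheme \<Rightarrow> bool" where
  "simple_ring R \<longleftrightarrow> ring R \<and> \<one>\<^bsub>R\<^esub> \<noteq> \<zero>\<^bsub>R\<^esub> \<and>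
     (\<forall>I. ideal I R \<longrightarrow> I = {\<zero>\<^bsub>R\<^esub>} \<or> I = carrier R)"


section \<open>Modules over noncommutative rings, functors\<close>

text \<open>
  The locale \<open>module\<close> of the library requires a commutative base ring; its record type is reused.
  The ring operations \<open>mult\<close> and \<open>one\<close> of that record play no role for modules.
\<close>

locale left_module = R?: ring R + M?: abelian_group M
  for R (structure) and M (structure) +
  assumes smult_closed:
      "\<lbrakk>a \<in> carrier R; x \<in> carrier M\<rbrakk> \<Longrightarrow> a \<odot>\<^bsub>M\<^esub> x \<in> carrier M"
    and smult_l_distr:
      "\<lbrakk>a \<in> carrier R; b \<in> carrier R; x \<in> carrier M\<rbrakk> \<Longrightarrow>
       (a \<oplus> b) \<odot>\<^bsub>M\<^esub> x = a \<odot>\<^bsub>M\<^esub> x \<oplus>\<^bsub>M\<^esub> b \<odot>\<^bsub>M\<^esub> x"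
    and smult_r_distr:
      "\<lbrakk>a \<in> carrier R; x \<in> carrier M; y \<in> carrier M\<rbrakk> \<Longrightarrow>
       a \<odot>\<^bsub>M\<^esub> (x \<oplus>\<^bsub>M\<^esub> y) = a \<odot>\<^bsub>M\<^esub> x \<oplus>\<^bsub>M\<^esub> a \<odot>\<^bsub>M\<^esub> y"
    and smult_assoc:
      "\<lbrakk>a \<in> carrier R; b \<in> carrier R; x \<in> carrier M\<rbrakk> \<Longrightarrow>
       (a \<otimes> b) \<odot>\<^bsub>M\<^esub> x = a \<odot>\<^bsub>M\<^esub> (b \<odot>\<^bsub>M\<^esub> x)"
    and smult_one: "x \<in> carrier M \<Longrightarrow> \<one> \<odot>\<^bsub>M\<^esub> x = x"

text \<open>Homomorphisms are extensional, so equality of morphisms is equality of functions.\<close>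

definition left_hom ::
    "('r, 'c) ring_scheme \<Rightarrow> ('r, 'm, 'd) module_scheme \<Rightarrow> ('r, 'n, 'e) module_scheme \<Rightarrow> ('m \<Rightarrow> 'n) set"
  where
  "left_hom R M N =
     {f \<in> carrier M \<rightarrow>\<^sub>E carrier N.
        (\<forall>x\<in>carrier M. \<forall>y\<in>carrier M. f (x \<oplus>\<^bsub>M\<^esub> y) = f x \<oplus>\<^bsub>N\<^esub> f y) \<and>
        (\<forall>a\<in>carrier R. \<forall>x\<in>carrier M. f (a \<odot>\<^bsub>M\<^esub> x) = a \<odot>\<^bsub>N\<^esub> f x)}"

text \<open>
  A functor from left modules carried by subsets of \<open>'m\<close> to left modules carried by subsets of
  \<open>'n\<close>; \<open>fmap F M N f\<close> is the image of \<open>f : M \<rightarrow> N\<close>.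
\<close>

record ('r, 'm, 's, 'n) mod_functor =
  fobj :: "('r, 'm) module \<Rightarrow> ('s, 'n) module"
  fmap :: "('r, 'm) module \<Rightarrow> ('r, 'm) module \<Rightarrow> ('m \<Rightarrow> 'm) \<Rightarrow> ('n \<Rightarrow> 'n)"

definition is_functor :: "'r ring \<Rightarrow> 's ring \<Rightarrow> ('r, 'm, 's, 'n) mod_functor \<Rightarrow> bool" where
  "is_functor R S F \<longleftrightarrow>
     (\<forall>M. left_module R M \<longrightarrow> left_module S (fobj F M)) \<and>
     (\<forall>M N f. left_module R M \<longrightarrow> left_module R N \<longrightarrow> f \<in> left_hom R M N \<longrightarrow>
        fmap F M N f \<in> left_hom S (fobj F M) (fobj F N)) \<and>
     (\<forall>M. left_module R M \<longrightarrow>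
        fmap F M M (\<lambda>x\<in>carrier M. x) = (\<lambda>x\<in>carrier (fobj F M). x)) \<and>
     (\<forall>M N L f g. left_module R M \<longrightarrow> left_module R N \<longrightarrow> left_module R L \<longrightarrow>
        f \<in> left_hom R M N \<longrightarrow> g \<in> left_hom R N L \<longrightarrow>
        fmap F M L (compose (carrier M) g f) =
        compose (carrier (fobj F M)) (fmap F N L g) (fmap F M N f))"

definition functorial_iso ::
    "'r ring \<Rightarrow> 's ring \<Rightarrow> ('r, 'm, 's, 'n) mod_functor \<Rightarrow> ('r, 'm, 's, 'p) mod_functor \<Rightarrow> bool" where
  "functorial_iso R S F G \<longleftrightarrow> is_functor R S F \<and> is_functor R S G \<and>
     (\<exists>\<eta>.
       (\<forall>M. left_module R M \<longrightarrow>
          \<eta> M \<in> left_hom S (fobj F M) (fobj G M) \<and>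
          bij_betw (\<eta> M) (carrier (fobj F M)) (carrier (fobj G M))) \<and>
       (\<forall>M N f. left_module R M \<longrightarrow> left_module R N \<longrightarrow> f \<in> left_hom R M N \<longrightarrow>
          compose (carrier (fobj F M)) (\<eta> N) (fmap F M N f) =
          compose (carrier (fobj F M)) (fmap G M N f) (\<eta> M)))"

definition id_functor :: "('r, 'm, 'r, 'm) mod_functor" where
  "id_functor = \<lparr>fobj = \<lambda>M. M, fmap = \<lambda>M N f. f\<rparr>"

definition comp_functor ::
    "('s, 'n, 't, 'p) mod_functor \<Rightarrow> ('r, 'm, 's, 'n) mod_functor \<Rightarrow> ('r, 'm, 't, 'p) mod_functor" where
  "comp_functor G F =
     \<lparr>fobj = \<lambda>M. fobj G (fobj F M),
      fmap = \<lambda>M N f. fmap G (fobj F M) (fobj F N) (fmap F M N f)\<rparr>"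


section \<open>Bimodules, tensor and Hom functors\<close>

record ('r, 's, 'p) bimodule = "('r, 'p) module" +
  ract :: "'p \<Rightarrow> 's \<Rightarrow> 'p"

text \<open>
  \<open>P \<otimes>\<^sub>S N\<close> is the free abelian group on \<open>P \<times> N\<close> modulo the subgroup generated by the
  bilinearity and balancing relations.
\<close>

definition tensor_relations ::
    "'s ring \<Rightarrow> ('r, 's, 'p) bimodule \<Rightarrow> ('s, 'n) module \<Rightarrow> (('p \<times> 'n) \<Rightarrow>\<^sub>0 int) set" where
  "tensor_relations S P N =
     {frag_of (p \<oplus>\<^bsub>P\<^esub> p', x) - frag_of (p, x) - frag_of (p', x) |p p' x.
        p \<in> carrier P \<and> p' \<in> carrier P \<and> x \<in> carrier N} \<union>
     {frag_of (p, x \<oplus>\<^bsub>N\<^esub> x') - frag_of (p, x) - frag_of (p, x') |p x x'.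
        p \<in> carrier P \<and> x \<in> carrier N \<and> x' \<in> carrier N} \<union>
     {frag_of (ract P p s, x) - frag_of (p, s \<odot>\<^bsub>N\<^esub> x) |p s x.
        p \<in> carrier P \<and> s \<in> carrier S \<and> x \<in> carrier N}"

definition tensor_kernel ::
    "'s ring \<Rightarrow> ('r, 's, 'p) bimodule \<Rightarrow> ('s, 'n) module \<Rightarrow> (('p \<times> 'n) \<Rightarrow>\<^sub>0 int) set" where
  "tensor_kernel S P N =
     generate (free_Abelian_group (carrier P \<times> carrier N)) (tensor_relations S P N)"

text \<open>
  \<open>induced_map K A h T\<close> is the map of quotients \<open>\<int>[A'] / K' \<rightarrow> \<int>[A] / K\<close> induced by a map \<open>h\<close> of
  generators \<open>A' \<rightarrow> A\<close>, applied to a coset \<open>T\<close>.  When it is well defined, all cosets in the union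
  coincide.
\<close>

definition induced_map ::
    "('b \<Rightarrow>\<^sub>0 int) set \<Rightarrow> 'b set \<Rightarrow> ('a \<Rightarrow> 'b) \<Rightarrow> ('a \<Rightarrow>\<^sub>0 int) set \<Rightarrow> ('b \<Rightarrow>\<^sub>0 int) set" where
  "induced_map K A h T =
     (\<Union>t\<in>T. K #>\<^bsub>free_Abelian_group A\<^esub> frag_extend (\<lambda>a. frag_of (h a)) t)"

definition tensor_module ::
    "'s ring \<Rightarrow> ('r, 's, 'p) bimodule \<Rightarrow> ('s, 'n) module \<Rightarrow> ('r, (('p \<times> 'n) \<Rightarrow>\<^sub>0 int) set) module" where
  "tensor_module S P N =
     (let A = carrier P \<times> carrier N; K = tensor_kernel S P N; T = free_Abelian_group A Mod K
      in \<lparr>carrier = carrier T, monoid.mult = undefined, monoid.one = undefined,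
          ring.zero = \<one>\<^bsub>T\<^esub>, ring.add = monoid.mult T,
          smult = (\<lambda>r. induced_map K A (\<lambda>(p, x). (r \<odot>\<^bsub>P\<^esub> p, x)))\<rparr>)"

definition tensor_functor ::
    "'s ring \<Rightarrow> ('r, 's, 'p) bimodule \<Rightarrow> ('s, 'n, 'r, (('p \<times> 'n) \<Rightarrow>\<^sub>0 int) set) mod_functor" where
  "tensor_functor S P =
     \<lparr>fobj = tensor_module S P,
      fmap = \<lambda>M N f. restrict
              (induced_map (tensor_kernel S P N) (carrier P \<times> carrier N) (\<lambda>(p, x). (p, f x)))
              (carrier (tensor_module S P M))\<rparr>"

text \<open>\<open>Hom\<^sub>R(P, M)\<close> is a left \<open>S\<close>-module via \<open>(s \<cdot> \<phi>)(p) = \<phi>(p \<cdot> s)\<close>.\<close>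

definition hom_module ::
    "'r ring \<Rightarrow> ('r, 's, 'p) bimodule \<Rightarrow> ('r, 'm) module \<Rightarrow> ('s, 'p \<Rightarrow> 'm) module" where
  "hom_module R P M =
     \<lparr>carrier = left_hom R P M, monoid.mult = undefined, monoid.one = undefined,
      ring.zero = (\<lambda>p\<in>carrier P. \<zero>\<^bsub>M\<^esub>), ring.add = (\<lambda>\<phi> \<psi>. \<lambda>p\<in>carrier P. \<phi> p \<oplus>\<^bsub>M\<^esub> \<psi> p),
      smult = (\<lambda>s \<phi>. \<lambda>p\<in>carrier P. \<phi> (ract P p s))\<rparr>"

definition hom_functor ::
    "'r ring \<Rightarrow> ('r, 's, 'p) bimodule \<Rightarrow> ('r, 'm, 's, 'p \<Rightarrow> 'm) mod_functor" where
  "hom_functor R P =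
     \<lparr>fobj = hom_module R P,
      fmap = \<lambda>M N f. \<lambda>\<phi>\<in>left_hom R P M. compose (carrier P) f \<phi>\<rparr>"


section \<open>The bimodules given by the quantum torus, and invariants\<close>

text \<open>\<open>\<H>\<^sup>l\<close>, with \<open>(f \<otimes> w) \<cdot> h = f \<cdot> \<^sup>wh\<close>.\<close>

definition torus_l ::
    "('k, 'v) torus ring \<Rightarrow> (('k, 'v) twisted, ('k, 'v) torus, ('k, 'v) torus) bimodule" where
  "torus_l H =
     \<lparr>carrier = carrier H, monoid.mult = monoid.mult H, monoid.one = monoid.one H,
      ring.zero = ring.zero H, ring.add = ring.add H,
      smult = (\<lambda>F h. \<Sum>w\<in>Poly_Mapping.keys F. Poly_Mapping.lookup F w \<otimes>\<^bsub>H\<^esub> torus_act w h),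
      ract = monoid.mult H\<rparr>"

text \<open>\<open>\<H>\<^sup>r\<close>, with \<open>h \<cdot> (f \<otimes> w)\<close> the image of \<open>hf\<close> under \<open>w\<^sup>-\<^sup>1\<close>.\<close>

definition torus_r ::
    "('k, 'v) torus ring \<Rightarrow> (('k, 'v) torus, ('k, 'v) twisted, ('k, 'v) torus) bimodule" where
  "torus_r H =
     \<lparr>carrier = carrier H, monoid.mult = monoid.mult H, monoid.one = monoid.one H,
      ring.zero = ring.zero H, ring.add = ring.add H,
      smult = monoid.mult H,
      ract = (\<lambda>h F. \<Sum>w\<in>Poly_Mapping.keys F.
                torus_act (inv_into UNIV w) (h \<otimes>\<^bsub>H\<^esub> Poly_Mapping.lookup F w))\<rparr>"

text \<open>
  \<open>M\<^sup>W\<close> as a module over the invariant ring, which acts through \<open>h \<mapsto> h \<otimes> 1\<close>.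
\<close>

definition invariants_module ::
    "('k, 'v) torus ring \<Rightarrow> ('v \<Rightarrow> 'v) set \<Rightarrow> (('k, 'v) twisted, 'm) module \<Rightarrow> (('k, 'v) torus, 'm) module"
  where
  "invariants_module H W M =
     \<lparr>carrier = {m \<in> carrier M. \<forall>w\<in>W. Poly_Mapping.single w \<one>\<^bsub>H\<^esub> \<odot>\<^bsub>M\<^esub> m = m},
      monoid.mult = undefined, monoid.one = undefined,
      ring.zero = ring.zero M, ring.add = ring.add M,
      smult = (\<lambda>h m. Poly_Mapping.single id h \<odot>\<^bsub>M\<^esub> m)\<rparr>"

definition invariants_functor ::
    "('k, 'v) torus ring \<Rightarrow> ('v \<Rightarrow> 'v) set \<Rightarrow> (('k, 'v) twisted, 'm, ('k, 'v) torus, 'm) mod_functor" where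
  "invariants_functor H W =
     \<lparr>fobj = invariants_module H W,
      fmap = \<lambda>M N f. restrict f (carrier (invariants_module H W M))\<rparr>"

text \<open>
  The functors \<open>\<F> = P \<otimes>\<^sub>A -\<close> and \<open>\<I> = Q \<otimes>\<^sub>B -\<close> are mutually quasi-inverse
  equivalences between the categories of left modules.  The two type tokens are the universes in
  which the modules over \<open>A\<close> and over \<open>B\<close> live; as a tensor product lives in a bigger
  type, the functors occur at several type instances.
\<close>

definition morita_equivalent_via ::
    "'m itself \<Rightarrow> 'n itself \<Rightarrow> 'a ring \<Rightarrow> 'b ring \<Rightarrow> ('b, 'a, 'p) bimodule \<Rightarrow> ('a, 'b, 'p) bimodule \<Rightarrow> bool"
  where
  "morita_equivalent_via _ _ A B P Q \<longleftrightarrow>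
     is_functor A B (tensor_functor A P :: ('a, 'm, 'b, _) mod_functor) \<and>
     is_functor B A (tensor_functor B Q :: ('b, 'n, 'a, _) mod_functor) \<and>
     functorial_iso A A
       (comp_functor (tensor_functor B Q) (tensor_functor A P))
       (id_functor :: ('a, 'm, 'a, 'm) mod_functor) \<and>
     functorial_iso B B
       (comp_functor (tensor_functor A P) (tensor_functor B Q))
       (id_functor :: ('b, 'n, 'b, 'n) mod_functor)"

end

theory Submission
  imports Defs
begin

text \<open>
  The rings \<open>\<H>[W]\<close> and \<open>\<H>\<^sup>W\<close> are the two corners of a Morita context. The bimodules \<open>\<H>\<^sup>r\<close> and \<open>\<H>\<^sup>l\<close> carry
  the pairings \<open>\<phi> p q = \<Sum>\<^sub>w w(p q)\<close> with values in \<open>\<H>\<^sup>W\<close> and \<open>\<psi> q p = \<Sum>\<^sub>w q w(p) \<otimes> w\<close> with values in \<open>\<H>[W]\<close>.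
  They are bilinear and balanced, and \<open>p \<cdot> \<psi> q p' = \<phi> p q \<cdot> p'\<close> and \<open>q \<cdot> \<phi> p q' = \<psi> q p \<cdot> q'\<close>.

  In any Morita context whose pairings both generate the unit ideal, the two tensor functors are
  inverse to each other (\<open>tensor_functors_inverse\<close>), \<open>P \<otimes>\<^sub>R M\<close> is isomorphic to \<open>Hom\<^sub>R(Q, M)\<close>
  (\<open>tensor_iso_hom\<close>), and simplicity of one ring implies simplicity of the other
  (\<open>simple_ring_transfer\<close>). The comparison maps send \<open>q \<otimes> p \<otimes> m\<close> to \<open>\<psi> q p \<cdot> m\<close>, and \<open>p \<otimes> m\<close> to the
  homomorphism \<open>q \<mapsto> \<psi> q p \<cdot> m\<close>. Multiplication by a value of a pairing factors through them on either
  side, and since these values generate \<open>1\<close>, the maps are bijective.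

  It remains to see that \<open>1\<close> is reached by both pairings. This is clear for \<open>\<phi>\<close>, as \<open>\<phi> (1/|W|) 1 = 1\<close>. The
  values of \<open>\<psi>\<close> generate a nonzero two-sided ideal, so it is enough that \<open>\<H>[W]\<close> is simple.

  First, \<open>\<H>\<close> is simple: conjugation by monomials acts on the monomials \<open>e\<^sup>x e\<^sup>y\<close> by characters, and these are
  pairwise distinct because the pairing is nondegenerate and \<open>q\<close> is not a root of unity; hence an
  element of smallest support in a nonzero ideal is a monomial (\<open>one_in_torus_ideal\<close>). Next, take an
  element of an ideal of \<open>\<H>[W]\<close> with the fewest components in \<open>W\<close>. Simplicity of \<open>\<H>\<close> allows one
  component to be normalised to \<open>1\<close>. Comparing that element with its products by monomials from both
  sides, chosen to preserve this component, then forces the support of any other component to be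
  stable under a nonzero translation, because \<open>W\<close> acts faithfully on \<open>Y\<close>. As supports are finite, only one component is left (\<open>one_in_twisted_ideal\<close>).

  Finally \<open>Hom(\<H>\<^sup>l, M)\<close> is \<open>M\<^sup>W\<close> by evaluation at \<open>1\<close> (\<open>hom_iso_invariants\<close>).
\<close>

section \<open>Additive maps and module homomorphisms\<close>

definition additive_map :: "('a, 'c) ring_scheme \<Rightarrow> ('b, 'd) ring_scheme \<Rightarrow> ('a \<Rightarrow> 'b) \<Rightarrow> bool" where
  "additive_map M N f \<longleftrightarrow> f \<in> hom (add_monoid M) (add_monoid N)"

lemma additiveI:
  assumes "\<And>x. x \<in> carrier M \<Longrightarrow> f x \<in> carrier N"
    and "\<And>x y. \<lbrakk>x \<in> carrier M; y \<in> carrier M\<rbrakk> \<Longrightarrow> f (x \<oplus>\<^bsub>M\<^esub> y) = f x \<oplus>\<^bsub>N\<^esub> f y"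
  shows "additive_map M N f"
  unfolding additive_map_def by (rule homI) (use assms in auto)

lemma
  assumes "additive_map M N f"
  shows additive_closed: "x \<in> carrier M \<Longrightarrow> f x \<in> carrier N"
    and additive_add: "\<lbrakk>x \<in> carrier M; y \<in> carrier M\<rbrakk> \<Longrightarrow> f (x \<oplus>\<^bsub>M\<^esub> y) = f x \<oplus>\<^bsub>N\<^esub> f y"
  using assms by (auto simp: additive_map_def hom_def)

lemma
  assumes "additive_map M N f" and "abelian_group M" "abelian_group N"
  shows additive_zero: "f \<zero>\<^bsub>M\<^esub> = \<zero>\<^bsub>N\<^esub>"
    and additive_neg: "x \<in> carrier M \<Longrightarrow> f (\<ominus>\<^bsub>M\<^esub> x) = \<ominus>\<^bsub>N\<^esub> f x"
    and additive_minus: "\<lbrakk>x \<in> carrier M; y \<in> carrier M\<rbrakk> \<Longrightarrow> f (x \<ominus>\<^bsub>M\<^esub> y) = f x \<ominus>\<^bsub>N\<^esub> f y"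
proof -
  interpret M: abelian_group M by fact
  interpret N: abelian_group N by fact
  interpret f: group_hom "add_monoid M" "add_monoid N" f
    using assms(1) by (simp add: additive_map_def group_hom_def group_hom_axioms_def M.a_group N.a_group)
  show "f \<zero>\<^bsub>M\<^esub> = \<zero>\<^bsub>N\<^esub>"
    using f.hom_one by simp
  show neg: "f (\<ominus>\<^bsub>M\<^esub> x) = \<ominus>\<^bsub>N\<^esub> f x" if "x \<in> carrier M" for x
    using f.hom_inv[of x] that by (simp add: a_inv_def)
  show "f (x \<ominus>\<^bsub>M\<^esub> y) = f x \<ominus>\<^bsub>N\<^esub> f y" if "x \<in> carrier M" "y \<in> carrier M" for x y
    using that additive_add[OF assms(1), of x "\<ominus>\<^bsub>M\<^esub> y"] by (simp add: a_minus_def neg)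
qed

lemma (in abelian_group) additive_subgroup_minusI:
  assumes "U \<subseteq> carrier G" "\<zero> \<in> U" "\<And>x y. \<lbrakk>x \<in> U; y \<in> U\<rbrakk> \<Longrightarrow> x \<ominus> y \<in> U"
  shows "subgroup U (add_monoid G)"
proof -
  have inv: "\<ominus> x \<in> U" if "x \<in> U" for x
    using assms(3)[OF assms(2) that] assms(1) that by (simp add: a_minus_def subset_iff)
  have add: "x \<oplus> y \<in> U" if "x \<in> U" "y \<in> U" for x y
    using assms(3)[OF that(1) inv[OF that(2)]] assms(1) that by (simp add: a_minus_def subset_iff)
  show ?thesis
    by (rule subgroup.intro) (use assms(1,2) add inv in \<open>auto simp: a_inv_def\<close>)
qed

text \<open>
  Scalars with a given property often form an additive subgroup. Membership of \<open>1\<close> then only has to be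
  checked on additive generators, so no expression of \<open>1\<close> as a sum of generators has to be chosen.
\<close>

lemma (in abelian_group) generate_additive_minimal:
  assumes "g \<in> generate (add_monoid G) S" "S \<subseteq> U"
    and "U \<subseteq> carrier G" "\<zero> \<in> U" "\<And>x y. \<lbrakk>x \<in> U; y \<in> U\<rbrakk> \<Longrightarrow> x \<ominus> y \<in> U"
  shows "g \<in> U"
  using add.generate_subgroup_incl[OF assms(2) additive_subgroup_minusI[OF assms(3-5)]] assms(1)
  by auto

lemma left_homI:
  assumes "additive_map M N f" "f \<in> extensional (carrier M)"
    and "\<And>a x. \<lbrakk>a \<in> carrier R; x \<in> carrier M\<rbrakk> \<Longrightarrow> f (a \<odot>\<^bsub>M\<^esub> x) = a \<odot>\<^bsub>N\<^esub> f x"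
  shows "f \<in> left_hom R M N"
  using assms by (auto simp: left_hom_def additive_map_def hom_def PiE_def)

lemma
  assumes "f \<in> left_hom R M N"
  shows left_hom_additive: "additive_map M N f"
    and left_hom_closed: "x \<in> carrier M \<Longrightarrow> f x \<in> carrier N"
    and left_hom_smult: "\<lbrakk>a \<in> carrier R; x \<in> carrier M\<rbrakk> \<Longrightarrow> f (a \<odot>\<^bsub>M\<^esub> x) = a \<odot>\<^bsub>N\<^esub> f x"
    and left_hom_extensional: "f \<in> extensional (carrier M)"
  using assms by (auto simp: left_hom_def additive_map_def hom_def PiE_def)

lemma (in left_module) additive_smult:
  "a \<in> carrier R \<Longrightarrow> additive_map M M (\<lambda>x. a \<odot>\<^bsub>M\<^esub> x)"
  by (rule additiveI) (auto simp: smult_closed smult_r_distr)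

lemma (in left_module) additive_scalar:
  "x \<in> carrier M \<Longrightarrow> additive_map R M (\<lambda>a. a \<odot>\<^bsub>M\<^esub> x)"
  by (rule additiveI) (auto simp: smult_closed smult_l_distr)

lemma additive_id: "additive_map M M (\<lambda>x. x)"
  by (simp add: additive_map_def hom_def)

lemma additive_compose:
  "\<lbrakk>additive_map M N f; additive_map N L g\<rbrakk> \<Longrightarrow> additive_map M L (\<lambda>x. g (f x))"
  by (simp add: additive_map_def hom_def Pi_iff)

lemma additive_sum:
  assumes "additive_map M N f" "additive_map M N g" "abelian_group N"
  shows "additive_map M N (\<lambda>x. f x \<oplus>\<^bsub>N\<^esub> g x)"
proof -
  interpret N: abelian_group N by fact
  show ?thesis
    by (rule additiveI)
       (simp_all add: additive_closed[OF assms(1)] additive_closed[OF assms(2)]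
         additive_add[OF assms(1)] additive_add[OF assms(2)] N.a_ac)
qed

lemma additive_restrict:
  assumes "abelian_group M"
  shows "additive_map M N (restrict f (carrier M)) \<longleftrightarrow> additive_map M N f"
proof -
  interpret M: abelian_group M by fact
  show ?thesis by (auto simp: additive_map_def hom_def Pi_iff)
qed

lemma left_module_abelian_group: "left_module R M \<Longrightarrow> abelian_group M"
  by (simp add: left_module_def)

lemma additive_map_image:
  assumes "additive_map M N f" and "abelian_group M" "abelian_group N"
  shows "subgroup (f ` carrier M) (add_monoid N)"
proof -
  interpret f: group_hom "add_monoid M" "add_monoid N" f
    using assms by (simp add: additive_map_def group_hom_def group_hom_axioms_def abelian_group.a_group)
  show ?thesis using f.img_is_subgroup by simp
qed

lemma left_hom_eqI:
  assumes "f \<in> left_hom R M N" "g \<in> left_hom R M N" "\<And>x. x \<in> carrier M \<Longrightarrow> f x = g x"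
  shows "f = g"
  by (rule extensionalityI[OF left_hom_extensional[OF assms(1)] left_hom_extensional[OF assms(2)] assms(3)])

lemma left_hom_restrictI:
  assumes M: "left_module R M" and "additive_map M N f"
    and "\<And>a x. \<lbrakk>a \<in> carrier R; x \<in> carrier M\<rbrakk> \<Longrightarrow> f (a \<odot>\<^bsub>M\<^esub> x) = a \<odot>\<^bsub>N\<^esub> f x"
  shows "restrict f (carrier M) \<in> left_hom R M N"
  by (rule left_homI)
     (use assms in \<open>auto simp: additive_restrict left_module_abelian_group left_module.smult_closed\<close>)

lemma left_hom_compose:
  assumes M: "left_module R M" and f: "f \<in> left_hom R M N" and g: "g \<in> left_hom R N L"
  shows "compose (carrier M) g f \<in> left_hom R M L"
  unfolding compose_def
  by (rule left_hom_restrictI[OF M additive_compose[OF left_hom_additive[OF f] left_hom_additive[OF g]]])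
     (simp add: left_hom_smult[OF f] left_hom_smult[OF g] left_hom_closed[OF f])

lemma (in ring)
  assumes "x \<in> carrier R" "y \<in> carrier R" "z \<in> carrier R"
  shows right_diff_distr: "x \<otimes> (y \<ominus> z) = x \<otimes> y \<ominus> x \<otimes> z"
    and left_diff_distr: "(y \<ominus> z) \<otimes> x = y \<otimes> x \<ominus> z \<otimes> x"
  using assms by (simp_all add: a_minus_def l_distr r_distr l_minus r_minus)

section \<open>Functors between module categories\<close>

lemma is_functor_id: "is_functor R R id_functor"
  by (simp add: is_functor_def id_functor_def)

lemma is_functor_comp:
  assumes "is_functor R S F" "is_functor S T G"
  shows "is_functor R T (comp_functor G F)"
  using assms unfolding is_functor_def comp_functor_def by simp

text \<open>
  Morphisms are extensional functions, so it is the restrictions of the \<open>\<theta> M\<close> to the carriers that form the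
  natural isomorphism.
\<close>

lemma functorial_isoI:
  fixes F :: "('r, 'm, 's, 'n) mod_functor" and G :: "('r, 'm, 's, 'p) mod_functor"
  assumes F: "is_functor R S F" and G: "is_functor R S G"
    and add: "\<And>M. left_module R M \<Longrightarrow> additive_map (fobj F M) (fobj G M) (\<theta> M)"
    and smult: "\<And>M a t. \<lbrakk>left_module R M; a \<in> carrier S; t \<in> carrier (fobj F M)\<rbrakk> \<Longrightarrow>
        \<theta> M (a \<odot>\<^bsub>fobj F M\<^esub> t) = a \<odot>\<^bsub>fobj G M\<^esub> \<theta> M t"
    and bij: "\<And>M. left_module R M \<Longrightarrow> bij_betw (\<theta> M) (carrier (fobj F M)) (carrier (fobj G M))"
    and natural: "\<And>M N f t. \<lbrakk>left_module R M; left_module R N; f \<in> left_hom R M N; t \<in> carrier (fobj F M)\<rbrakk> \<Longrightarrow>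
        \<theta> N (fmap F M N f t) = fmap G M N f (\<theta> M t)"
  shows "functorial_iso R S F G"
  unfolding functorial_iso_def
proof (intro conjI F G exI[of _ "\<lambda>M. restrict (\<theta> M) (carrier (fobj F M))"] allI impI)
  fix M :: "('r, 'm) module" assume M: "left_module R M"
  have FM: "left_module S (fobj F M)"
    using F M by (simp add: is_functor_def)
  interpret FM: left_module S "fobj F M" by (rule FM)
  show "restrict (\<theta> M) (carrier (fobj F M)) \<in> left_hom S (fobj F M) (fobj G M)"
    by (rule left_homI)
       (use M in \<open>auto simp: additive_restrict left_module_abelian_group[OF FM] add smult FM.smult_closed\<close>)
  show "bij_betw (restrict (\<theta> M) (carrier (fobj F M))) (carrier (fobj F M)) (carrier (fobj G M))"
    using bij[OF M] by (simp cong: bij_betw_cong)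
next
  fix M N :: "('r, 'm) module" and f
  assume M: "left_module R M" and N: "left_module R N" and f: "f \<in> left_hom R M N"
  have "fmap F M N f \<in> left_hom S (fobj F M) (fobj F N)"
    using F M N f by (simp add: is_functor_def)
  then have "fmap F M N f t \<in> carrier (fobj F N)" if "t \<in> carrier (fobj F M)" for t
    using that by (rule left_hom_closed)
  then show "compose (carrier (fobj F M)) (restrict (\<theta> N) (carrier (fobj F N))) (fmap F M N f) =
      compose (carrier (fobj F M)) (fmap G M N f) (restrict (\<theta> M) (carrier (fobj F M)))"
    using natural[OF M N f] by (auto simp: compose_def)
qed

lemma fobj_tensor_functor [simp]: "fobj (tensor_functor S P) = tensor_module S P"
  by (simp add: tensor_functor_def)

lemma fobj_hom_functor [simp]: "fobj (hom_functor R P) = hom_module R P"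
  by (simp add: hom_functor_def)

section \<open>Tensor products over a noncommutative ring\<close>

text \<open>
  The image of a coset under a map of generators that respects the relations is a single coset, so
  the union in the definition of \<^const>\<open>induced_map\<close> collapses.
\<close>

lemma induced_map_coset:
  assumes K: "subgroup K (free_Abelian_group A)" and K': "subgroup K' (free_Abelian_group A')"
    and h: "h ` A' \<subseteq> A" and ext: "frag_extend (\<lambda>a. frag_of (h a)) ` K' \<subseteq> K"
    and c: "Poly_Mapping.keys c \<subseteq> A'"
  shows "induced_map K A h (K' #>\<^bsub>free_Abelian_group A'\<^esub> c) =
         K #>\<^bsub>free_Abelian_group A\<^esub> frag_extend (\<lambda>a. frag_of (h a)) c"
proof -
  let ?G = "free_Abelian_group A" and ?e = "frag_extend (\<lambda>a. frag_of (h a))"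
  interpret G: group ?G by simp
  have keys: "Poly_Mapping.keys (?e d) \<subseteq> A" if "Poly_Mapping.keys d \<subseteq> A'" for d
    using keys_frag_extend[of "\<lambda>a. frag_of (h a)" d] that h by fastforce
  have "K #>\<^bsub>?G\<^esub> ?e t = K #>\<^bsub>?G\<^esub> ?e c" if t: "t \<in> K' #>\<^bsub>free_Abelian_group A'\<^esub> c" for t
  proof -
    obtain k where k: "k \<in> K'" "t = k + c"
      using t by (auto simp: r_coset_def)
    have "?e k \<in> K" using k ext by auto
    then have "?e t \<in> K #>\<^bsub>?G\<^esub> ?e c"
      using k by (auto simp: r_coset_def frag_extend_add)
    then show ?thesis
      using G.repr_independence[OF _ _ K, of "?e t" "?e c"] keys[OF c] by simp
  qed
  moreover have "K' #>\<^bsub>free_Abelian_group A'\<^esub> c \<noteq> {}"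
    using subgroup.one_closed[OF K'] by (auto simp: r_coset_def)
  ultimately show ?thesis
    unfolding induced_map_def by blast
qed

text \<open>
  What a left module with right multiplications must satisfy so that tensoring with it produces
  left modules again: the two actions commute.
\<close>

locale tensor_factor = P: left_module R P + S: ring S
  for R :: "'r ring" and S :: "'s ring" and P :: "('r, 's, 'p) bimodule" +
  assumes ract_closed: "\<lbrakk>p \<in> carrier P; s \<in> carrier S\<rbrakk> \<Longrightarrow> ract P p s \<in> carrier P"
    and smult_ract: "\<lbrakk>a \<in> carrier R; p \<in> carrier P; s \<in> carrier S\<rbrakk> \<Longrightarrow>
          a \<odot>\<^bsub>P\<^esub> ract P p s = ract P (a \<odot>\<^bsub>P\<^esub> p) s"

definition pure_tensor ::
    "'s ring \<Rightarrow> ('r, 's, 'p) bimodule \<Rightarrow> ('s, 'n) module \<Rightarrow> 'p \<Rightarrow> 'n \<Rightarrow> (('p \<times> 'n) \<Rightarrow>\<^sub>0 int) set" where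
  "pure_tensor S P N p x =
     tensor_kernel S P N #>\<^bsub>free_Abelian_group (carrier P \<times> carrier N)\<^esub> frag_of (p, x)"

locale tensor_product = tensor_factor R S P + N: left_module S N
  for R :: "'r ring" and S :: "'s ring" and P :: "('r, 's, 'p) bimodule" and N :: "('s, 'n) module"
begin

abbreviation "A \<equiv> carrier P \<times> carrier N"
abbreviation "G \<equiv> free_Abelian_group A"
abbreviation "K \<equiv> tensor_kernel S P N"
abbreviation "T \<equiv> tensor_module S P N"
abbreviation "pure \<equiv> pure_tensor S P N"

lemma diff_closed: "\<lbrakk>c \<in> carrier G; d \<in> carrier G\<rbrakk> \<Longrightarrow> c - d \<in> carrier G"
  using keys_diff[of c d] by auto

lemma relations_incl: "tensor_relations S P N \<subseteq> carrier G"
  unfolding tensor_relations_def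
  by (auto intro!: diff_closed ract_closed N.smult_closed simp del: carrier_free_Abelian_group_iff)

lemma kernel_subgroup: "subgroup K G"
  unfolding tensor_kernel_def
  by (rule group.generate_is_subgroup[OF group_free_Abelian_group relations_incl])

lemma kernel_normal: "K \<lhd> G"
  by (rule comm_group.subgroup_imp_normal[OF abelian_free_Abelian_group kernel_subgroup])

lemma carrier_tensor: "carrier T = (\<lambda>c. K #>\<^bsub>G\<^esub> c) ` carrier G"
  by (auto simp: tensor_module_def FactGroup_def RCOSETS_def Let_def)

lemma add_coset:
  "\<lbrakk>c \<in> carrier G; d \<in> carrier G\<rbrakk> \<Longrightarrow> (K #>\<^bsub>G\<^esub> c) \<oplus>\<^bsub>T\<^esub> (K #>\<^bsub>G\<^esub> d) = K #>\<^bsub>G\<^esub> (c + d)"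
  using normal.rcos_sum[OF kernel_normal, of c d]
  by (simp add: tensor_module_def FactGroup_def Let_def)

lemma zero_coset: "\<zero>\<^bsub>T\<^esub> = K #>\<^bsub>G\<^esub> 0"
  using group.coset_mult_one[OF group_free_Abelian_group, of K A] subgroup.subset[OF kernel_subgroup]
  by (simp add: tensor_module_def FactGroup_def Let_def)

lemma tensor_quotient:
  "carrier T = carrier (G Mod K)" "ring.add T = monoid.mult (G Mod K)" "\<zero>\<^bsub>T\<^esub> = \<one>\<^bsub>G Mod K\<^esub>"
  by (simp_all add: tensor_module_def Let_def)

lemma tensor_abelian_group: "abelian_group T"
proof -
  interpret Q: comm_group "G Mod K"
    by (rule comm_group.abelian_FactGroup[OF abelian_free_Abelian_group kernel_subgroup])
  show ?thesis
    by (rule abelian_groupI) (auto simp: tensor_quotient Q.m_ac intro: Q.l_inv_ex simp del: carrier_FactGroup mult_FactGroup one_FactGroup)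
qed

lemma pure_closed: "\<lbrakk>p \<in> carrier P; x \<in> carrier N\<rbrakk> \<Longrightarrow> pure p x \<in> carrier T"
  by (auto simp: carrier_tensor pure_tensor_def)

lemma coset_minus:
  assumes "c \<in> carrier G" "d \<in> carrier G"
  shows "(K #>\<^bsub>G\<^esub> c) \<ominus>\<^bsub>T\<^esub> (K #>\<^bsub>G\<^esub> d) = K #>\<^bsub>G\<^esub> (c - d)"
proof -
  interpret T: abelian_group T by (rule tensor_abelian_group)
  have cd: "c - d \<in> carrier G"
    using assms keys_diff[of c d] by auto
  have "(K #>\<^bsub>G\<^esub> (c - d)) \<oplus>\<^bsub>T\<^esub> (K #>\<^bsub>G\<^esub> d) = K #>\<^bsub>G\<^esub> c"
    using add_coset[OF cd assms(2)] by simp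
  moreover have "K #>\<^bsub>G\<^esub> (c - d) \<in> carrier T" "K #>\<^bsub>G\<^esub> d \<in> carrier T"
    using cd assms by (auto simp: carrier_tensor simp del: carrier_free_Abelian_group_iff)
  ultimately show ?thesis
    by (metis T.a_assoc T.a_inv_closed T.r_neg T.r_zero a_minus_def)
qed

text \<open>
  The pure tensors generate the tensor product as an abelian group. Closure
  under differences accounts for negative coefficients in the free abelian group.
\<close>

lemma tensor_induct [consumes 1, case_names zero pure minus]:
  assumes t: "t \<in> carrier T"
    and "Q \<zero>\<^bsub>T\<^esub>" "\<And>p x. \<lbrakk>p \<in> carrier P; x \<in> carrier N\<rbrakk> \<Longrightarrow> Q (pure p x)"
    and minus: "\<And>s t. \<lbrakk>s \<in> carrier T; t \<in> carrier T; Q s; Q t\<rbrakk> \<Longrightarrow> Q (s \<ominus>\<^bsub>T\<^esub> t)"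
  shows "Q t"
proof -
  obtain c where c: "Poly_Mapping.keys c \<subseteq> A" "t = K #>\<^bsub>G\<^esub> c"
    using t by (auto simp: carrier_tensor)
  from c(1) have "Q (K #>\<^bsub>G\<^esub> c)"
  proof (induction c rule: free_Abelian_group_induct[consumes 1, case_names zero diff of])
    case zero
    show ?case using assms(2) by (simp add: zero_coset)
  next
    case (diff x y)
    then show ?case
      using minus[of "K #>\<^bsub>G\<^esub> x" "K #>\<^bsub>G\<^esub> y"] coset_minus[of x y] by (auto simp: carrier_tensor)
  next
    case (of a)
    then show ?case
      using assms(3)[of "fst a" "snd a"] by (auto simp: pure_tensor_def)
  qed
  with c show ?thesis by simp
qed

lemma kernel_relation: "r \<in> tensor_relations S P N \<Longrightarrow> r \<in> K"
  unfolding tensor_kernel_def by (rule generate.incl)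

lemma coset_eqI:
  assumes "c - d \<in> tensor_relations S P N" "d \<in> carrier G"
  shows "K #>\<^bsub>G\<^esub> c = K #>\<^bsub>G\<^esub> d"
proof -
  have "c = (c - d) + d" by simp
  then have "c \<in> K #>\<^bsub>G\<^esub> d"
    using kernel_relation[OF assms(1)] unfolding r_coset_def mult_free_Abelian_group by blast
  then show ?thesis
    using group.repr_independence[OF group_free_Abelian_group _ _ kernel_subgroup] assms(2) by metis
qed

lemma pure_add_left:
  assumes "p \<in> carrier P" "p' \<in> carrier P" "x \<in> carrier N"
  shows "pure (p \<oplus>\<^bsub>P\<^esub> p') x = pure p x \<oplus>\<^bsub>T\<^esub> pure p' x"
proof -
  have "K #>\<^bsub>G\<^esub> frag_of (p \<oplus>\<^bsub>P\<^esub> p', x) = K #>\<^bsub>G\<^esub> (frag_of (p, x) + frag_of (p', x))"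
  proof (rule coset_eqI)
    show "frag_of (p \<oplus>\<^bsub>P\<^esub> p', x) - (frag_of (p, x) + frag_of (p', x)) \<in> tensor_relations S P N"
      unfolding tensor_relations_def diff_diff_eq[symmetric] using assms by blast
    show "frag_of (p, x) + frag_of (p', x) \<in> carrier G"
      using assms keys_add[of "frag_of (p, x)" "frag_of (p', x)"] by fastforce
  qed
  then show ?thesis
    using assms add_coset[of "frag_of (p, x)" "frag_of (p', x)"] by (simp add: pure_tensor_def)
qed

lemma pure_add_right:
  assumes "p \<in> carrier P" "x \<in> carrier N" "x' \<in> carrier N"
  shows "pure p (x \<oplus>\<^bsub>N\<^esub> x') = pure p x \<oplus>\<^bsub>T\<^esub> pure p x'"
proof -
  have "K #>\<^bsub>G\<^esub> frag_of (p, x \<oplus>\<^bsub>N\<^esub> x') = K #>\<^bsub>G\<^esub> (frag_of (p, x) + frag_of (p, x'))"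
  proof (rule coset_eqI)
    show "frag_of (p, x \<oplus>\<^bsub>N\<^esub> x') - (frag_of (p, x) + frag_of (p, x')) \<in> tensor_relations S P N"
      unfolding tensor_relations_def diff_diff_eq[symmetric] using assms by blast
    show "frag_of (p, x) + frag_of (p, x') \<in> carrier G"
      using assms keys_add[of "frag_of (p, x)" "frag_of (p, x')"] by fastforce
  qed
  then show ?thesis
    using assms add_coset[of "frag_of (p, x)" "frag_of (p, x')"] by (simp add: pure_tensor_def)
qed

lemma pure_balanced:
  assumes "p \<in> carrier P" "s \<in> carrier S" "x \<in> carrier N"
  shows "pure (ract P p s) x = pure p (s \<odot>\<^bsub>N\<^esub> x)"
  unfolding pure_tensor_def
proof (rule coset_eqI)
  show "frag_of (ract P p s, x) - frag_of (p, s \<odot>\<^bsub>N\<^esub> x) \<in> tensor_relations S P N"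
    unfolding tensor_relations_def using assms by blast
  show "frag_of (p, s \<odot>\<^bsub>N\<^esub> x) \<in> carrier G"
    using assms N.smult_closed by simp
qed

text \<open>
  Every identity between maps out of a tensor product is reduced to pure tensors in this way.
\<close>

lemma additive_ext:
  assumes "additive_map T D f" "additive_map T D g" "abelian_group D"
    and "\<And>p x. \<lbrakk>p \<in> carrier P; x \<in> carrier N\<rbrakk> \<Longrightarrow> f (pure p x) = g (pure p x)"
    and "t \<in> carrier T"
  shows "f t = g t"
  using assms(5)
proof (induction t rule: tensor_induct)
  case zero
  show ?case
    using additive_zero[OF assms(1) tensor_abelian_group assms(3)]
      additive_zero[OF assms(2) tensor_abelian_group assms(3)] by simp
next
  case (minus s t)
  then show ?case
    using additive_minus[OF assms(1) tensor_abelian_group assms(3)]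
      additive_minus[OF assms(2) tensor_abelian_group assms(3)] by simp
qed (rule assms(4))

text \<open>
  The universal property: a balanced biadditive map kills the defining relations, hence the subgroup
  that they generate, and factors through the quotient.
\<close>

lemma lift_exists:
  assumes D: "abelian_group D"
    and closed: "\<And>p x. \<lbrakk>p \<in> carrier P; x \<in> carrier N\<rbrakk> \<Longrightarrow> \<beta> p x \<in> carrier D"
    and left: "\<And>p p' x. \<lbrakk>p \<in> carrier P; p' \<in> carrier P; x \<in> carrier N\<rbrakk> \<Longrightarrow>
        \<beta> (p \<oplus>\<^bsub>P\<^esub> p') x = \<beta> p x \<oplus>\<^bsub>D\<^esub> \<beta> p' x"
    and right: "\<And>p x x'. \<lbrakk>p \<in> carrier P; x \<in> carrier N; x' \<in> carrier N\<rbrakk> \<Longrightarrow>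
        \<beta> p (x \<oplus>\<^bsub>N\<^esub> x') = \<beta> p x \<oplus>\<^bsub>D\<^esub> \<beta> p x'"
    and bal: "\<And>p s x. \<lbrakk>p \<in> carrier P; s \<in> carrier S; x \<in> carrier N\<rbrakk> \<Longrightarrow>
        \<beta> (ract P p s) x = \<beta> p (s \<odot>\<^bsub>N\<^esub> x)"
  shows "\<exists>g. additive_map T D g \<and> (\<forall>p\<in>carrier P. \<forall>x\<in>carrier N. g (pure p x) = \<beta> p x)"
proof -
  interpret D: abelian_group D by fact
  have "(\<lambda>(p, x). \<beta> p x) ` A \<subseteq> carrier (add_monoid D)"
    using closed by auto
  then obtain h where h: "h \<in> hom G (add_monoid D)"
    and h_of: "\<And>a. a \<in> A \<Longrightarrow> h (frag_of a) = (\<lambda>(p, x). \<beta> p x) a"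
    by (rule comm_group.free_Abelian_group_universal[OF D.a_comm_group]) blast
  interpret h: group_hom G "add_monoid D" h
    by (simp add: group_hom_def group_hom_axioms_def D.a_group h)
  have h_diff: "h (c - d) = h c \<ominus>\<^bsub>D\<^esub> h d" if "c \<in> carrier G" "d \<in> carrier G" for c d
  proof -
    have "h (c \<otimes>\<^bsub>G\<^esub> inv\<^bsub>G\<^esub> d) = h c \<oplus>\<^bsub>D\<^esub> (\<ominus>\<^bsub>D\<^esub> h d)"
      using that h.hom_mult[of c "inv\<^bsub>G\<^esub> d"] h.hom_inv[of d] by (simp add: a_inv_def)
    then show ?thesis
      using that by (simp add: a_minus_def)
  qed
  have h_diff2: "h (frag_of a - frag_of b - frag_of c) = h (frag_of a) \<ominus>\<^bsub>D\<^esub> h (frag_of b) \<ominus>\<^bsub>D\<^esub> h (frag_of c)"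
    if "a \<in> A" "b \<in> A" "c \<in> A" for a b c
  proof -
    have "frag_of a - frag_of b \<in> carrier G"
      using that keys_diff[of "frag_of a" "frag_of b"] by fastforce
    then show ?thesis using that by (simp add: h_diff del: carrier_free_Abelian_group_iff)
  qed
  have cancel: "d \<oplus>\<^bsub>D\<^esub> d' \<ominus>\<^bsub>D\<^esub> d \<ominus>\<^bsub>D\<^esub> d' = \<zero>\<^bsub>D\<^esub>" "d \<ominus>\<^bsub>D\<^esub> d = \<zero>\<^bsub>D\<^esub>"
    if "d \<in> carrier D" "d' \<in> carrier D" for d d'
    using that by (simp_all add: a_minus_def D.a_ac D.r_neg D.r_neg1 D.r_neg2)
  have "r \<in> kernel G (add_monoid D) h" if r: "r \<in> tensor_relations S P N" for r
  proof -
    have "h r = \<zero>\<^bsub>D\<^esub>"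
      using r unfolding tensor_relations_def
      by (auto simp: h_diff h_diff2 h_of left right bal closed cancel(1) ract_closed N.smult_closed
          intro!: cancel(2))
    then show ?thesis
      using r relations_incl by (auto simp: kernel_def simp del: carrier_free_Abelian_group_iff)
  qed
  then have "K \<subseteq> kernel G (add_monoid D) h"
    unfolding tensor_kernel_def
    by (intro h.generate_subgroup_incl subsetI h.subgroup_kernel) auto
  from h.FactGroup_universal_kernel[OF kernel_normal this]
  obtain g where g: "g \<in> hom (G Mod K) (add_monoid D)"
    and g_of: "\<And>x. x \<in> carrier G \<Longrightarrow> g (K #>\<^bsub>G\<^esub> x) = h x" by blast
  have "additive_map T D g"
    using g by (simp add: additive_map_def hom_def tensor_quotient)
  moreover have "g (pure p x) = \<beta> p x" if "p \<in> carrier P" "x \<in> carrier N" for p x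
    using that by (simp add: pure_tensor_def g_of h_of)
  ultimately show ?thesis by blast
qed

end

section \<open>The tensor functor\<close>

text \<open>
  Functoriality in both factors at once. The choice \<open>\<alpha> = id\<close> gives the action of the tensor functor on
  morphisms, and \<open>f = id\<close> with \<open>\<alpha>\<close> a scalar multiplication gives the module structure.
\<close>

lemma
  assumes M: "tensor_product R S P M" and N: "tensor_product R S P N"
    and \<alpha>: "additive_map P P \<alpha>" "\<And>p s. \<lbrakk>p \<in> carrier P; s \<in> carrier S\<rbrakk> \<Longrightarrow> \<alpha> (ract P p s) = ract P (\<alpha> p) s"
    and f: "additive_map M N f" "\<And>s x. \<lbrakk>s \<in> carrier S; x \<in> carrier M\<rbrakk> \<Longrightarrow> f (s \<odot>\<^bsub>M\<^esub> x) = s \<odot>\<^bsub>N\<^esub> f x"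
  shows induced_map_additive:
      "additive_map (tensor_module S P M) (tensor_module S P N)
         (induced_map (tensor_kernel S P N) (carrier P \<times> carrier N) (\<lambda>(p, x). (\<alpha> p, f x)))"
    and induced_map_pure:
      "\<lbrakk>p \<in> carrier P; x \<in> carrier M\<rbrakk> \<Longrightarrow>
       induced_map (tensor_kernel S P N) (carrier P \<times> carrier N) (\<lambda>(p, x). (\<alpha> p, f x))
         (pure_tensor S P M p x) = pure_tensor S P N (\<alpha> p) (f x)"
proof -
  interpret M: tensor_product R S P M by fact
  interpret N: tensor_product R S P N by fact
  let ?h = "\<lambda>(p, x). (\<alpha> p, f x)"
  let ?e = "frag_extend (\<lambda>a. frag_of (?h a))"
  have h: "?h ` M.A \<subseteq> N.A"
    using additive_closed[OF \<alpha>(1)] additive_closed[OF f(1)] by auto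
  have keys: "?e c \<in> carrier N.G" if "c \<in> carrier M.G" for c
    using keys_frag_extend[of "\<lambda>a. frag_of (?h a)" c] that h by fastforce
  have rel: "?e ` tensor_relations S P M \<subseteq> tensor_relations S P N"
  proof (rule image_subsetI)
    fix r assume "r \<in> tensor_relations S P M"
    then consider
        (left) p p' x where "r = frag_of (p \<oplus>\<^bsub>P\<^esub> p', x) - frag_of (p, x) - frag_of (p', x)"
          "p \<in> carrier P" "p' \<in> carrier P" "x \<in> carrier M"
      | (right) p x x' where "r = frag_of (p, x \<oplus>\<^bsub>M\<^esub> x') - frag_of (p, x) - frag_of (p, x')"
          "p \<in> carrier P" "x \<in> carrier M" "x' \<in> carrier M"
      | (balanced) p s x where "r = frag_of (ract P p s, x) - frag_of (p, s \<odot>\<^bsub>M\<^esub> x)"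
          "p \<in> carrier P" "s \<in> carrier S" "x \<in> carrier M"
      unfolding tensor_relations_def by blast
    then show "?e r \<in> tensor_relations S P N"
    proof cases
      case left
      then have "?e r = frag_of (\<alpha> p \<oplus>\<^bsub>P\<^esub> \<alpha> p', f x) - frag_of (\<alpha> p, f x) - frag_of (\<alpha> p', f x)"
        by (simp add: frag_extend_diff additive_add[OF \<alpha>(1)])
      with left show ?thesis
        using additive_closed[OF \<alpha>(1)] additive_closed[OF f(1)]
        unfolding tensor_relations_def by blast
    next
      case right
      then have "?e r = frag_of (\<alpha> p, f x \<oplus>\<^bsub>N\<^esub> f x') - frag_of (\<alpha> p, f x) - frag_of (\<alpha> p, f x')"
        by (simp add: frag_extend_diff additive_add[OF f(1)])
      with right show ?thesis
        using additive_closed[OF \<alpha>(1)] additive_closed[OF f(1)]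
        unfolding tensor_relations_def by blast
    next
      case balanced
      then have "?e r = frag_of (ract P (\<alpha> p) s, f x) - frag_of (\<alpha> p, s \<odot>\<^bsub>N\<^esub> f x)"
        by (simp add: frag_extend_diff \<alpha>(2) f(2))
      with balanced show ?thesis
        using additive_closed[OF \<alpha>(1)] additive_closed[OF f(1)]
        unfolding tensor_relations_def by blast
    qed
  qed
  interpret e: group_hom M.G N.G ?e
  proof (unfold group_hom_def group_hom_axioms_def, intro conjI homI)
    show "?e c \<in> carrier N.G" if "c \<in> carrier M.G" for c
      by (rule keys[OF that])
  qed (simp_all add: frag_extend_add)
  have ext: "?e ` M.K \<subseteq> N.K"
    unfolding tensor_kernel_def e.generate_img[OF M.relations_incl, symmetric]
    by (rule group.mono_generate[OF group_free_Abelian_group rel])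
  have coset: "induced_map N.K N.A ?h (M.K #>\<^bsub>M.G\<^esub> c) = N.K #>\<^bsub>N.G\<^esub> ?e c"
    if "c \<in> carrier M.G" for c
    using induced_map_coset[OF N.kernel_subgroup M.kernel_subgroup h ext] that by simp
  show "additive_map M.T N.T (induced_map N.K N.A ?h)"
  proof (rule additiveI)
    fix t t' assume "t \<in> carrier M.T" "t' \<in> carrier M.T"
    then obtain c c' where c: "c \<in> carrier M.G" "t = M.K #>\<^bsub>M.G\<^esub> c"
        "c' \<in> carrier M.G" "t' = M.K #>\<^bsub>M.G\<^esub> c'"
      unfolding M.carrier_tensor by blast
    show "induced_map N.K N.A ?h t \<in> carrier N.T"
      using c coset keys unfolding N.carrier_tensor by blast
    have "c + c' \<in> carrier M.G"
      using group.is_monoid[OF group_free_Abelian_group] c monoid.m_closed[of M.G c c'] by simp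
    then show "induced_map N.K N.A ?h (t \<oplus>\<^bsub>M.T\<^esub> t') = induced_map N.K N.A ?h t \<oplus>\<^bsub>N.T\<^esub> induced_map N.K N.A ?h t'"
      using c by (simp only: M.add_coset coset N.add_coset keys frag_extend_add)
  qed
  show "induced_map N.K N.A ?h (M.pure p x) = N.pure (\<alpha> p) (f x)"
    if "p \<in> carrier P" "x \<in> carrier M"
    unfolding pure_tensor_def using that by (simp add: coset)
qed

context tensor_product
begin

lemma additive_pure_right: "p \<in> carrier P \<Longrightarrow> additive_map N T (pure p)"
  by (rule additiveI) (simp_all add: pure_closed pure_add_right)

lemma
  assumes "a \<in> carrier R"
  shows tensor_smult_additive: "additive_map T T (\<lambda>t. a \<odot>\<^bsub>T\<^esub> t)"
    and tensor_smult_pure: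
      "\<lbrakk>p \<in> carrier P; x \<in> carrier N\<rbrakk> \<Longrightarrow> a \<odot>\<^bsub>T\<^esub> pure p x = pure (a \<odot>\<^bsub>P\<^esub> p) x"
proof -
  have smult: "smult T a = induced_map K A (\<lambda>(p, x). (a \<odot>\<^bsub>P\<^esub> p, x))"
    by (simp add: tensor_module_def Let_def)
  note induced = tensor_product_axioms tensor_product_axioms P.additive_smult[OF assms]
    smult_ract[OF assms] additive_id[of N] refl
  show "additive_map T T (\<lambda>t. a \<odot>\<^bsub>T\<^esub> t)"
    using induced_map_additive[OF induced] by (simp add: smult)
  show "a \<odot>\<^bsub>T\<^esub> pure p x = pure (a \<odot>\<^bsub>P\<^esub> p) x" if "p \<in> carrier P" "x \<in> carrier N"
    using induced_map_pure[OF induced that] by (simp add: smult)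
qed

lemma tensor_left_module: "left_module R T"
proof -
  interpret T: abelian_group T by (rule tensor_abelian_group)
  show ?thesis
  proof (intro left_module.intro left_module_axioms.intro P.ring_axioms tensor_abelian_group)
    fix a b t t'
    assume a: "a \<in> carrier R" and b: "b \<in> carrier R" and t: "t \<in> carrier T"
    note smult = tensor_smult_additive tensor_smult_pure
    show "(a \<oplus>\<^bsub>R\<^esub> b) \<odot>\<^bsub>T\<^esub> t = a \<odot>\<^bsub>T\<^esub> t \<oplus>\<^bsub>T\<^esub> b \<odot>\<^bsub>T\<^esub> t"
      by (rule additive_ext[where D = T and f = "\<lambda>t. (a \<oplus>\<^bsub>R\<^esub> b) \<odot>\<^bsub>T\<^esub> t" and g = "\<lambda>t. a \<odot>\<^bsub>T\<^esub> t \<oplus>\<^bsub>T\<^esub> b \<odot>\<^bsub>T\<^esub> t"])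
         (use a b t in \<open>auto intro!: smult(1) additive_sum tensor_abelian_group
           simp: smult(2) P.smult_closed P.smult_l_distr pure_add_left\<close>)
    show "(a \<otimes>\<^bsub>R\<^esub> b) \<odot>\<^bsub>T\<^esub> t = a \<odot>\<^bsub>T\<^esub> (b \<odot>\<^bsub>T\<^esub> t)"
      by (rule additive_ext[where D = T and f = "\<lambda>t. (a \<otimes>\<^bsub>R\<^esub> b) \<odot>\<^bsub>T\<^esub> t" and g = "\<lambda>t. a \<odot>\<^bsub>T\<^esub> (b \<odot>\<^bsub>T\<^esub> t)"])
         (use a b t in \<open>auto intro!: smult(1) additive_compose[OF smult(1) smult(1)] tensor_abelian_group
           simp: smult(2) P.smult_closed P.smult_assoc\<close>)
  next
    fix t assume t: "t \<in> carrier T"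
    show "\<one>\<^bsub>R\<^esub> \<odot>\<^bsub>T\<^esub> t = t"
      by (rule additive_ext[where D = T and f = "\<lambda>t. \<one>\<^bsub>R\<^esub> \<odot>\<^bsub>T\<^esub> t" and g = "\<lambda>t. t"])
         (use t in \<open>auto intro!: tensor_smult_additive additive_id tensor_abelian_group
           simp: tensor_smult_pure P.smult_closed P.smult_one\<close>)
  next
    fix a t assume "a \<in> carrier R" "t \<in> carrier T"
    then show "a \<odot>\<^bsub>T\<^esub> t \<in> carrier T"
      by (rule additive_closed[OF tensor_smult_additive])
  next
    fix a t t' assume "a \<in> carrier R" "t \<in> carrier T" "t' \<in> carrier T"
    then show "a \<odot>\<^bsub>T\<^esub> (t \<oplus>\<^bsub>T\<^esub> t') = a \<odot>\<^bsub>T\<^esub> t \<oplus>\<^bsub>T\<^esub> a \<odot>\<^bsub>T\<^esub> t'"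
      by (rule additive_add[OF tensor_smult_additive])
  qed
qed

end

context tensor_factor
begin

lemma tensor_productI: "left_module S N \<Longrightarrow> tensor_product R S P N"
  by (simp add: tensor_product_def tensor_factor_axioms)

lemma
  assumes M: "left_module S M" and N: "left_module S N" and f: "f \<in> left_hom S M N"
  shows tensor_map_additive:
      "additive_map (tensor_module S P M) (tensor_module S P N) (fmap (tensor_functor S P) M N f)"
    and tensor_map_pure: "\<lbrakk>p \<in> carrier P; x \<in> carrier M\<rbrakk> \<Longrightarrow>
       fmap (tensor_functor S P) M N f (pure_tensor S P M p x) = pure_tensor S P N p (f x)"
    and tensor_map_extensional:
       "fmap (tensor_functor S P) M N f \<in> extensional (carrier (tensor_module S P M))"
    and tensor_map_hom:
      "fmap (tensor_functor S P) M N f \<in> left_hom R (tensor_module S P M) (tensor_module S P N)"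
proof -
  interpret M: tensor_product R S P M by (rule tensor_productI[OF M])
  interpret N: tensor_product R S P N by (rule tensor_productI[OF N])
  let ?F = "fmap (tensor_functor S P) M N f"
  have F: "?F = restrict (induced_map N.K N.A (\<lambda>(p, x). (p, f x))) (carrier M.T)"
    by (simp add: tensor_functor_def)
  note induced = M.tensor_product_axioms N.tensor_product_axioms additive_id[of P] refl
    left_hom_additive[OF f] left_hom_smult[OF f]
  show add: "additive_map M.T N.T ?F"
    unfolding F additive_restrict[OF M.tensor_abelian_group]
    by (rule induced_map_additive[OF induced])
  show pure: "?F (M.pure p x) = N.pure p (f x)" if "p \<in> carrier P" "x \<in> carrier M" for p x
    using induced_map_pure[OF induced that] M.pure_closed[OF that] by (simp add: F)
  show extensional: "?F \<in> extensional (carrier M.T)"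
    by (simp add: F)
  show "?F \<in> left_hom R M.T N.T"
  proof (rule left_homI[OF add extensional])
    fix a t assume a: "a \<in> carrier R" and t: "t \<in> carrier M.T"
    show "?F (a \<odot>\<^bsub>M.T\<^esub> t) = a \<odot>\<^bsub>N.T\<^esub> ?F t"
      by (rule M.additive_ext[where D = N.T and f = "\<lambda>t. ?F (a \<odot>\<^bsub>M.T\<^esub> t)" and g = "\<lambda>t. a \<odot>\<^bsub>N.T\<^esub> ?F t"])
         (use a t left_hom_closed[OF f] in \<open>auto intro!: additive_compose[OF M.tensor_smult_additive add]
            additive_compose[OF add N.tensor_smult_additive] N.tensor_abelian_group
            simp: M.tensor_smult_pure N.tensor_smult_pure pure P.smult_closed\<close>)
  qed
qed

theorem tensor_is_functor: "is_functor S R (tensor_functor S P)"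
proof -
  let ?F = "tensor_functor S P"
  have obj: "fobj ?F M = tensor_module S P M" for M :: "('s, 'n) module"
    by (simp add: tensor_functor_def)
  show ?thesis
    unfolding is_functor_def obj
  proof (intro conjI allI impI)
    fix M :: "('s, 'n) module" assume M: "left_module S M"
    interpret M: tensor_product R S P M by (rule tensor_productI[OF M])
    show "left_module R (tensor_module S P M)"
      by (rule M.tensor_left_module)
    have id: "(\<lambda>x\<in>carrier M. x) \<in> left_hom S M M"
      by (rule left_homI) (auto simp: additive_restrict M.N.abelian_group_axioms additive_id M.N.smult_closed)
    note F = tensor_map_additive[OF M M id] tensor_map_pure[OF M M id]
    show "fmap ?F M M (\<lambda>x\<in>carrier M. x) = (\<lambda>x\<in>carrier M.T. x)"
    proof (rule extensionalityI[OF tensor_map_extensional[OF M M id] restrict_extensional])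
      fix t assume t: "t \<in> carrier M.T"
      have "fmap ?F M M (\<lambda>x\<in>carrier M. x) t = t"
        by (rule M.additive_ext[OF F(1) additive_id M.tensor_abelian_group _ t]) (simp add: F(2))
      with t show "fmap ?F M M (\<lambda>x\<in>carrier M. x) t = (\<lambda>x\<in>carrier M.T. x) t" by simp
    qed
  next
    fix M N :: "('s, 'n) module" and f
    assume "left_module S M" "left_module S N" "f \<in> left_hom S M N"
    then show "fmap ?F M N f \<in> left_hom R (tensor_module S P M) (tensor_module S P N)"
      by (rule tensor_map_hom)
  next
    fix M N L :: "('s, 'n) module" and f g
    assume M: "left_module S M" and N: "left_module S N" and L: "left_module S L"
      and f: "f \<in> left_hom S M N" and g: "g \<in> left_hom S N L"
    interpret M: tensor_product R S P M by (rule tensor_productI[OF M])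
    interpret L: tensor_product R S P L by (rule tensor_productI[OF L])
    have gf: "compose (carrier M) g f \<in> left_hom S M L"
      by (rule left_homI)
         (auto simp: compose_def additive_restrict M.N.abelian_group_axioms M.N.smult_closed
            left_hom_smult[OF f] left_hom_smult[OF g] left_hom_closed[OF f]
            intro!: additive_compose[OF left_hom_additive[OF f] left_hom_additive[OF g]])
    show "fmap ?F M L (compose (carrier M) g f) = compose (carrier M.T) (fmap ?F N L g) (fmap ?F M N f)"
    proof (rule extensionalityI[OF tensor_map_extensional[OF M L gf] compose_extensional])
      fix t assume t: "t \<in> carrier M.T"
      have "fmap ?F M L (compose (carrier M) g f) t = fmap ?F N L g (fmap ?F M N f t)"
        by (rule M.additive_ext[OF tensor_map_additive[OF M L gf]
              additive_compose[OF tensor_map_additive[OF M N f] tensor_map_additive[OF N L g]]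
              L.tensor_abelian_group _ t])
           (simp add: tensor_map_pure M N L f g gf left_hom_closed[OF f] compose_eq)
      with t show "fmap ?F M L (compose (carrier M) g f) t = compose (carrier M.T) (fmap ?F N L g) (fmap ?F M N f) t"
        by (simp add: compose_eq)
    qed
  qed
qed

end

section \<open>Morita contexts\<close>

text \<open>
  The data of a bimodule map \<open>P \<otimes>\<^sub>R Q \<rightarrow> S\<close>, given on pure tensors.
\<close>

locale bilinear_pairing = P: tensor_factor S R P + Q: tensor_factor R S Q
  for R :: "'r ring" and S :: "'s ring" and P :: "('s, 'r, 'p) bimodule"
    and Q :: "('r, 's, 'q) bimodule" and \<phi> :: "'p \<Rightarrow> 'q \<Rightarrow> 's" +
  assumes pairing_closed: "\<lbrakk>p \<in> carrier P; q \<in> carrier Q\<rbrakk> \<Longrightarrow> \<phi> p q \<in> carrier S"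
    and pairing_add_left: "\<lbrakk>p \<in> carrier P; p' \<in> carrier P; q \<in> carrier Q\<rbrakk> \<Longrightarrow>
          \<phi> (p \<oplus>\<^bsub>P\<^esub> p') q = \<phi> p q \<oplus>\<^bsub>S\<^esub> \<phi> p' q"
    and pairing_add_right: "\<lbrakk>p \<in> carrier P; q \<in> carrier Q; q' \<in> carrier Q\<rbrakk> \<Longrightarrow>
          \<phi> p (q \<oplus>\<^bsub>Q\<^esub> q') = \<phi> p q \<oplus>\<^bsub>S\<^esub> \<phi> p q'"
    and pairing_smult: "\<lbrakk>s \<in> carrier S; p \<in> carrier P; q \<in> carrier Q\<rbrakk> \<Longrightarrow>
          \<phi> (s \<odot>\<^bsub>P\<^esub> p) q = s \<otimes>\<^bsub>S\<^esub> \<phi> p q"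
    and pairing_ract: "\<lbrakk>s \<in> carrier S; p \<in> carrier P; q \<in> carrier Q\<rbrakk> \<Longrightarrow>
          \<phi> p (ract Q q s) = \<phi> p q \<otimes>\<^bsub>S\<^esub> s"
    and pairing_balanced: "\<lbrakk>r \<in> carrier R; p \<in> carrier P; q \<in> carrier Q\<rbrakk> \<Longrightarrow>
          \<phi> (ract P p r) q = \<phi> p (r \<odot>\<^bsub>Q\<^esub> q)"
begin

lemma pairing_additive:
  shows "q \<in> carrier Q \<Longrightarrow> additive_map P S (\<lambda>p. \<phi> p q)"
    and "p \<in> carrier P \<Longrightarrow> additive_map Q S (\<lambda>q. \<phi> p q)"
  by (auto intro!: additiveI simp: pairing_closed pairing_add_left pairing_add_right)

text \<open>
  The image of \<open>P \<otimes>\<^sub>R Q \<rightarrow> S\<close>.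
\<close>

definition trace_ideal :: "'s set" where
  "trace_ideal = generate (add_monoid S) {\<phi> p q |p q. p \<in> carrier P \<and> q \<in> carrier Q}"

lemma trace_ideal_subgroup: "subgroup trace_ideal (add_monoid S)"
  unfolding trace_ideal_def
  by (rule P.P.R.add.generate_is_subgroup) (auto simp: pairing_closed)

lemma trace_ideal_minimal:
  assumes "\<And>p q. \<lbrakk>p \<in> carrier P; q \<in> carrier Q\<rbrakk> \<Longrightarrow> \<phi> p q \<in> U"
    and "U \<subseteq> carrier S" "\<zero>\<^bsub>S\<^esub> \<in> U" "\<And>x y. \<lbrakk>x \<in> U; y \<in> U\<rbrakk> \<Longrightarrow> x \<ominus>\<^bsub>S\<^esub> y \<in> U"
  shows "trace_ideal \<subseteq> U"
proof
  fix s assume "s \<in> trace_ideal"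
  then show "s \<in> U"
    unfolding trace_ideal_def
    by (rule P.P.R.generate_additive_minimal[OF _ _ assms(2-4)]) (use assms(1) in auto)
qed

lemma trace_ideal_minus:
  "\<lbrakk>x \<in> trace_ideal; y \<in> trace_ideal\<rbrakk> \<Longrightarrow> x \<ominus>\<^bsub>S\<^esub> y \<in> trace_ideal"
  using additive_subgroup.a_closed[OF additive_subgroupI[OF trace_ideal_subgroup]]
    additive_subgroup.a_inv_closed[OF additive_subgroupI[OF trace_ideal_subgroup]]
  by (simp add: a_minus_def)

lemma trace_ideal_ideal: "ideal trace_ideal S"
proof (rule idealI[OF P.P.R.ring_axioms trace_ideal_subgroup])
  have gen: "\<phi> p q \<in> trace_ideal" if "p \<in> carrier P" "q \<in> carrier Q" for p q
    unfolding trace_ideal_def using that by (auto intro: generate.incl)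
  have zero: "\<zero>\<^bsub>S\<^esub> \<in> trace_ideal"
    using subgroup.one_closed[OF trace_ideal_subgroup] by simp
  fix a s assume a: "a \<in> trace_ideal" and s: "s \<in> carrier S"
  have "trace_ideal \<subseteq> {a \<in> carrier S. s \<otimes>\<^bsub>S\<^esub> a \<in> trace_ideal}"
    by (rule trace_ideal_minimal)
       (use s zero in \<open>auto simp: pairing_closed gen pairing_smult[symmetric] P.P.smult_closed
          P.P.R.right_diff_distr trace_ideal_minus\<close>)
  with a show "s \<otimes>\<^bsub>S\<^esub> a \<in> trace_ideal" by auto
  have "trace_ideal \<subseteq> {a \<in> carrier S. a \<otimes>\<^bsub>S\<^esub> s \<in> trace_ideal}"
    by (rule trace_ideal_minimal)
       (use s zero in \<open>auto simp: pairing_closed gen pairing_ract[symmetric] Q.ract_closed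
          P.P.R.left_diff_distr trace_ideal_minus\<close>)
  with a show "a \<otimes>\<^bsub>S\<^esub> s \<in> trace_ideal" by auto
qed

text \<open>
  The trace ideal is two-sided, so over a simple ring one nonzero value of the pairing already makes
  the pairing surjective.
\<close>

lemma one_in_trace_ideal:
  assumes "simple_ring S" "p \<in> carrier P" "q \<in> carrier Q" "\<phi> p q \<noteq> \<zero>\<^bsub>S\<^esub>"
  shows "\<one>\<^bsub>S\<^esub> \<in> trace_ideal"
proof -
  have "\<phi> p q \<in> trace_ideal"
    unfolding trace_ideal_def using assms by (auto intro: generate.incl)
  with assms have "trace_ideal = carrier S"
    using trace_ideal_ideal unfolding simple_ring_def by blast
  then show ?thesis by simp
qed

text \<open>
  The scalars that do not distinguish \<open>x\<close> from \<open>y\<close> form an additive subgroup. This yields the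
  injectivity of the comparison maps below.
\<close>

lemma eq_if_trace_eq:
  assumes "\<one>\<^bsub>S\<^esub> \<in> trace_ideal" and M: "left_module S M" and x: "x \<in> carrier M" "y \<in> carrier M"
    and "\<And>p q. \<lbrakk>p \<in> carrier P; q \<in> carrier Q\<rbrakk> \<Longrightarrow> \<phi> p q \<odot>\<^bsub>M\<^esub> x = \<phi> p q \<odot>\<^bsub>M\<^esub> y"
  shows "x = y"
proof -
  interpret M: left_module S M by fact
  note minus = additive_minus[OF M.additive_scalar P.P.R.abelian_group_axioms M.M.abelian_group_axioms]
    additive_zero[OF M.additive_scalar P.P.R.abelian_group_axioms M.M.abelian_group_axioms]
  have "trace_ideal \<subseteq> {s \<in> carrier S. s \<odot>\<^bsub>M\<^esub> x = s \<odot>\<^bsub>M\<^esub> y}"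
    by (rule trace_ideal_minimal) (use assms(5) x in \<open>auto simp: pairing_closed minus\<close>)
  with assms(1) have "\<one>\<^bsub>S\<^esub> \<odot>\<^bsub>M\<^esub> x = \<one>\<^bsub>S\<^esub> \<odot>\<^bsub>M\<^esub> y" by auto
  with x show ?thesis by (simp add: M.smult_one)
qed

text \<open>
  The scalars that carry \<open>x\<close> into \<open>U\<close> form an additive subgroup. This yields the surjectivity of the
  comparison maps below, with \<open>U\<close> their image.
\<close>

lemma closed_under_trace:
  assumes "\<one>\<^bsub>S\<^esub> \<in> trace_ideal" and M: "left_module S M" and x: "x \<in> carrier M"
    and U: "subgroup U (add_monoid M)"
    and "\<And>p q. \<lbrakk>p \<in> carrier P; q \<in> carrier Q\<rbrakk> \<Longrightarrow> \<phi> p q \<odot>\<^bsub>M\<^esub> x \<in> U"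
  shows "x \<in> U"
proof -
  interpret M: left_module S M by fact
  interpret U: additive_subgroup U M by (rule additive_subgroupI[OF U])
  note minus = additive_minus[OF M.additive_scalar P.P.R.abelian_group_axioms M.M.abelian_group_axioms]
    additive_zero[OF M.additive_scalar P.P.R.abelian_group_axioms M.M.abelian_group_axioms]
  have "trace_ideal \<subseteq> {s \<in> carrier S. s \<odot>\<^bsub>M\<^esub> x \<in> U}"
    by (rule trace_ideal_minimal) (use assms(5) x in \<open>auto simp: pairing_closed minus a_minus_def[of M]\<close>)
  with assms(1) have "\<one>\<^bsub>S\<^esub> \<odot>\<^bsub>M\<^esub> x \<in> U" by auto
  with x show ?thesis by (simp add: M.smult_one)
qed

end

text \<open>
  A Morita context with both pairings surjective. The assumptions are symmetric under exchanging
  the two rings, so that every statement about one ring also holds for the other.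
\<close>

locale morita_context =
  \<phi>: bilinear_pairing R S P Q \<phi> + \<psi>: bilinear_pairing S R Q P \<psi>
  for R :: "'r ring" and S :: "'s ring" and P :: "('s, 'r, 'p) bimodule"
    and Q :: "('r, 's, 'q) bimodule" and \<phi> :: "'p \<Rightarrow> 'q \<Rightarrow> 's" and \<psi> :: "'q \<Rightarrow> 'p \<Rightarrow> 'r" +
  assumes ract_\<psi>: "\<lbrakk>p \<in> carrier P; q \<in> carrier Q; p' \<in> carrier P\<rbrakk> \<Longrightarrow>
        ract P p (\<psi> q p') = \<phi> p q \<odot>\<^bsub>P\<^esub> p'"
    and ract_\<phi>: "\<lbrakk>q \<in> carrier Q; p \<in> carrier P; q' \<in> carrier Q\<rbrakk> \<Longrightarrow>
        ract Q q (\<phi> p q') = \<psi> q p \<odot>\<^bsub>Q\<^esub> q'"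
    and one_in_trace_\<phi>: "\<one>\<^bsub>S\<^esub> \<in> \<phi>.trace_ideal"
    and one_in_trace_\<psi>: "\<one>\<^bsub>R\<^esub> \<in> \<psi>.trace_ideal"
begin

lemma morita_context_swap: "morita_context S R Q P \<psi> \<phi>"
  by (intro morita_context.intro morita_context_axioms.intro \<phi>.bilinear_pairing_axioms
      \<psi>.bilinear_pairing_axioms ract_\<psi> ract_\<phi> one_in_trace_\<phi> one_in_trace_\<psi>)

text \<open>
  An ideal \<open>J\<close> of \<open>S\<close> is pulled back to the ideal \<open>I = {r. \<phi> P (r Q) \<subseteq> J}\<close> of \<open>R\<close>, which must be \<open>0\<close> or \<open>R\<close>.
  If \<open>I = R\<close>, then \<open>J\<close> contains the trace ideal and hence \<open>1\<close>. Since \<open>\<psi> (q j) p \<in> I\<close> for \<open>j \<in> J\<close>, the case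
  \<open>I = 0\<close> makes all products \<open>\<phi> p' q \<cdot> j \<cdot> \<phi> p q'\<close> vanish, and surjectivity of \<open>\<phi>\<close> gives \<open>j = 0\<close>.
\<close>

lemma simple_ring_transfer:
  assumes R: "simple_ring R" and nontrivial: "\<one>\<^bsub>S\<^esub> \<noteq> \<zero>\<^bsub>S\<^esub>"
  shows "simple_ring S"
  unfolding simple_ring_def
proof (intro conjI allI impI nontrivial \<phi>.P.P.R.ring_axioms)
  fix J assume "ideal J S"
  then interpret J: ideal J S .
  define I where "I = {r \<in> carrier R. \<forall>p\<in>carrier P. \<forall>q\<in>carrier Q. \<phi> p (r \<odot>\<^bsub>Q\<^esub> q) \<in> J}"
  have zero_minus: "\<zero>\<^bsub>S\<^esub> \<ominus>\<^bsub>S\<^esub> \<zero>\<^bsub>S\<^esub> = \<zero>\<^bsub>S\<^esub>"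
    by (simp add: a_minus_def)
  have scalar: "additive_map R S (\<lambda>r. \<phi> p (r \<odot>\<^bsub>Q\<^esub> q))" if "p \<in> carrier P" "q \<in> carrier Q" for p q
    by (rule additive_compose[OF \<phi>.Q.P.additive_scalar[OF that(2)] \<phi>.pairing_additive(2)[OF that(1)]])
  note sc = additive_zero[OF scalar \<phi>.P.S.abelian_group_axioms \<phi>.P.P.R.abelian_group_axioms]
    additive_minus[OF scalar \<phi>.P.S.abelian_group_axioms \<phi>.P.P.R.abelian_group_axioms]
  have "ideal I R"
  proof (rule idealI[OF \<phi>.P.S.ring_axioms \<phi>.P.S.additive_subgroup_minusI])
    show "I \<subseteq> carrier R" "\<zero>\<^bsub>R\<^esub> \<in> I"
      by (auto simp: I_def sc)
    show "x \<ominus>\<^bsub>R\<^esub> y \<in> I" if "x \<in> I" "y \<in> I" for x y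
      using that by (auto simp: I_def sc a_minus_def[of S])
    show "x \<otimes>\<^bsub>R\<^esub> a \<in> I" if "a \<in> I" "x \<in> carrier R" for a x
      using that \<phi>.P.ract_closed
      by (auto simp: I_def \<phi>.Q.P.smult_assoc \<phi>.Q.P.smult_closed \<phi>.pairing_balanced[symmetric])
    show "a \<otimes>\<^bsub>R\<^esub> x \<in> I" if "a \<in> I" "x \<in> carrier R" for a x
      using that by (auto simp: I_def \<phi>.Q.P.smult_assoc \<phi>.Q.P.smult_closed)
  qed
  then consider "I = {\<zero>\<^bsub>R\<^esub>}" | "I = carrier R"
    using R by (auto simp: simple_ring_def)
  then show "J = {\<zero>\<^bsub>S\<^esub>} \<or> J = carrier S"
  proof cases
    case 1
    have "j = \<zero>\<^bsub>S\<^esub>" if j: "j \<in> J" for j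
    proof -
      have jS: "j \<in> carrier S" using j J.a_subset by auto
      have val: "\<phi> p' (\<psi> (ract Q q j) p \<odot>\<^bsub>Q\<^esub> q') = \<phi> p' q \<otimes>\<^bsub>S\<^esub> j \<otimes>\<^bsub>S\<^esub> \<phi> p q'"
        if "p \<in> carrier P" "q \<in> carrier Q" "p' \<in> carrier P" "q' \<in> carrier Q" for p q p' q'
        using that jS by (simp add: ract_\<phi>[symmetric] \<phi>.Q.ract_closed \<phi>.pairing_ract \<phi>.pairing_closed)
      have "\<psi> (ract Q q j) p \<in> I" if "p \<in> carrier P" "q \<in> carrier Q" for p q
        using that jS val J.I_r_closed[OF J.I_l_closed[OF j]]
        by (auto simp: I_def \<phi>.Q.ract_closed \<psi>.pairing_closed \<phi>.pairing_closed)
      then have zero: "\<psi> (ract Q q j) p = \<zero>\<^bsub>R\<^esub>" if "p \<in> carrier P" "q \<in> carrier Q" for p q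
        using that 1 by auto
      have prod: "\<phi> p' q \<otimes>\<^bsub>S\<^esub> (j \<otimes>\<^bsub>S\<^esub> \<phi> p q') = \<zero>\<^bsub>S\<^esub>"
        if "p \<in> carrier P" "q \<in> carrier Q" "p' \<in> carrier P" "q' \<in> carrier Q" for p q p' q'
        using val[OF that] that jS zero sc(1) by (simp add: \<phi>.P.P.R.m_assoc \<phi>.pairing_closed)
      \<comment> \<open>In \<open>\<phi> p' q \<cdot> j \<cdot> \<phi> p q' = 0\<close> the left factor and then the right factor are replaced by \<open>1\<close>.\<close>
      have *: "\<phi>.trace_ideal \<subseteq> {s \<in> carrier S. s \<otimes>\<^bsub>S\<^esub> (j \<otimes>\<^bsub>S\<^esub> \<phi> p q') = \<zero>\<^bsub>S\<^esub>}"
        if "p \<in> carrier P" "q' \<in> carrier Q" for p q'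
        by (rule \<phi>.trace_ideal_minimal)
           (use that prod jS in \<open>auto simp: \<phi>.pairing_closed \<phi>.P.P.R.left_diff_distr zero_minus\<close>)
      have "\<phi>.trace_ideal \<subseteq> {s \<in> carrier S. j \<otimes>\<^bsub>S\<^esub> s = \<zero>\<^bsub>S\<^esub>}"
      proof (rule \<phi>.trace_ideal_minimal)
        show "\<phi> p q \<in> {s \<in> carrier S. j \<otimes>\<^bsub>S\<^esub> s = \<zero>\<^bsub>S\<^esub>}" if "p \<in> carrier P" "q \<in> carrier Q" for p q
          using *[OF that] one_in_trace_\<phi> jS that by (auto simp: \<phi>.pairing_closed)
      qed (use jS in \<open>auto simp: \<phi>.P.P.R.right_diff_distr zero_minus\<close>)
      with one_in_trace_\<phi> jS show ?thesis by auto
    qed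
    then show ?thesis using J.zero_closed by blast
  next
    case 2
    then have "\<one>\<^bsub>R\<^esub> \<in> I" by simp
    then have "\<phi> p q \<in> J" if "p \<in> carrier P" "q \<in> carrier Q" for p q
      using that by (auto simp: I_def \<phi>.Q.P.smult_one)
    then have "\<phi>.trace_ideal \<subseteq> J"
      using J.a_subset by (intro \<phi>.trace_ideal_minimal) (auto simp: a_minus_def[of S])
    with one_in_trace_\<phi> have "\<one>\<^bsub>S\<^esub> \<in> J" by auto
    then have "carrier S \<subseteq> J" using J.I_l_closed[of "\<one>\<^bsub>S\<^esub>"] by force
    then show ?thesis using J.a_subset by auto
  qed
qed

end

section \<open>The Hom functor\<close>

text \<open>
  The left \<open>S\<close>-module \<open>Hom\<^sub>R(P, M)\<close> uses the right action of \<open>S\<close> on \<open>P\<close>, so that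
  action has to be a genuine module structure.
\<close>

locale bimodule_over = tensor_factor R S P
  for R :: "'r ring" and S :: "'s ring" and P :: "('r, 's, 'p) bimodule" +
  assumes ract_add_left: "\<lbrakk>p \<in> carrier P; p' \<in> carrier P; s \<in> carrier S\<rbrakk> \<Longrightarrow>
        ract P (p \<oplus>\<^bsub>P\<^esub> p') s = ract P p s \<oplus>\<^bsub>P\<^esub> ract P p' s"
    and ract_add_right: "\<lbrakk>p \<in> carrier P; s \<in> carrier S; s' \<in> carrier S\<rbrakk> \<Longrightarrow>
        ract P p (s \<oplus>\<^bsub>S\<^esub> s') = ract P p s \<oplus>\<^bsub>P\<^esub> ract P p s'"
    and ract_assoc: "\<lbrakk>p \<in> carrier P; s \<in> carrier S; s' \<in> carrier S\<rbrakk> \<Longrightarrow>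
        ract P (ract P p s) s' = ract P p (s \<otimes>\<^bsub>S\<^esub> s')"
    and ract_one: "p \<in> carrier P \<Longrightarrow> ract P p \<one>\<^bsub>S\<^esub> = p"

context bimodule_over
begin

lemma hom_left_module:
  assumes M: "left_module R M"
  shows "left_module S (hom_module R P M)"
proof -
  interpret M: left_module R M by fact
  let ?H = "hom_module R P M"
  note PM = P.left_module_axioms
  have sum: "f \<oplus>\<^bsub>?H\<^esub> g \<in> carrier ?H" if "f \<in> carrier ?H" "g \<in> carrier ?H" for f g
  proof -
    have f: "f \<in> left_hom R P M" and g: "g \<in> left_hom R P M" using that by (simp_all add: hom_module_def)
    have "restrict (\<lambda>p. f p \<oplus>\<^bsub>M\<^esub> g p) (carrier P) \<in> left_hom R P M"
      by (rule left_hom_restrictI[OF PM additive_sum[OF left_hom_additive[OF f] left_hom_additive[OF g]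
              M.M.abelian_group_axioms]])
         (simp add: left_hom_smult[OF f] left_hom_smult[OF g] left_hom_closed[OF f] left_hom_closed[OF g]
            M.smult_r_distr)
    then show ?thesis by (simp add: hom_module_def)
  qed
  have zero: "\<zero>\<^bsub>?H\<^esub> \<in> carrier ?H"
    unfolding hom_module_def module.simps ring.simps partial_object.simps
    by (rule left_hom_restrictI[OF PM additiveI])
       (simp_all add: additive_zero[OF M.additive_smult M.M.abelian_group_axioms M.M.abelian_group_axioms])
  have neg: "(\<lambda>p\<in>carrier P. \<ominus>\<^bsub>M\<^esub> f p) \<in> carrier ?H" if "f \<in> carrier ?H" for f
  proof -
    have f: "f \<in> left_hom R P M" using that by (simp add: hom_module_def)
    have "additive_map P M (\<lambda>p. \<ominus>\<^bsub>M\<^esub> f p)"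
      by (rule additiveI)
         (simp_all add: left_hom_closed[OF f] additive_add[OF left_hom_additive[OF f]] M.M.minus_add)
    then show ?thesis
      unfolding hom_module_def partial_object.simps
      by (rule left_hom_restrictI[OF PM])
         (simp add: left_hom_smult[OF f] left_hom_closed[OF f]
            additive_neg[OF M.additive_smult M.M.abelian_group_axioms M.M.abelian_group_axioms])
  qed
  have act: "s \<odot>\<^bsub>?H\<^esub> f \<in> carrier ?H" if "s \<in> carrier S" "f \<in> carrier ?H" for s f
  proof -
    have f: "f \<in> left_hom R P M" using that by (simp add: hom_module_def)
    have "additive_map P P (\<lambda>p. ract P p s)"
      by (rule additiveI) (simp_all add: ract_closed ract_add_left that)
    from additive_compose[OF this left_hom_additive[OF f]]
    have "restrict (\<lambda>p. f (ract P p s)) (carrier P) \<in> left_hom R P M"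
      by (rule left_hom_restrictI[OF PM])
         (simp add: that smult_ract[symmetric] left_hom_smult[OF f] ract_closed)
    then show ?thesis by (simp add: hom_module_def)
  qed
  have closed: "f p \<in> carrier M" if "f \<in> carrier ?H" "p \<in> carrier P" for f p
    using that by (simp add: hom_module_def left_hom_closed)
  have eqI: "f = g" if "f \<in> carrier ?H" "g \<in> carrier ?H" "\<And>p. p \<in> carrier P \<Longrightarrow> f p = g p" for f g
    using that left_hom_eqI by (simp add: hom_module_def) blast
  have app: "(f \<oplus>\<^bsub>?H\<^esub> g) p = f p \<oplus>\<^bsub>M\<^esub> g p" "\<zero>\<^bsub>?H\<^esub> p = \<zero>\<^bsub>M\<^esub>" "(s \<odot>\<^bsub>?H\<^esub> f) p = f (ract P p s)"
    if "p \<in> carrier P" for f g p s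
    using that by (simp_all add: hom_module_def)
  have add: "f (p \<oplus>\<^bsub>P\<^esub> p') = f p \<oplus>\<^bsub>M\<^esub> f p'" if "f \<in> carrier ?H" "p \<in> carrier P" "p' \<in> carrier P" for f p p'
    using that by (simp add: hom_module_def additive_add[OF left_hom_additive])
  show ?thesis
  proof (intro left_module.intro left_module_axioms.intro S.ring_axioms abelian_groupI)
    fix f assume f: "f \<in> carrier ?H"
    show "\<exists>g\<in>carrier ?H. g \<oplus>\<^bsub>?H\<^esub> f = \<zero>\<^bsub>?H\<^esub>"
      by (rule bexI[OF _ neg[OF f]], rule eqI)
         (simp_all add: f sum neg zero app closed M.M.l_neg)
  qed (auto intro!: eqI sum act simp: sum act zero app closed M.M.a_ac add
        ract_closed ract_add_right ract_assoc ract_one)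
qed

theorem hom_is_functor: "is_functor R S (hom_functor R P)"
  unfolding is_functor_def fobj_hom_functor
proof (intro conjI allI impI)
  fix M :: "('r, 'm) module" assume M: "left_module R M"
  show "left_module S (hom_module R P M)" by (rule hom_left_module[OF M])
  show "fmap (hom_functor R P) M M (\<lambda>x\<in>carrier M. x) = (\<lambda>x\<in>carrier (hom_module R P M). x)"
    by (auto simp: hom_functor_def hom_module_def restrict_def compose_def fun_eq_iff left_hom_closed
        dest: extensional_arb[OF left_hom_extensional])
next
  fix M N :: "('r, 'm) module" and f
  assume M: "left_module R M" and N: "left_module R N" and f: "f \<in> left_hom R M N"
  note comp = left_hom_compose[OF P.left_module_axioms _ f]
  have *: "restrict (\<lambda>\<phi>. compose (carrier P) f \<phi>) (carrier (hom_module R P M)) \<in>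
      left_hom S (hom_module R P M) (hom_module R P N)"
  proof (rule left_hom_restrictI[OF hom_left_module[OF M] additiveI])
    fix s \<phi> assume "s \<in> carrier S" "\<phi> \<in> carrier (hom_module R P M)"
    then show "compose (carrier P) f (s \<odot>\<^bsub>hom_module R P M\<^esub> \<phi>) = s \<odot>\<^bsub>hom_module R P N\<^esub> compose (carrier P) f \<phi>"
      by (auto simp: hom_module_def compose_def ract_closed fun_eq_iff restrict_def)
  qed (use comp in \<open>auto simp: hom_module_def compose_def fun_eq_iff restrict_def additive_add[OF left_hom_additive[OF f]] left_hom_closed\<close>)
  then show "fmap (hom_functor R P) M N f \<in> left_hom S (hom_module R P M) (hom_module R P N)"
    by (simp add: hom_functor_def hom_module_def)
next
  fix M N L :: "('r, 'm) module" and f g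
  assume "f \<in> left_hom R M N" "g \<in> left_hom R N L"
  then show "fmap (hom_functor R P) M L (compose (carrier M) g f) =
      compose (carrier (hom_module R P M)) (fmap (hom_functor R P) N L g) (fmap (hom_functor R P) M N f)"
    using left_hom_compose[OF P.left_module_axioms, of _ M f N]
    by (auto simp: hom_functor_def hom_module_def compose_def fun_eq_iff restrict_def left_hom_closed)
qed

end

section \<open>The equivalence attached to a Morita context\<close>

context morita_context
begin

text \<open>
  An element \<open>q\<close> of \<open>Q\<close> turns \<open>p \<otimes> m\<close> into \<open>\<psi> q p \<cdot> m\<close>. Both comparison maps are built from these
  evaluations: reading the result as a function of \<open>q\<close> maps \<open>P \<otimes>\<^sub>R M\<close> to \<open>Hom\<^sub>R(Q, M)\<close>, and collecting the
  evaluations over all \<open>q\<close> maps \<open>Q \<otimes>\<^sub>S (P \<otimes>\<^sub>R M)\<close> to \<open>M\<close>.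
\<close>

lemma evaluation_exists:
  assumes M: "left_module R M" and q: "q \<in> carrier Q"
  shows "\<exists>e. additive_map (tensor_module R P M) M e \<and>
    (\<forall>p\<in>carrier P. \<forall>m\<in>carrier M. e (pure_tensor R P M p m) = \<psi> q p \<odot>\<^bsub>M\<^esub> m)"
proof -
  interpret PM: tensor_product S R P M by (rule \<phi>.P.tensor_productI[OF M])
  show ?thesis
    by (intro PM.lift_exists PM.N.M.abelian_group_axioms)
       (auto simp: q \<psi>.pairing_closed PM.N.smult_closed \<psi>.pairing_add_right PM.N.smult_l_distr
          PM.N.smult_r_distr \<psi>.pairing_ract PM.N.smult_assoc)
qed

text \<open>
  By \<open>additive_ext\<close> such a map is unique on the carrier of the tensor product.
\<close>

definition evaluation :: "('r, 'm) module \<Rightarrow> 'q \<Rightarrow> (('p \<times> 'm) \<Rightarrow>\<^sub>0 int) set \<Rightarrow> 'm" where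
  "evaluation M q = (SOME e. additive_map (tensor_module R P M) M e \<and>
    (\<forall>p\<in>carrier P. \<forall>m\<in>carrier M. e (pure_tensor R P M p m) = \<psi> q p \<odot>\<^bsub>M\<^esub> m))"

lemma
  assumes "left_module R M" "q \<in> carrier Q"
  shows evaluation_additive: "additive_map (tensor_module R P M) M (evaluation M q)"
    and evaluation_pure: "\<lbrakk>p \<in> carrier P; m \<in> carrier M\<rbrakk> \<Longrightarrow>
      evaluation M q (pure_tensor R P M p m) = \<psi> q p \<odot>\<^bsub>M\<^esub> m"
  using someI_ex[OF evaluation_exists[OF assms], folded evaluation_def] by blast+

text \<open>
  The first three parts say that evaluation is compatible with all structure on \<open>Q\<close>. The last part is
  the key to the inverse of the comparison maps: by \<open>\<phi> p q \<cdot> p' = p \<cdot> \<psi> q p'\<close>, multiplying a tensor by a value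
  of \<open>\<phi>\<close> only depends on an evaluation of that tensor.
\<close>

lemma
  assumes M: "left_module R M" and t: "t \<in> carrier (tensor_module R P M)" and q: "q \<in> carrier Q"
  shows evaluation_add: "q' \<in> carrier Q \<Longrightarrow>
      evaluation M (q \<oplus>\<^bsub>Q\<^esub> q') t = evaluation M q t \<oplus>\<^bsub>M\<^esub> evaluation M q' t"
    and evaluation_smult: "a \<in> carrier R \<Longrightarrow>
      evaluation M (a \<odot>\<^bsub>Q\<^esub> q) t = a \<odot>\<^bsub>M\<^esub> evaluation M q t"
    and evaluation_ract: "s \<in> carrier S \<Longrightarrow>
      evaluation M (ract Q q s) t = evaluation M q (s \<odot>\<^bsub>tensor_module R P M\<^esub> t)"
    and smult_pairing: "p \<in> carrier P \<Longrightarrow>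
      \<phi> p q \<odot>\<^bsub>tensor_module R P M\<^esub> t = pure_tensor R P M p (evaluation M q t)"
proof -
  interpret PM: tensor_product S R P M by (rule \<phi>.P.tensor_productI[OF M])
  note MG = PM.N.M.abelian_group_axioms
  note ev = evaluation_additive[OF M]
  note ev_pure = evaluation_pure[OF M]
  show "evaluation M (q \<oplus>\<^bsub>Q\<^esub> q') t = evaluation M q t \<oplus>\<^bsub>M\<^esub> evaluation M q' t" if q': "q' \<in> carrier Q"
    by (rule PM.additive_ext[where D = M and f = "evaluation M (q \<oplus>\<^bsub>Q\<^esub> q')",
          OF ev additive_sum[OF ev[OF q] ev[OF q'] MG] MG _ t])
       (use q q' in \<open>simp_all add: ev_pure \<psi>.pairing_add_left \<psi>.pairing_closed PM.N.smult_l_distr\<close>)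
  show "evaluation M (a \<odot>\<^bsub>Q\<^esub> q) t = a \<odot>\<^bsub>M\<^esub> evaluation M q t" if a: "a \<in> carrier R"
    by (rule PM.additive_ext[where D = M and f = "evaluation M (a \<odot>\<^bsub>Q\<^esub> q)",
          OF ev additive_compose[OF ev[OF q] PM.N.additive_smult[OF a]] MG _ t])
       (use q a in \<open>simp_all add: ev_pure \<phi>.Q.P.smult_closed \<psi>.pairing_smult \<psi>.pairing_closed PM.N.smult_assoc\<close>)
  show "evaluation M (ract Q q s) t = evaluation M q (s \<odot>\<^bsub>PM.T\<^esub> t)" if s: "s \<in> carrier S"
    by (rule PM.additive_ext[where D = M and f = "evaluation M (ract Q q s)",
          OF ev additive_compose[OF PM.tensor_smult_additive[OF s] ev[OF q]] MG _ t])
       (use q s in \<open>simp_all add: ev_pure \<psi>.pairing_balanced \<phi>.Q.ract_closed PM.tensor_smult_pure \<phi>.P.P.smult_closed\<close>)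
  show "\<phi> p q \<odot>\<^bsub>PM.T\<^esub> t = PM.pure p (evaluation M q t)" if p: "p \<in> carrier P"
    by (rule PM.additive_ext[where D = PM.T and g = "\<lambda>t. PM.pure p (evaluation M q t)",
          OF PM.tensor_smult_additive[OF \<phi>.pairing_closed[OF p q]]
            additive_compose[OF ev[OF q] PM.additive_pure_right[OF p]] PM.tensor_abelian_group _ t])
       (use p q in \<open>simp_all add: ev_pure PM.pure_balanced[symmetric] \<psi>.pairing_closed ract_\<psi>
          PM.tensor_smult_pure \<phi>.pairing_closed\<close>)
qed

lemma evaluation_natural:
  assumes M: "left_module R M" and N: "left_module R N" and f: "f \<in> left_hom R M N"
    and q: "q \<in> carrier Q" and t: "t \<in> carrier (tensor_module R P M)"
  shows "evaluation N q (fmap (tensor_functor R P) M N f t) = f (evaluation M q t)"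
proof -
  interpret PM: tensor_product S R P M by (rule \<phi>.P.tensor_productI[OF M])
  show ?thesis
    by (rule PM.additive_ext[where D = N and g = "\<lambda>t. f (evaluation M q t)",
          OF additive_compose[OF \<phi>.P.tensor_map_additive[OF M N f] evaluation_additive[OF N q]]
            additive_compose[OF evaluation_additive[OF M q] left_hom_additive[OF f]]
            left_module_abelian_group[OF N] _ t])
       (simp add: \<phi>.P.tensor_map_pure[OF M N f] evaluation_pure[OF M q] evaluation_pure[OF N q]
          left_hom_closed[OF f] left_hom_smult[OF f] \<psi>.pairing_closed q)
qed

lemma contraction_exists:
  assumes M: "left_module R M"
  shows "\<exists>e. additive_map (tensor_module S Q (tensor_module R P M)) M e \<and>
    (\<forall>q\<in>carrier Q. \<forall>t\<in>carrier (tensor_module R P M).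
       e (pure_tensor S Q (tensor_module R P M) q t) = evaluation M q t)"
proof -
  interpret PM: tensor_product S R P M by (rule \<phi>.P.tensor_productI[OF M])
  interpret QPM: tensor_product R S Q PM.T
    by (rule \<phi>.Q.tensor_productI[OF PM.tensor_left_module])
  show ?thesis
    by (rule QPM.lift_exists[OF PM.N.M.abelian_group_axioms])
       (simp_all add: additive_closed[OF evaluation_additive[OF M]] additive_add[OF evaluation_additive[OF M]]
          evaluation_add[OF M] evaluation_ract[OF M])
qed

definition contraction :: "('r, 'm) module \<Rightarrow> (('q \<times> (('p \<times> 'm) \<Rightarrow>\<^sub>0 int) set) \<Rightarrow>\<^sub>0 int) set \<Rightarrow> 'm" where
  "contraction M = (SOME e. additive_map (tensor_module S Q (tensor_module R P M)) M e \<and>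
    (\<forall>q\<in>carrier Q. \<forall>t\<in>carrier (tensor_module R P M).
       e (pure_tensor S Q (tensor_module R P M) q t) = evaluation M q t))"

lemma
  assumes "left_module R M"
  shows contraction_additive:
      "additive_map (tensor_module S Q (tensor_module R P M)) M (contraction M)"
    and contraction_pure: "\<lbrakk>q \<in> carrier Q; t \<in> carrier (tensor_module R P M)\<rbrakk> \<Longrightarrow>
      contraction M (pure_tensor S Q (tensor_module R P M) q t) = evaluation M q t"
  using someI_ex[OF contraction_exists[OF assms], folded contraction_def] by blast+

text \<open>
  Bijectivity comes from \<open>\<psi> q p \<cdot> t = q \<otimes> (p \<otimes> contraction t)\<close>. The contraction of
  \<open>t\<close> therefore determines the products of \<open>t\<close> with all values of \<open>\<psi>\<close>, and these values generate \<open>1\<close>.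
\<close>

lemma
  assumes M: "left_module R M"
  shows contraction_smult: "\<lbrakk>a \<in> carrier R; t \<in> carrier (tensor_module S Q (tensor_module R P M))\<rbrakk> \<Longrightarrow>
      contraction M (a \<odot>\<^bsub>tensor_module S Q (tensor_module R P M)\<^esub> t) = a \<odot>\<^bsub>M\<^esub> contraction M t"
    and contraction_bij:
      "bij_betw (contraction M) (carrier (tensor_module S Q (tensor_module R P M))) (carrier M)"
proof -
  interpret PM: tensor_product S R P M by (rule \<phi>.P.tensor_productI[OF M])
  interpret QPM: tensor_product R S Q PM.T
    by (rule \<phi>.Q.tensor_productI[OF PM.tensor_left_module])
  let ?\<eta> = "contraction M"
  note MG = PM.N.M.abelian_group_axioms
  note \<eta> = contraction_additive[OF M]
  note \<eta>_pure = contraction_pure[OF M]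
  show "?\<eta> (a \<odot>\<^bsub>QPM.T\<^esub> t) = a \<odot>\<^bsub>M\<^esub> ?\<eta> t" if a: "a \<in> carrier R" and t: "t \<in> carrier QPM.T" for a t
    by (rule QPM.additive_ext[where D = M and f = "\<lambda>t. ?\<eta> (a \<odot>\<^bsub>QPM.T\<^esub> t)" and g = "\<lambda>t. a \<odot>\<^bsub>M\<^esub> ?\<eta> t",
          OF additive_compose[OF QPM.tensor_smult_additive[OF a] \<eta>]
            additive_compose[OF \<eta> PM.N.additive_smult[OF a]] MG _ t])
       (simp add: a \<eta>_pure QPM.tensor_smult_pure \<phi>.Q.P.smult_closed evaluation_smult[OF M])
  have key: "\<psi> q p \<odot>\<^bsub>QPM.T\<^esub> t = QPM.pure q (PM.pure p (?\<eta> t))"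
    if q: "q \<in> carrier Q" and p: "p \<in> carrier P" and t: "t \<in> carrier QPM.T" for q p t
    by (rule QPM.additive_ext[where D = QPM.T and g = "\<lambda>t. QPM.pure q (PM.pure p (?\<eta> t))",
          OF QPM.tensor_smult_additive[OF \<psi>.pairing_closed[OF q p]]
            additive_compose[OF additive_compose[OF \<eta> PM.additive_pure_right[OF p]] QPM.additive_pure_right[OF q]]
            QPM.tensor_abelian_group _ t])
       (simp add: q p \<eta>_pure QPM.tensor_smult_pure \<psi>.pairing_closed ract_\<phi>[symmetric]
          QPM.pure_balanced \<phi>.pairing_closed smult_pairing[OF M])
  have inj: "inj_on ?\<eta> (carrier QPM.T)"
  proof (rule inj_onI)
    fix t t' assume "t \<in> carrier QPM.T" "t' \<in> carrier QPM.T" "?\<eta> t = ?\<eta> t'"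
    then show "t = t'"
      by - (rule \<psi>.eq_if_trace_eq[OF one_in_trace_\<psi> QPM.tensor_left_module], simp_all add: key)
  qed
  have img: "subgroup (?\<eta> ` carrier QPM.T) (add_monoid M)"
    by (rule additive_map_image[OF \<eta> QPM.tensor_abelian_group MG])
  have "m \<in> ?\<eta> ` carrier QPM.T" if m: "m \<in> carrier M" for m
  proof (rule \<psi>.closed_under_trace[OF one_in_trace_\<psi> M m img])
    fix q p assume qp: "q \<in> carrier Q" "p \<in> carrier P"
    then have "\<psi> q p \<odot>\<^bsub>M\<^esub> m = ?\<eta> (QPM.pure q (PM.pure p m))"
      by (simp add: \<eta>_pure evaluation_pure[OF M] m PM.pure_closed)
    with qp m show "\<psi> q p \<odot>\<^bsub>M\<^esub> m \<in> ?\<eta> ` carrier QPM.T"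
      by (auto intro: QPM.pure_closed PM.pure_closed)
  qed
  then show "bij_betw ?\<eta> (carrier QPM.T) (carrier M)"
    using inj additive_closed[OF \<eta>] by (auto simp: bij_betw_def)
qed

lemma contraction_natural:
  assumes M: "left_module R M" and N: "left_module R N" and f: "f \<in> left_hom R M N"
    and t: "t \<in> carrier (tensor_module S Q (tensor_module R P M))"
  shows "contraction N (fmap (tensor_functor S Q) (tensor_module R P M) (tensor_module R P N)
      (fmap (tensor_functor R P) M N f) t) = f (contraction M t)"
proof -
  interpret PM: tensor_product S R P M by (rule \<phi>.P.tensor_productI[OF M])
  interpret QPM: tensor_product R S Q PM.T
    by (rule \<phi>.Q.tensor_productI[OF PM.tensor_left_module])
  interpret PN: tensor_product S R P N by (rule \<phi>.P.tensor_productI[OF N])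
  note Pf = \<phi>.P.tensor_map_hom[OF M N f]
  note QPf = PM.tensor_left_module PN.tensor_left_module Pf
  show ?thesis
    by (rule QPM.additive_ext[where D = N and g = "\<lambda>t. f (contraction M t)",
        OF additive_compose[OF \<phi>.Q.tensor_map_additive[OF QPf] contraction_additive[OF N]]
          additive_compose[OF contraction_additive[OF M] left_hom_additive[OF f]]
          left_module_abelian_group[OF N] _ t])
       (simp add: \<phi>.Q.tensor_map_pure[OF QPf] contraction_pure[OF M] contraction_pure[OF N]
          evaluation_natural[OF M N f] left_hom_closed[OF Pf])
qed

theorem tensor_functors_inverse:
  "functorial_iso R R (comp_functor (tensor_functor S Q) (tensor_functor R P))
     (id_functor :: ('r, 'm, 'r, 'm) mod_functor)"
proof (rule functorial_isoI[where \<theta> = contraction])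
  show "is_functor R R (comp_functor (tensor_functor S Q) (tensor_functor R P))"
    by (rule is_functor_comp[OF \<phi>.P.tensor_is_functor \<phi>.Q.tensor_is_functor])
  show "is_functor R R id_functor"
    by (rule is_functor_id)
qed (simp_all add: comp_functor_def id_functor_def contraction_additive contraction_smult
      contraction_bij contraction_natural)

text \<open>
  The proof is parallel to that for \<open>contraction\<close>: injectivity follows from \<open>\<phi> p q \<cdot> t = p \<otimes> evaluation q t\<close>,
  and surjectivity because \<open>\<phi> p q \<cdot> g\<close> is, for every homomorphism \<open>g\<close>, the image of \<open>p \<otimes> g q\<close>.
\<close>

theorem tensor_iso_hom:
  assumes "bimodule_over R S Q"
  shows "functorial_iso R S (tensor_functor R P) (hom_functor R Q :: ('r, 'm, 's, 'q \<Rightarrow> 'm) mod_functor)"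
proof (rule functorial_isoI[where \<theta> = "\<lambda>M t. \<lambda>q\<in>carrier Q. evaluation M q t"])
  interpret Q: bimodule_over R S Q by fact
  show "is_functor R S (tensor_functor R P)" by (rule \<phi>.P.tensor_is_functor)
  show "is_functor R S (hom_functor R Q)" by (rule Q.hom_is_functor)
  fix M :: "('r, 'm) module" assume M: "left_module R M"
  interpret PM: tensor_product S R P M by (rule \<phi>.P.tensor_productI[OF M])
  let ?H = "hom_module R Q M"
  let ?\<theta> = "\<lambda>t. \<lambda>q\<in>carrier Q. evaluation M q t"
  have H: "left_module S ?H" by (rule Q.hom_left_module[OF M])
  have hom: "?\<theta> t \<in> left_hom R Q M" if "t \<in> carrier PM.T" for t
    by (rule left_hom_restrictI[OF \<phi>.Q.P.left_module_axioms additiveI])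
       (use that in \<open>simp_all add: additive_closed[OF evaluation_additive[OF M]] evaluation_add[OF M] evaluation_smult[OF M]\<close>)
  show add: "additive_map (fobj (tensor_functor R P) M) (fobj (hom_functor R Q) M) ?\<theta>"
    unfolding fobj_tensor_functor fobj_hom_functor
    by (rule additiveI)
       (auto simp: hom hom_module_def additive_add[OF evaluation_additive[OF M]] fun_eq_iff)
  show smult: "?\<theta> (s \<odot>\<^bsub>fobj (tensor_functor R P) M\<^esub> t) = s \<odot>\<^bsub>fobj (hom_functor R Q) M\<^esub> ?\<theta> t"
    if "s \<in> carrier S" "t \<in> carrier (fobj (tensor_functor R P) M)" for s t
    using that by (auto simp: hom_module_def evaluation_ract[OF M] \<phi>.Q.ract_closed fun_eq_iff)
  have inj: "inj_on ?\<theta> (carrier PM.T)"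
  proof (rule inj_onI)
    fix t t' assume t: "t \<in> carrier PM.T" "t' \<in> carrier PM.T" and eq: "?\<theta> t = ?\<theta> t'"
    have "evaluation M q t = evaluation M q t'" if "q \<in> carrier Q" for q
      using fun_cong[OF eq, of q] that by simp
    with t show "t = t'"
      by - (rule \<phi>.eq_if_trace_eq[OF one_in_trace_\<phi> PM.tensor_left_module],
            simp_all add: smult_pairing[OF M])
  qed
  have img: "subgroup (?\<theta> ` carrier PM.T) (add_monoid ?H)"
    using additive_map_image[OF add] PM.tensor_abelian_group left_module_abelian_group[OF H] by simp
  have "g \<in> ?\<theta> ` carrier PM.T" if g: "g \<in> carrier ?H" for g
  proof (rule \<phi>.closed_under_trace[OF one_in_trace_\<phi> H g img])
    fix p q assume p: "p \<in> carrier P" and q: "q \<in> carrier Q"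
    have g': "g \<in> left_hom R Q M" using g by (simp add: hom_module_def)
    have "\<phi> p q \<odot>\<^bsub>?H\<^esub> g = ?\<theta> (PM.pure p (g q))"
      using p q by (auto simp: hom_module_def fun_eq_iff ract_\<phi> left_hom_smult[OF g'] left_hom_closed[OF g']
          \<psi>.pairing_closed evaluation_pure[OF M])
    then show "\<phi> p q \<odot>\<^bsub>?H\<^esub> g \<in> ?\<theta> ` carrier PM.T"
      using PM.pure_closed[OF p left_hom_closed[OF g' q]] by blast
  qed
  then show "bij_betw ?\<theta> (carrier (fobj (tensor_functor R P) M)) (carrier (fobj (hom_functor R Q) M))"
    using inj hom by (auto simp: bij_betw_def hom_module_def)
next
  fix M N :: "('r, 'm) module" and f t
  assume M: "left_module R M" and N: "left_module R N" and f: "f \<in> left_hom R M N"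
    and t: "t \<in> carrier (fobj (tensor_functor R P) M)"
  have "(\<lambda>q\<in>carrier Q. evaluation M q t) \<in> left_hom R Q M"
    by (rule left_hom_restrictI[OF \<phi>.Q.P.left_module_axioms additiveI])
       (use t in \<open>simp_all add: additive_closed[OF evaluation_additive[OF M]] evaluation_add[OF M] evaluation_smult[OF M]\<close>)
  then show "(\<lambda>q\<in>carrier Q. evaluation N q (fmap (tensor_functor R P) M N f t)) =
      fmap (hom_functor R Q) M N f (\<lambda>q\<in>carrier Q. evaluation M q t)"
    using t by (auto simp: hom_functor_def compose_def fun_eq_iff evaluation_natural[OF M N f])
qed

end

section \<open>The Weyl group and its action on the lattices\<close>

context reduced_root_system
begin

abbreviation "root_reflection \<equiv> reflection scale coroot"
abbreviation "W \<equiv> weyl_group scale \<Delta> coroot"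

lemma coroot_hom: "\<alpha> \<in> \<Delta> \<Longrightarrow> Vector_Spaces.linear scale (*) (coroot \<alpha>)"
  using coroot_linear by (simp add: dual_space_def)

lemma reflection_linear:
  assumes "\<alpha> \<in> \<Delta>"
  shows "Vector_Spaces.linear scale scale (root_reflection \<alpha>)"
proof -
  interpret c: Vector_Spaces.linear scale "(*)" "coroot \<alpha>" by (rule coroot_hom[OF assms])
  show ?thesis
    by (intro Vector_Spaces.linear_iff[THEN iffD2] conjI allI vector_space_axioms)
       (simp_all add: reflection_def c.add c.scale scale_left_distrib scale_right_diff_distrib)
qed

lemma reflection_reflection:
  assumes "\<alpha> \<in> \<Delta>"
  shows "root_reflection \<alpha> (root_reflection \<alpha> v) = v"
proof -
  interpret c: Vector_Spaces.linear scale "(*)" "coroot \<alpha>" by (rule coroot_hom[OF assms])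
  have "coroot \<alpha> (root_reflection \<alpha> v) = - coroot \<alpha> v"
    using assms by (simp add: reflection_def c.diff c.scale coroot_self)
  then show ?thesis by (simp add: reflection_def)
qed

lemma reflection_bij: "\<alpha> \<in> \<Delta> \<Longrightarrow> bij (root_reflection \<alpha>)"
  by (rule o_bij[of "root_reflection \<alpha>"]) (simp_all add: fun_eq_iff reflection_reflection)

lemma reflection_in_Bij: "root_reflection ` \<Delta> \<subseteq> carrier (BijGroup UNIV)"
  by (auto simp: BijGroup_def Bij_def reflection_bij)

lemma BijGroup_UNIV:
  "\<one>\<^bsub>BijGroup UNIV\<^esub> = id"
  "\<lbrakk>bij f; bij g\<rbrakk> \<Longrightarrow> f \<otimes>\<^bsub>BijGroup UNIV\<^esub> g = f \<circ> g"
  "bij f \<Longrightarrow> inv\<^bsub>BijGroup UNIV\<^esub> f = inv_into UNIV f"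
proof -
  show "\<one>\<^bsub>BijGroup UNIV\<^esub> = id"
    by (auto simp: BijGroup_def)
  show "f \<otimes>\<^bsub>BijGroup UNIV\<^esub> g = f \<circ> g" if "bij f" "bij g"
    using that by (auto simp: BijGroup_def Bij_def compose_def)
  show "inv\<^bsub>BijGroup UNIV\<^esub> f = inv_into UNIV f" if "bij f"
    using that inv_BijGroup[of f UNIV] by (simp add: Bij_def fun_eq_iff)
qed

lemma weyl_subgroup: "subgroup W (BijGroup UNIV)"
  unfolding weyl_group_def by (rule group.generate_is_subgroup[OF group_BijGroup reflection_in_Bij])

lemma weyl_bij: "w \<in> W \<Longrightarrow> bij w"
  using subgroup.subset[OF weyl_subgroup] by (auto simp: BijGroup_def Bij_def)

lemma weyl_id: "id \<in> W"
  using subgroup.one_closed[OF weyl_subgroup] by (simp add: BijGroup_UNIV)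

lemma weyl_comp: "\<lbrakk>w \<in> W; u \<in> W\<rbrakk> \<Longrightarrow> w \<circ> u \<in> W"
  using subgroup.m_closed[OF weyl_subgroup, of w u] by (simp add: BijGroup_UNIV weyl_bij)

lemma weyl_inv: "w \<in> W \<Longrightarrow> inv_into UNIV w \<in> W"
  using subgroup.m_inv_closed[OF weyl_subgroup, of w] by (simp add: BijGroup_UNIV weyl_bij)

lemma weyl_linear_roots:
  assumes "w \<in> W"
  shows "Vector_Spaces.linear scale scale w \<and> w ` \<Delta> \<subseteq> \<Delta>"
  using assms unfolding weyl_group_def
proof (induction w rule: generate.induct)
  case one
  show ?case
    by (auto simp: BijGroup_UNIV id_def linear_ident)
next
  case (incl h)
  then show ?case using reflection_linear reflection_root by auto
next
  case (inv h)
  then obtain \<alpha> where \<alpha>: "\<alpha> \<in> \<Delta>" "h = root_reflection \<alpha>" by auto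
  then have "inv_into UNIV h = h"
    by (intro inv_unique_comp) (simp_all add: fun_eq_iff reflection_reflection)
  then show ?case
    using \<alpha> reflection_linear reflection_root reflection_bij by (auto simp: BijGroup_UNIV)
next
  case (eng h1 h2)
  then have "bij h1" "bij h2"
    using weyl_bij unfolding weyl_group_def by auto
  with eng show ?case
    using Vector_Spaces.linear_compose[of scale scale h2 scale h1] by (auto simp: BijGroup_UNIV o_def)
qed

lemma weyl_linear: "w \<in> W \<Longrightarrow> Vector_Spaces.linear scale scale w"
  using weyl_linear_roots by blast

lemma weyl_add: "w \<in> W \<Longrightarrow> w (v + v') = w v + w v'"
  by (rule module_hom.add[OF Vector_Spaces.linear.axioms(3)[OF weyl_linear]])

text \<open>
  Elements of the Weyl group are linear, so they are determined on any spanning set. Applied to the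
  roots this gives finiteness of the group, and applied to the lattice \<open>Y\<close> its faithful action on \<open>Y\<close>.
\<close>

lemma weyl_eqI:
  assumes "w \<in> W" "u \<in> W" "\<And>b. b \<in> B \<Longrightarrow> w b = u b" "span B = UNIV"
  shows "w = u"
proof
  fix v
  interpret p: vector_space_pair scale scale
    by (intro vector_space_pair.intro vector_space_axioms)
  show "w v = u v"
    using p.linear_eq_on_span[OF weyl_linear[OF assms(1)] weyl_linear[OF assms(2)], of B v] assms(3,4) by auto
qed

lemma weyl_finite: "finite W"
proof (rule finite_imageD)
  show "inj_on (\<lambda>w. restrict w \<Delta>) W"
  proof (rule inj_onI)
    fix w u assume wu: "w \<in> W" "u \<in> W" and eq: "restrict w \<Delta> = restrict u \<Delta>"
    show "w = u"
      by (rule weyl_eqI[OF wu _ roots_span]) (use fun_cong[OF eq] in \<open>metis restrict_apply\<close>)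
  qed
  have "(\<lambda>w. restrict w \<Delta>) ` W \<subseteq> \<Delta> \<rightarrow>\<^sub>E \<Delta>"
    using weyl_linear_roots by (auto simp: image_subset_iff)
  then show "finite ((\<lambda>w. restrict w \<Delta>) ` W)"
    by (rule finite_subset) (simp add: finite_PiE finite_roots)
qed

end

lemma dual_vector_space: "vector_space (dual_scale :: 'k::field_char_0 \<Rightarrow> ('v \<Rightarrow> 'k) \<Rightarrow> 'v \<Rightarrow> 'k)"
  by (rule vector_space.intro) (auto simp: dual_scale_def fun_eq_iff algebra_simps)

lemma
  assumes V: "vector_space scale" and L: "lattice_in scale U L"
  shows lattice_zero: "0 \<in> L"
    and lattice_add: "\<lbrakk>x \<in> L; y \<in> L\<rbrakk> \<Longrightarrow> x + y \<in> L"
    and lattice_uminus: "x \<in> L \<Longrightarrow> - x \<in> L"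
    and lattice_incl: "L \<subseteq> U"
    and lattice_span: "U \<subseteq> module.span scale L"
proof -
  interpret vector_space scale by fact
  obtain B where B: "finite B" "span B = U"
    and L': "L = {\<Sum>b\<in>B. scale (of_int (c b)) b |c. True}"
    using L unfolding lattice_in_def by blast
  have mem: "(\<Sum>b\<in>B. scale (of_int (c b)) b) \<in> L" for c
    unfolding L' by blast
  show "0 \<in> L" using mem[of "\<lambda>_. 0"] by simp
  show "x + y \<in> L" if xy: "x \<in> L" "y \<in> L" for x y
  proof -
    obtain c d where "x = (\<Sum>b\<in>B. scale (of_int (c b)) b)" "y = (\<Sum>b\<in>B. scale (of_int (d b)) b)"
      using xy unfolding L' by blast
    then show ?thesis
      using mem[of "\<lambda>b. c b + d b"] by (simp add: scale_left_distrib sum.distrib)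
  qed
  show "- x \<in> L" if x: "x \<in> L" for x
  proof -
    obtain c where "x = (\<Sum>b\<in>B. scale (of_int (c b)) b)"
      using x unfolding L' by blast
    then show ?thesis
      using mem[of "\<lambda>b. - c b"] by (simp add: sum_negf)
  qed
  show "L \<subseteq> U"
    unfolding B(2)[symmetric] L' by (auto intro!: span_sum intro: span_scale span_base)
  have "b \<in> L" if "b \<in> B" for b
  proof -
    have "(\<Sum>b'\<in>B. scale (of_int (if b' = b then 1 else 0)) b') = (\<Sum>b'\<in>B. if b' = b then b else 0)"
      by (rule sum.cong) auto
    also have "\<dots> = b" using B(1) that by simp
    finally show ?thesis using mem[of "\<lambda>b'. if b' = b then 1 else 0"] by simp
  qed
  then show "U \<subseteq> span L"
    unfolding B(2)[symmetric] by (intro span_mono) auto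
qed

context quantum_torus_datum
begin

lemma X_linear: "x \<in> X \<Longrightarrow> Vector_Spaces.linear scale (*) x"
  using lattice_incl[OF dual_vector_space lattice_X] by (auto simp: dual_space_def)

lemma X_add_arg: "x \<in> X \<Longrightarrow> x (v + v') = x v + x v'"
  by (rule module_hom.add[OF Vector_Spaces.linear.axioms(3)[OF X_linear]])

lemma X_zero_arg: "x \<in> X \<Longrightarrow> x 0 = 0"
  by (rule module_hom.zero[OF Vector_Spaces.linear.axioms(3)[OF X_linear]])

lemmas X_closed = lattice_zero[OF dual_vector_space lattice_X] lattice_add[OF dual_vector_space lattice_X]
  lattice_uminus[OF dual_vector_space lattice_X]

lemmas Y_closed = lattice_zero[OF vector_space_axioms lattice_Y]
  lattice_add[OF vector_space_axioms lattice_Y] lattice_uminus[OF vector_space_axioms lattice_Y]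

lemma weyl_moves_lattice:
  assumes "w \<in> W" "w \<noteq> id"
  shows "\<exists>y\<in>Y. w y \<noteq> y"
proof (rule ccontr)
  assume "\<not> ?thesis"
  then have "w = id"
    using lattice_span[OF vector_space_axioms lattice_Y]
    by (intro weyl_eqI[OF assms(1) weyl_id, of Y]) auto
  with assms show False by simp
qed

text \<open>
  \<open>q\<^sup>t\<close> for the rational exponents with denominator \<open>n\<close>.
\<close>

definition q_exp :: "'k \<Rightarrow> complex" where "q_exp = q_pow n qn"

lemma q_exp_of_int: "of_nat n * t = of_int a \<Longrightarrow> q_exp t = qn powi a"
  unfolding q_exp_def q_pow_def by (rule arg_cong[of _ _ "\<lambda>a. qn powi a"]) (rule the_equality, auto)

lemma qn_nonzero: "qn \<noteq> 0"
  using qn_root q_nonzero n_pos by (auto simp: zero_power)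

lemma q_exp_nonzero: "of_nat n * t \<in> \<int> \<Longrightarrow> q_exp t \<noteq> 0"
  using q_exp_of_int[of t] qn_nonzero by (auto simp: Ints_def)

lemma q_exp_zero: "q_exp 0 = 1"
  using q_exp_of_int[of 0 0] by simp

lemma q_exp_add:
  assumes "of_nat n * s \<in> \<int>" "of_nat n * t \<in> \<int>"
  shows "q_exp (s + t) = q_exp s * q_exp t"
proof -
  obtain a b where "of_nat n * s = of_int a" "of_nat n * t = of_int b"
    using assms by (auto simp: Ints_def)
  then show ?thesis
    using q_exp_of_int[of s a] q_exp_of_int[of t b] q_exp_of_int[of "s + t" "a + b"] qn_nonzero
    by (simp add: power_int_add ring_distribs)
qed

text \<open>
  As \<open>q\<close> is not a root of unity, \<open>t \<mapsto> q\<^sup>t\<close> is injective on the exponents that occur.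
\<close>

lemma q_exp_eq_one:
  assumes "of_nat n * t \<in> \<int>" "q_exp t = 1"
  shows "t = 0"
proof -
  obtain a where a: "of_nat n * t = of_int a" using assms by (auto simp: Ints_def)
  then have 1: "qn powi a = 1" using assms q_exp_of_int by simp
  have "a = 0"
  proof (rule ccontr)
    assume "a \<noteq> 0"
    have "qn powi \<bar>a\<bar> = 1"
      using 1 by (cases "a \<ge> 0") (simp_all add: power_int_minus)
    then have "qn ^ nat \<bar>a\<bar> = 1"
      by (simp add: power_int_def)
    then have "q ^ nat \<bar>a\<bar> = 1"
      unfolding qn_root[symmetric] by (metis power_mult mult.commute power_one)
    with \<open>a \<noteq> 0\<close> q_not_root_of_unity[of "nat \<bar>a\<bar>"] show False by simp
  qed
  with a n_pos show ?thesis by simp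
qed

end

section \<open>Additive extension from monomials\<close>

lemma poly_mapping_sum_singles:
  "f = (\<Sum>k\<in>Poly_Mapping.keys f. Poly_Mapping.single k (Poly_Mapping.lookup f k))"
  by (rule poly_mapping_eqI)
     (simp add: lookup_sum lookup_single when_def sum.delta' in_keys_iff)

lemma poly_mapping_additive_induct [case_names zero single add]:
  fixes f :: "'a \<Rightarrow>\<^sub>0 'b::comm_monoid_add"
  assumes "Q 0" "\<And>k. k \<in> Poly_Mapping.keys f \<Longrightarrow> Q (Poly_Mapping.single k (Poly_Mapping.lookup f k))"
    and "\<And>g h. \<lbrakk>Q g; Q h\<rbrakk> \<Longrightarrow> Q (g + h)"
  shows "Q f"
proof -
  have "Q (\<Sum>k\<in>A. Poly_Mapping.single k (Poly_Mapping.lookup f k))"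
    if "finite A" "A \<subseteq> Poly_Mapping.keys f" for A
    using that by (induction A rule: finite_induct) (auto intro: assms)
  from this[OF finite_keys order_refl] show ?thesis
    by (subst poly_mapping_sum_singles)
qed

text \<open>
  Products, group actions and module structures on the finitely supported functions of this theory
  are all sums over a support, with summands additive in the coefficient. Writing them with this
  operator makes additivity and the values on monomials immediate, and an identity only has to be
  checked on monomials.
\<close>

definition additive_extension :: "('a \<Rightarrow> 'b \<Rightarrow> 'c) \<Rightarrow> ('a \<Rightarrow>\<^sub>0 'b::ab_group_add) \<Rightarrow> 'c::ab_group_add" where
  "additive_extension \<phi> f = (\<Sum>k\<in>Poly_Mapping.keys f. \<phi> k (Poly_Mapping.lookup f k))"

lemma additive_fun_zero:
  fixes h :: "'a::ab_group_add \<Rightarrow> 'b::ab_group_add"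
  assumes "\<And>x y. h (x + y) = h x + h y"
  shows "h 0 = 0"
  using assms[of 0 0] by simp

lemma additive_extension_superset:
  assumes "\<And>k a b. \<phi> k (a + b) = \<phi> k a + \<phi> k b" "finite A" "Poly_Mapping.keys f \<subseteq> A"
  shows "additive_extension \<phi> f = (\<Sum>k\<in>A. \<phi> k (Poly_Mapping.lookup f k))"
  unfolding additive_extension_def
  by (rule sum.mono_neutral_left) (use assms additive_fun_zero[of "\<phi> _"] in \<open>auto simp: in_keys_iff\<close>)

lemma additive_extension_add:
  assumes "\<And>k a b. \<phi> k (a + b) = \<phi> k a + \<phi> k b"
  shows "additive_extension \<phi> (f + g) = additive_extension \<phi> f + additive_extension \<phi> g"
  using additive_extension_superset[of \<phi> "Poly_Mapping.keys f \<union> Poly_Mapping.keys g", OF assms] keys_add[of f g]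
  by (simp add: assms lookup_add sum.distrib)

lemma additive_extension_single:
  assumes "\<And>a b. \<phi> k (a + b) = \<phi> k a + \<phi> k b"
  shows "additive_extension \<phi> (Poly_Mapping.single k c) = \<phi> k c"
  using additive_fun_zero[of "\<phi> k", OF assms] by (cases "c = 0") (simp_all add: additive_extension_def)

lemma additive_extension_fun_add:
  "additive_extension (\<lambda>k c. \<phi> k c + \<psi> k c) f = additive_extension \<phi> f + additive_extension \<psi> f"
  by (simp add: additive_extension_def sum.distrib)

lemma additive_fun_sum:
  fixes h :: "'a::ab_group_add \<Rightarrow> 'b::ab_group_add"
  assumes "\<And>x y. h (x + y) = h x + h y"
  shows "h (\<Sum>i\<in>A. g i) = (\<Sum>i\<in>A. h (g i))"
proof -
  have "h 0 = 0" by (rule additive_fun_zero[OF assms])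
  then show ?thesis using sum_comp_morphism[of h g A] assms by (simp add: o_def)
qed

section \<open>The quantum torus\<close>

context quantum_torus_datum
begin

abbreviation "H \<equiv> quantum_torus X Y n qn"
abbreviation tmult :: "('k, 'v) torus \<Rightarrow> ('k, 'v) torus \<Rightarrow> ('k, 'v) torus" (infixl \<open>\<star>\<close> 70) where "tmult \<equiv> torus_mult n qn"
text \<open>
  \<open>monom x y c\<close> is \<open>c e\<^sup>x e\<^sup>y\<close>.
\<close>

abbreviation "monom x y c \<equiv> Poly_Mapping.single (x :: 'v \<Rightarrow> 'k, y :: 'v) (c :: complex)"

lemma torus_record:
  "f \<in> carrier H \<longleftrightarrow> Poly_Mapping.keys f \<subseteq> X \<times> Y" "monoid.mult H = torus_mult n qn"
  "\<one>\<^bsub>H\<^esub> = monom 0 0 1" "\<zero>\<^bsub>H\<^esub> = 0" "ring.add H = (+)"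
  by (simp_all add: quantum_torus_def)

lemma torus_mult_extension:
  "f \<star> g = additive_extension (\<lambda>k c. additive_extension (\<lambda>l d.
     monom (fst k + fst l) (snd k + snd l) (c * d * q_exp (- fst l (snd k)))) g) f"
  by (simp add: torus_mult_def additive_extension_def case_prod_unfold q_exp_def)

lemma torus_mult_add:
  shows "(f + g) \<star> h = f \<star> h + g \<star> h"
    and "f \<star> (g + h) = f \<star> g + f \<star> h"
  unfolding torus_mult_extension
  by (simp_all add: additive_extension_add additive_extension_fun_add distrib_left distrib_right single_add)

lemma torus_mult_monom: "monom x y c \<star> monom x' y' d = monom (x + x') (y + y') (c * d * q_exp (- x' y))"
  unfolding torus_mult_extension
  by (simp add: additive_extension_single additive_extension_fun_add distrib_left distrib_right single_add)

lemma torus_mult_zero [simp]: "0 \<star> f = 0" "f \<star> 0 = 0"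
  by (simp_all add: torus_mult_def)

lemma torus_mult_sum:
  "(\<Sum>i\<in>I. f i) \<star> g = (\<Sum>i\<in>I. f i \<star> g)" "g \<star> (\<Sum>i\<in>I. f i) = (\<Sum>i\<in>I. g \<star> f i)"
  by (rule additive_fun_sum, rule torus_mult_add)+

lemma torus_act_extension:
  "torus_act w f = additive_extension (\<lambda>k c. monom (dual_act w (fst k)) (w (snd k)) c) f"
  by (simp add: torus_act_def additive_extension_def case_prod_unfold)

lemma torus_act_add: "torus_act w (f + g :: ('k, 'v) torus) = torus_act w f + torus_act w g"
  unfolding torus_act_extension by (simp add: additive_extension_add single_add)

lemma torus_act_monom: "torus_act w (monom x y c) = monom (dual_act w x) (w y) c"
  unfolding torus_act_extension by (simp add: additive_extension_single single_add)

lemma torus_act_zero [simp]: "torus_act w (0 :: ('k, 'v) torus) = 0"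
  by (simp add: torus_act_def)

lemma torus_act_sum: "torus_act w (\<Sum>i\<in>I. f i :: ('k, 'v) torus) = (\<Sum>i\<in>I. torus_act w (f i))"
  by (rule additive_fun_sum, rule torus_act_add)

lemma monom_closed: "\<lbrakk>x \<in> X; y \<in> Y\<rbrakk> \<Longrightarrow> monom x y c \<in> carrier H"
  by (simp add: torus_record)

lemma torus_zero_closed: "0 \<in> carrier H"
  by (simp add: torus_record)

lemma torus_add_closed: "\<lbrakk>f \<in> carrier H; g \<in> carrier H\<rbrakk> \<Longrightarrow> f + g \<in> carrier H"
  using keys_add[of f g] by (auto simp: torus_record)

lemma torus_diff_closed: "\<lbrakk>f \<in> carrier H; g \<in> carrier H\<rbrakk> \<Longrightarrow> f - g \<in> carrier H"
  using keys_diff[of f g] by (auto simp: torus_record)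

lemma torus_sum_closed: "(\<And>i. i \<in> I \<Longrightarrow> f i \<in> carrier H) \<Longrightarrow> (\<Sum>i\<in>I. f i) \<in> carrier H"
  by (induction I rule: infinite_finite_induct) (auto intro: torus_zero_closed torus_add_closed)

lemma torus_induct [consumes 1, case_names zero monom add]:
  assumes "f \<in> carrier H" "Q 0" "\<And>x y c. \<lbrakk>x \<in> X; y \<in> Y\<rbrakk> \<Longrightarrow> Q (monom x y c)"
    and "\<And>g h. \<lbrakk>g \<in> carrier H; h \<in> carrier H; Q g; Q h\<rbrakk> \<Longrightarrow> Q (g + h)"
  shows "Q f"
proof -
  have "f \<in> carrier H \<and> Q f"
  proof (rule poly_mapping_additive_induct[where Q = "\<lambda>f. f \<in> carrier H \<and> Q f"])
    fix k assume "k \<in> Poly_Mapping.keys f"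
    then have "fst k \<in> X" "snd k \<in> Y" using assms(1) by (auto simp: torus_record(1))
    then show "Poly_Mapping.single k (Poly_Mapping.lookup f k) \<in> carrier H \<and>
        Q (Poly_Mapping.single k (Poly_Mapping.lookup f k))"
      using assms(3)[of "fst k" "snd k"] monom_closed[of "fst k" "snd k"] by simp
  qed (simp_all add: assms torus_zero_closed torus_add_closed)
  then show ?thesis ..
qed

lemma pairing_integrals:
  "\<lbrakk>x \<in> X; y \<in> Y\<rbrakk> \<Longrightarrow> of_nat n * x y \<in> \<int>"
  "\<lbrakk>x \<in> X; y \<in> Y\<rbrakk> \<Longrightarrow> - (of_nat n * x y) \<in> \<int>"
  using pairing_integral[of x y] by auto

lemma torus_mult_closed:
  assumes "f \<in> carrier H" "g \<in> carrier H"
  shows "f \<star> g \<in> carrier H"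
  using assms
proof (induction f rule: torus_induct)
  case (monom x y c)
  from monom(3) show ?case
    by (induction g rule: torus_induct)
       (auto simp: torus_mult_monom torus_mult_add monom X_closed Y_closed
         intro: monom_closed torus_zero_closed torus_add_closed)
qed (auto simp: torus_mult_add intro: torus_zero_closed torus_add_closed)

lemma torus_mult_assoc:
  assumes "f \<in> carrier H" "g \<in> carrier H" "h \<in> carrier H"
  shows "(f \<star> g) \<star> h = f \<star> (g \<star> h)"
  using assms
proof (induction f rule: torus_induct)
  case (monom x y c)
  from monom(3,4) show ?case
  proof (induction g rule: torus_induct)
    case (monom x' y' d)
    note outer = \<open>x \<in> X\<close> \<open>y \<in> Y\<close> monom(1,2)
    from monom(3) show ?case
    proof (induction h rule: torus_induct)
      case (monom x'' y'' e)
      have "q_exp (- x'' (y + y')) = q_exp (- x'' y) * q_exp (- x'' y')"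
        using q_exp_add[of "- x'' y" "- x'' y'"] monom outer
        by (simp add: X_add_arg pairing_integrals)
      moreover have "q_exp (- (x' + x'') y) = q_exp (- x' y) * q_exp (- x'' y)"
        using q_exp_add[of "- x' y" "- x'' y"] monom outer
        by (simp add: pairing_integrals)
      ultimately show ?case
        by (simp add: torus_mult_monom add.assoc mult.assoc mult.left_commute mult.commute)
    qed (simp_all add: torus_mult_add)
  qed (simp_all add: torus_mult_add)
qed (simp_all add: torus_mult_add)

lemma torus_one_closed: "monom 0 0 1 \<in> carrier H"
  by (rule monom_closed) (simp_all add: X_closed Y_closed)

lemma torus_mult_one:
  assumes "f \<in> carrier H"
  shows "monom 0 0 1 \<star> f = f" "f \<star> monom 0 0 1 = f"
  using assms
  by (induction f rule: torus_induct)
     (simp_all add: torus_mult_add torus_mult_monom q_exp_zero X_zero_arg mult.commute)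

lemma torus_ring: "ring H"
proof (rule ringI)
  show "abelian_group H"
  proof (rule abelian_groupI)
    fix f assume "f \<in> carrier H"
    then show "\<exists>g\<in>carrier H. g \<oplus>\<^bsub>H\<^esub> f = \<zero>\<^bsub>H\<^esub>"
      using torus_diff_closed[OF torus_zero_closed] by (intro bexI[of _ "0 - f"]) (auto simp: torus_record(4,5))
  qed (simp_all add: torus_record(4,5) torus_add_closed torus_zero_closed add_ac)
  show "monoid H"
    by (rule monoidI) (simp_all add: torus_record(2,3) torus_mult_closed torus_one_closed torus_mult_assoc torus_mult_one)
qed (simp_all add: torus_record(2,5) torus_mult_add)

lemma dual_act_apply: "w \<in> W \<Longrightarrow> dual_act w x (w y) = x y"
  by (simp add: dual_act_def weyl_bij bij_is_inj)

lemma dual_act_id: "dual_act id x = x"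
  by (simp add: dual_act_def fun_eq_iff)

lemma dual_act_add: "dual_act w (x + x' :: 'v \<Rightarrow> 'k) = dual_act w x + dual_act w x'"
  by (simp add: dual_act_def fun_eq_iff)

lemma dual_act_comp: "\<lbrakk>w \<in> W; u \<in> W\<rbrakk> \<Longrightarrow> dual_act (w \<circ> u) x = dual_act w (dual_act u x)"
  unfolding dual_act_def by (subst o_inv_distrib) (simp_all only: weyl_bij o_assoc)

lemma torus_act_closed:
  assumes w: "w \<in> W" and "f \<in> carrier H"
  shows "torus_act w f \<in> carrier H"
  using assms(2)
  by (induction f rule: torus_induct)
     (auto simp: torus_act_monom torus_act_add X_invariant[OF w] Y_invariant[OF w]
       intro: monom_closed torus_zero_closed torus_add_closed)

lemma torus_act_mult:
  assumes w: "w \<in> W" and "f \<in> carrier H" "g \<in> carrier H"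
  shows "torus_act w (f \<star> g) = torus_act w f \<star> torus_act w g"
  using assms(2,3)
proof (induction f rule: torus_induct)
  case (monom x y c)
  from monom(3) show ?case
    by (induction g rule: torus_induct)
       (simp_all add: torus_mult_monom torus_act_monom torus_mult_add torus_act_add
          dual_act_apply[OF w] weyl_add[OF w] dual_act_add)
qed (simp_all add: torus_mult_add torus_act_add)

lemma torus_act_id: "f \<in> carrier H \<Longrightarrow> torus_act id f = f"
  by (induction f rule: torus_induct) (simp_all add: torus_act_add torus_act_monom dual_act_id[unfolded id_def])

lemma torus_act_comp:
  assumes "w \<in> W" "u \<in> W" "f \<in> carrier H"
  shows "torus_act (w \<circ> u) f = torus_act w (torus_act u f)"
  using assms(3)
  by (induction f rule: torus_induct)
     (simp_all add: torus_act_add torus_act_monom dual_act_comp[unfolded o_def] assms(1,2))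

lemma torus_act_scalar: "w \<in> W \<Longrightarrow> torus_act w (monom 0 0 c) = monom 0 0 c"
  using weyl_add[of w 0 0] by (simp add: torus_act_monom dual_act_def zero_fun_def o_def)

lemma weyl_inv_comp: "w \<in> W \<Longrightarrow> w \<circ> inv_into UNIV w = id" "w \<in> W \<Longrightarrow> inv_into UNIV w \<circ> w = id"
  using weyl_bij[of w] by (simp_all add: fun_eq_iff bij_is_surj surj_f_inv_f bij_is_inj)

lemma torus_act_inv:
  assumes "w \<in> W" "f \<in> carrier H"
  shows "torus_act w (torus_act (inv_into UNIV w) f) = f"
    and "torus_act (inv_into UNIV w) (torus_act w f) = f"
  using assms torus_act_comp[of w "inv_into UNIV w" f] torus_act_comp[of "inv_into UNIV w" w f]
  by (simp_all add: weyl_inv_comp weyl_inv torus_act_id)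

text \<open>
  Sums over the group may be reindexed by translations and by inversion.
\<close>

lemma weyl_sum_translate:
  assumes "v \<in> W"
  shows "(\<Sum>w\<in>W. F (v \<circ> w)) = (\<Sum>w\<in>W. F w)" "(\<Sum>w\<in>W. F (w \<circ> v)) = (\<Sum>w\<in>W. F w)"
    "(\<Sum>w\<in>W. F (inv_into UNIV w)) = (\<Sum>w\<in>W. F w)"
proof -
  let ?i = "inv_into UNIV v"
  note inv = weyl_inv_comp[OF assms]
  have cancel: "v \<circ> (?i \<circ> w) = w" "?i \<circ> (v \<circ> w) = w" "(w \<circ> v) \<circ> ?i = w" "(w \<circ> ?i) \<circ> v = w" for w
    using inv by (metis comp_assoc comp_id id_comp)+
  show "(\<Sum>w\<in>W. F (v \<circ> w)) = (\<Sum>w\<in>W. F w)"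
    by (rule sum.reindex_bij_witness[of _ "\<lambda>w. ?i \<circ> w" "\<lambda>w. v \<circ> w"])
       (use assms weyl_inv weyl_comp cancel in auto)
  show "(\<Sum>w\<in>W. F (w \<circ> v)) = (\<Sum>w\<in>W. F w)"
    by (rule sum.reindex_bij_witness[of _ "\<lambda>w. w \<circ> ?i" "\<lambda>w. w \<circ> v"])
       (use assms weyl_inv weyl_comp cancel in auto)
  show "(\<Sum>w\<in>W. F (inv_into UNIV w)) = (\<Sum>w\<in>W. F w)"
    by (rule sum.reindex_bij_witness[of _ "inv_into UNIV" "inv_into UNIV"])
       (use weyl_inv weyl_bij in \<open>auto simp: inv_inv_eq\<close>)
qed

definition trace :: "('k, 'v) torus \<Rightarrow> ('k, 'v) torus" where
  "trace f = (\<Sum>w\<in>W. torus_act w f)"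

lemma trace_add: "trace (f + g) = trace f + trace g"
  by (simp add: trace_def torus_act_add sum.distrib)

lemma trace_act_inv: "\<lbrakk>v \<in> W; f \<in> carrier H\<rbrakk> \<Longrightarrow> torus_act v (trace f) = trace f"
  using weyl_sum_translate(1)[of v "\<lambda>w. torus_act w f"]
  by (simp add: trace_def torus_act_sum torus_act_comp cong: sum.cong)

lemma trace_of_act: "\<lbrakk>v \<in> W; f \<in> carrier H\<rbrakk> \<Longrightarrow> trace (torus_act v f) = trace f"
  using weyl_sum_translate(2)[of v "\<lambda>w. torus_act w f"]
  by (simp add: trace_def torus_act_comp cong: sum.cong)

lemma trace_closed: "f \<in> carrier H \<Longrightarrow> trace f \<in> carrier H"
  unfolding trace_def by (intro torus_sum_closed torus_act_closed)

abbreviation "HW \<equiv> invariant_subring H W"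

lemma invariant_record:
  "f \<in> carrier HW \<longleftrightarrow> f \<in> carrier H \<and> (\<forall>w\<in>W. torus_act w f = f)" "monoid.mult HW = torus_mult n qn"
  "\<one>\<^bsub>HW\<^esub> = monom 0 0 1" "\<zero>\<^bsub>HW\<^esub> = 0" "ring.add HW = (+)"
  by (simp_all add: invariant_subring_def torus_record)

lemma trace_invariant: "f \<in> carrier H \<Longrightarrow> trace f \<in> carrier HW"
  by (simp add: invariant_record trace_closed trace_act_inv)

lemma trace_mult_invariant:
  assumes "s \<in> carrier HW" "f \<in> carrier H"
  shows "trace (s \<star> f) = s \<star> trace f" "trace (f \<star> s) = trace f \<star> s"
  using assms by (simp_all add: trace_def invariant_record torus_act_mult torus_mult_sum cong: sum.cong)

lemma trace_scalar: "trace (monom 0 0 c) = monom 0 0 (of_nat (card W) * c)"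
proof -
  have "(\<Sum>w\<in>V. monom 0 0 c) = monom 0 0 (of_nat (card V) * c)" if "finite V" for V :: "('v \<Rightarrow> 'v) set"
    using that by (induction V rule: finite_induct) (simp_all add: single_add[symmetric] algebra_simps)
  then show ?thesis
    by (simp add: trace_def torus_act_scalar weyl_finite cong: sum.cong)
qed

lemma invariant_ring: "ring HW"
proof (rule ringI)
  have diff: "f - g \<in> carrier HW" if "f \<in> carrier HW" "g \<in> carrier HW" for f g
  proof -
    have "torus_act w (f - g) = torus_act w f - torus_act w g" for w
      using torus_act_add[of w "f - g" g] by (simp add: algebra_simps)
    with that show ?thesis by (simp add: invariant_record torus_diff_closed)
  qed
  show "abelian_group HW"
  proof (rule abelian_groupI)
    fix f assume "f \<in> carrier HW"
    then show "\<exists>g\<in>carrier HW. g \<oplus>\<^bsub>HW\<^esub> f = \<zero>\<^bsub>HW\<^esub>"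
      using diff[of 0 f] by (intro bexI[of _ "0 - f"]) (auto simp: invariant_record torus_zero_closed)
  qed (simp_all add: invariant_record torus_act_add torus_add_closed torus_zero_closed add_ac)
  show "monoid HW"
    by (rule monoidI) (simp_all add: invariant_record torus_act_mult torus_act_scalar
       torus_mult_closed torus_one_closed torus_mult_assoc torus_mult_one)
qed (simp_all add: invariant_record torus_mult_add)

section \<open>The twisted group ring and its modules\<close>

abbreviation "A \<equiv> twisted_group_ring H W"
abbreviation twisted_mult (infixl \<open>\<odot>\<odot>\<close> 70) where "twisted_mult \<equiv> monoid.mult A"
text \<open>
  \<open>twist w f\<close> is \<open>f \<otimes> w\<close>.
\<close>

abbreviation "twist w f \<equiv> Poly_Mapping.single (w :: 'v \<Rightarrow> 'v) (f :: ('k, 'v) torus)"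

lemma twisted_record:
  "F \<in> carrier A \<longleftrightarrow> Poly_Mapping.keys F \<subseteq> W \<and> (\<forall>w. Poly_Mapping.lookup F w \<in> carrier H)"
  "\<one>\<^bsub>A\<^esub> = twist id (monom 0 0 1)" "\<zero>\<^bsub>A\<^esub> = 0" "ring.add A = (+)"
  by (simp_all add: twisted_group_ring_def torus_record)

lemma twisted_mult_extension:
  "F \<odot>\<odot> G = additive_extension (\<lambda>w f. additive_extension (\<lambda>u g.
     twist (w \<circ> u) (f \<star> torus_act w g)) G) F"
  by (simp add: twisted_group_ring_def torus_record additive_extension_def)

lemma twisted_mult_add:
  shows "(F + G) \<odot>\<odot> K = F \<odot>\<odot> K + G \<odot>\<odot> K"
    and "F \<odot>\<odot> (G + K) = F \<odot>\<odot> G + F \<odot>\<odot> K"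
  unfolding twisted_mult_extension
  by (simp_all add: additive_extension_add additive_extension_fun_add torus_mult_add torus_act_add single_add)

lemma twisted_mult_twist: "twist w f \<odot>\<odot> twist u g = twist (w \<circ> u) (f \<star> torus_act w g)"
  unfolding twisted_mult_extension
  by (simp add: additive_extension_single additive_extension_fun_add torus_mult_add torus_act_add single_add)

lemma twisted_mult_zero [simp]: "0 \<odot>\<odot> F = 0" "F \<odot>\<odot> 0 = 0"
  by (simp_all add: twisted_group_ring_def)

lemma twisted_mult_sum:
  "(\<Sum>i\<in>I. f i) \<odot>\<odot> g = (\<Sum>i\<in>I. f i \<odot>\<odot> g)" "g \<odot>\<odot> (\<Sum>i\<in>I. f i) = (\<Sum>i\<in>I. g \<odot>\<odot> f i)"
  by (rule additive_fun_sum, rule twisted_mult_add)+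

lemma twist_closed: "\<lbrakk>w \<in> W; f \<in> carrier H\<rbrakk> \<Longrightarrow> twist w f \<in> carrier A"
  using torus_zero_closed by (auto simp: twisted_record(1) lookup_single when_def)

lemma twisted_zero_closed: "0 \<in> carrier A"
  by (simp add: twisted_record(1) torus_zero_closed)

lemma twisted_add_closed: "\<lbrakk>F \<in> carrier A; G \<in> carrier A\<rbrakk> \<Longrightarrow> F + G \<in> carrier A"
  using keys_add[of F G] by (auto simp: twisted_record(1) lookup_add torus_add_closed)

lemma twisted_diff_closed: "\<lbrakk>F \<in> carrier A; G \<in> carrier A\<rbrakk> \<Longrightarrow> F - G \<in> carrier A"
  using keys_diff[of F G] by (auto simp: twisted_record(1) lookup_minus torus_diff_closed)

lemma twisted_sum_closed: "(\<And>i. i \<in> I \<Longrightarrow> f i \<in> carrier A) \<Longrightarrow> (\<Sum>i\<in>I. f i) \<in> carrier A"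
  by (induction I rule: infinite_finite_induct) (auto intro: twisted_zero_closed twisted_add_closed)

lemma twisted_induct [consumes 1, case_names zero twist add]:
  assumes "F \<in> carrier A" "Q 0" "\<And>w f. \<lbrakk>w \<in> W; f \<in> carrier H\<rbrakk> \<Longrightarrow> Q (twist w f)"
    and "\<And>G K. \<lbrakk>G \<in> carrier A; K \<in> carrier A; Q G; Q K\<rbrakk> \<Longrightarrow> Q (G + K)"
  shows "Q F"
proof -
  have "F \<in> carrier A \<and> Q F"
  proof (rule poly_mapping_additive_induct[where Q = "\<lambda>F. F \<in> carrier A \<and> Q F"])
    fix w assume "w \<in> Poly_Mapping.keys F"
    then have "w \<in> W" "Poly_Mapping.lookup F w \<in> carrier H"
      using assms(1) by (auto simp: twisted_record(1))
    then show "twist w (Poly_Mapping.lookup F w) \<in> carrier A \<and> Q (twist w (Poly_Mapping.lookup F w))"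
      by (simp add: assms twist_closed)
  qed (simp_all add: assms twisted_zero_closed twisted_add_closed)
  then show ?thesis ..
qed

lemma twisted_mult_closed:
  assumes "F \<in> carrier A" "G \<in> carrier A"
  shows "F \<odot>\<odot> G \<in> carrier A"
  using assms
proof (induction F rule: twisted_induct)
  case (twist w f)
  from twist(3) show ?case
    by (induction G rule: twisted_induct)
       (auto simp: twisted_mult_twist twisted_mult_add twist
         intro!: twist_closed twisted_zero_closed twisted_add_closed weyl_comp torus_mult_closed torus_act_closed)
qed (auto simp: twisted_mult_add intro: twisted_zero_closed twisted_add_closed)

lemma twisted_mult_assoc:
  assumes "F \<in> carrier A" "G \<in> carrier A" "K \<in> carrier A"
  shows "(F \<odot>\<odot> G) \<odot>\<odot> K = F \<odot>\<odot> (G \<odot>\<odot> K)"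
  using assms
proof (induction F rule: twisted_induct)
  case (twist w f)
  from twist(3,4) show ?case
  proof (induction G rule: twisted_induct)
    case (twist u g)
    note outer = \<open>w \<in> W\<close> \<open>f \<in> carrier H\<close> twist(1,2)
    from twist(3) show ?case
      by (induction K rule: twisted_induct)
         (simp_all add: outer twisted_mult_twist twisted_mult_add torus_mult_assoc torus_act_mult
           torus_act_comp torus_act_closed torus_mult_closed o_assoc)
  qed (simp_all add: twisted_mult_add)
qed (simp_all add: twisted_mult_add)

lemma twisted_one_closed: "twist id (monom 0 0 1) \<in> carrier A"
  by (intro twist_closed weyl_id torus_one_closed)

lemma twisted_mult_one:
  assumes "F \<in> carrier A"
  shows "twist id (monom 0 0 1) \<odot>\<odot> F = F" "F \<odot>\<odot> twist id (monom 0 0 1) = F"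
  using assms
  by (induction F rule: twisted_induct)
     (simp_all add: twisted_mult_add twisted_mult_twist torus_mult_one torus_act_id torus_act_scalar)

lemma twisted_ring: "ring A"
proof (rule ringI)
  show "abelian_group A"
  proof (rule abelian_groupI)
    fix f assume "f \<in> carrier A"
    then show "\<exists>g\<in>carrier A. g \<oplus>\<^bsub>A\<^esub> f = \<zero>\<^bsub>A\<^esub>"
      using twisted_diff_closed[OF twisted_zero_closed] by (intro bexI[of _ "0 - f"]) (auto simp: twisted_record(3,4))
  qed (simp_all add: twisted_record(3,4) twisted_add_closed twisted_zero_closed add_ac)
  show "monoid A"
    by (rule monoidI) (simp_all add: twisted_record(2) twisted_mult_closed twisted_one_closed twisted_mult_assoc twisted_mult_one)
qed (simp_all add: twisted_record(4) twisted_mult_add)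

end

section \<open>Simplicity of the quantum torus and of the twisted group ring\<close>

lemma single_nonzero: "c \<noteq> 0 \<Longrightarrow> Poly_Mapping.single k c \<noteq> 0"
  by (metis lookup_single_eq lookup_zero)

lemma ideal_diff_closed:
  fixes R :: "'a::ab_group_add ring"
  assumes "ideal I R" "ring.add R = (+)" "\<zero>\<^bsub>R\<^esub> = 0" "x \<in> I" "y \<in> I"
  shows "x - y \<in> I"
proof -
  interpret ideal I R by fact
  have "\<ominus>\<^bsub>R\<^esub> y + y = 0"
    using l_neg[of y] assms(2-5) a_subset by auto
  then have "\<ominus>\<^bsub>R\<^esub> y = - y" by (simp add: eq_neg_iff_add_eq_0)
  then show ?thesis
    using additive_subgroup.a_closed[OF is_additive_subgroup assms(4)
        additive_subgroup.a_inv_closed[OF is_additive_subgroup assms(5)]] assms(2) by simp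
qed

lemma ideal_eq_carrier:
  assumes "ideal I R" "\<one>\<^bsub>R\<^esub> \<in> I"
  shows "I = carrier R"
proof -
  interpret ideal I R by fact
  show ?thesis
    using I_l_closed[OF assms(2)] a_subset by force
qed

context quantum_torus_datum
begin

text \<open>
  Multiplying by monomials from both sides translates the support and rescales the coefficients by
  powers of \<open>q\<close>.
\<close>

lemma lookup_sandwich:
  "Poly_Mapping.lookup (monom a b c \<star> f \<star> monom a' b' 1) (a + x + a', b + y + b') =
   c * q_exp (- x b) * q_exp (- a' (b + y)) * Poly_Mapping.lookup f (x, y)"
proof (induction f rule: poly_mapping_additive_induct)
  case (single k)
  obtain x0 y0 where k: "k = (x0, y0)" by (cases k)
  show ?case
  proof (cases "x0 = x \<and> y0 = y")
    case True
    then show ?thesis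
      unfolding k by (simp add: torus_mult_monom lookup_single when_def fun_eq_iff)
  next
    case False
    then have "(a + x0 + a', b + y0 + b') \<noteq> (a + x + a', b + y + b')" by auto
    with False show ?thesis
      unfolding k torus_mult_monom lookup_single when_def by auto
  qed
qed (simp_all add: torus_mult_add lookup_add distrib_left)

lemma keys_sandwich:
  assumes f: "f \<in> carrier H" and c: "c \<noteq> 0" and "a' \<in> X" "b \<in> Y"
  shows "Poly_Mapping.keys (monom a b c \<star> f \<star> monom a' b' 1) =
    (\<lambda>(x, y). (a + x + a', b + y + b')) ` Poly_Mapping.keys f"
proof (rule Set.set_eqI)
  fix k
  define x y where "x = fst k - a - a'" and "y = snd k - b - b'"
  have k: "k = (a + x + a', b + y + b')" by (simp add: x_def y_def prod_eq_iff)
  have "(x, y) \<in> Poly_Mapping.keys f \<Longrightarrow> q_exp (- x b) \<noteq> 0 \<and> q_exp (- a' (b + y)) \<noteq> 0"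
    using f assms(3,4) by (intro conjI q_exp_nonzero) (auto simp: torus_record pairing_integrals Y_closed)
  then have "k \<in> Poly_Mapping.keys (monom a b c \<star> f \<star> monom a' b' 1) \<longleftrightarrow> (x, y) \<in> Poly_Mapping.keys f"
    unfolding k in_keys_iff lookup_sandwich using c by auto
  also have "\<dots> \<longleftrightarrow> k \<in> (\<lambda>(x, y). (a + x + a', b + y + b')) ` Poly_Mapping.keys f"
    unfolding k by (auto simp: image_iff split: prod.splits)
  finally show "k \<in> Poly_Mapping.keys (monom a b c \<star> f \<star> monom a' b' 1) \<longleftrightarrow>
      k \<in> (\<lambda>(x, y). (a + x + a', b + y + b')) ` Poly_Mapping.keys f" .
qed

text \<open>
  Conjugation by a monomial is diagonal on monomials. The factor \<open>q_exp (- a b)\<close> normalises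
  \<open>e\<^bsup>-a\<^esup> e\<^bsup>-b\<^esup>\<close> to the inverse of \<open>e\<^sup>a e\<^sup>b\<close>.
\<close>

lemma lookup_conjugate:
  assumes "f \<in> carrier H" "a \<in> X" "b \<in> Y"
  shows "Poly_Mapping.lookup (monom a b (q_exp (- a b)) \<star> f \<star> monom (- a) (- b) 1) (x, y) =
    q_exp (a y - x b) * Poly_Mapping.lookup f (x, y)"
proof (cases "(x, y) \<in> Poly_Mapping.keys f")
  case True
  then have xy: "x \<in> X" "y \<in> Y" using assms(1) by (auto simp: torus_record)
  have "q_exp (a y - x b) = q_exp (- a b) * q_exp (- x b) * q_exp (a (b + y))"
    using q_exp_add[of "- a b" "- x b"] q_exp_add[of "- a b - x b" "a (b + y)"] assms xy
    by (simp add: pairing_integrals X_add_arg distrib_left right_diff_distrib)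
  then show ?thesis
    using lookup_sandwich[of a b "q_exp (- a b)" f "- a" "- b" x y] by simp
next
  case False
  then show ?thesis
    using lookup_sandwich[of a b "q_exp (- a b)" f "- a" "- b" x y] by (simp add: in_keys_iff)
qed

text \<open>
  An element of smallest support in a nonzero ideal may be translated so that its support contains
  \<open>0\<close>. Subtracting it from a conjugate by a monomial removes \<open>0\<close> from the support, so minimality forces
  the element to commute with all monomials. As \<open>q\<close> is not a root of unity and the pairing is
  nondegenerate, the element is then a scalar.
\<close>

lemma one_in_torus_ideal:
  assumes I: "ideal I H" and "f \<in> I" "f \<noteq> 0"
  shows "monom 0 0 1 \<in> I"
  using assms(2,3)
proof (induction "card (Poly_Mapping.keys f)" arbitrary: f rule: less_induct)
  case less
  interpret I: ideal I H by fact
  have sandwich: "g \<star> h \<star> g' \<in> I" if "h \<in> I" "g \<in> carrier H" "g' \<in> carrier H" for g h g'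
    using I.I_r_closed[OF I.I_l_closed[OF that(1,2)] that(3)] by (simp add: torus_record)
  have f: "f \<in> carrier H" using less.prems(1) I.a_subset by auto
  obtain x0 y0 where k0: "(x0, y0) \<in> Poly_Mapping.keys f"
    using less.prems(2) by (metis all_not_in_conv keys_eq_empty surj_pair)
  then have xy0: "x0 \<in> X" "y0 \<in> Y" using f by (auto simp: torus_record)
  define g where "g = monom (- x0) (- y0) 1 \<star> f \<star> monom 0 0 1"
  have g_I: "g \<in> I"
    unfolding g_def using xy0
    by (intro sandwich[OF less.prems(1)] monom_closed) (simp_all add: X_closed Y_closed)
  have g_H: "g \<in> carrier H" using g_I I.a_subset by auto
  note g = g_I g_H
  have keys_g: "Poly_Mapping.keys g = (\<lambda>(x, y). (- x0 + x + 0, - y0 + y + 0)) ` Poly_Mapping.keys f"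
    unfolding g_def using f xy0 by (intro keys_sandwich) (auto simp: X_closed Y_closed)
  have card_g: "card (Poly_Mapping.keys g) = card (Poly_Mapping.keys f)"
    unfolding keys_g by (rule card_image) (auto simp: inj_on_def)
  have zero_key: "(0, 0) \<in> Poly_Mapping.keys g"
    unfolding keys_g using k0 by (auto simp: image_iff intro!: bexI[of _ "(x0, y0)"])
  \<comment> \<open>The conjugate minus \<open>g\<close> itself: the coefficient at \<open>0\<close> cancels.\<close>
  define d where "d a b = monom a b (q_exp (- a b)) \<star> g \<star> monom (- a) (- b) 1 - g" for a b
  have lookup_d: "Poly_Mapping.lookup (d a b) (x, y) = (q_exp (a y - x b) - 1) * Poly_Mapping.lookup g (x, y)"
    if "a \<in> X" "b \<in> Y" for a b x y
    using lookup_conjugate[OF g(2) that] by (simp add: d_def lookup_minus left_diff_distrib)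
  have d_I: "d a b \<in> I" if "a \<in> X" "b \<in> Y" for a b
    unfolding d_def using that g
    by (intro ideal_diff_closed[OF I] sandwich monom_closed) (simp_all add: torus_record X_closed Y_closed)
  show ?case
  proof (cases "\<exists>a\<in>X. \<exists>b\<in>Y. d a b \<noteq> 0")
    case True
    then obtain a b where ab: "a \<in> X" "b \<in> Y" "d a b \<noteq> 0" by blast
    have "Poly_Mapping.keys (d a b) \<subseteq> Poly_Mapping.keys g - {(0, 0)}"
      using X_zero_arg[OF ab(1)] by (auto simp: in_keys_iff lookup_d[OF ab(1,2)] q_exp_zero)
    then have "card (Poly_Mapping.keys (d a b)) < card (Poly_Mapping.keys f)"
      unfolding card_g[symmetric] using zero_key by (intro psubset_card_mono) auto
    then show ?thesis
      using less.hyps d_I[OF ab(1,2)] ab(3) by blast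
  next
    case False
    have "x = 0 \<and> y = 0" if xy: "(x, y) \<in> Poly_Mapping.keys g" for x y
    proof -
      have x: "x \<in> X" and y: "y \<in> Y" using xy g(2) by (auto simp: torus_record)
      have commute: "a y = x b" if ab: "a \<in> X" "b \<in> Y" for a b
      proof -
        have "q_exp (a y - x b) = 1"
          using lookup_d[OF ab, of x y] False ab xy by (auto simp: in_keys_iff)
        then have "a y - x b = 0"
          using x y ab by (intro q_exp_eq_one) (auto simp: right_diff_distrib pairing_integrals)
        then show ?thesis by simp
      qed
      have "\<forall>a\<in>X. a y = 0" using commute[of _ 0] X_zero_arg[OF x] Y_closed(1) by auto
      then have "y = 0" by (rule nondegenerate_right[OF y])
      moreover have "\<forall>b\<in>Y. x b = 0" using commute[of 0] X_closed(1) by auto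
      then have "x = 0" by (rule nondegenerate_left[OF x])
      ultimately show ?thesis by simp
    qed
    then have "Poly_Mapping.keys g = {(0, 0)}" using zero_key by auto
    then have g_scalar: "g = monom 0 0 (Poly_Mapping.lookup g (0, 0))"
      using poly_mapping_sum_singles[of g] by simp
    have nz: "Poly_Mapping.lookup g (0, 0) \<noteq> 0" using zero_key by (simp add: in_keys_iff)
    let ?c = "Poly_Mapping.lookup g (0, 0)"
    have "monom 0 0 (inverse ?c) \<star> g \<in> I"
      using I.I_l_closed[OF g(1) monom_closed[OF X_closed(1) Y_closed(1)]] by (simp add: torus_record)
    moreover have "monom 0 0 (inverse ?c) \<star> monom 0 0 ?c = monom 0 0 1"
      using nz by (simp add: torus_mult_monom q_exp_zero)
    ultimately show ?thesis using g_scalar by simp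
  qed
qed

text \<open>
  Such an \<open>S\<close> equals its translate, and comparing the sums of elements gives \<open>|S| \<cdot> \<delta> = 0\<close>.
\<close>

lemma stable_under_translation:
  fixes \<delta> :: 'v
  assumes "finite S" "S \<noteq> {}" "\<And>s. s \<in> S \<Longrightarrow> s + \<delta> \<in> S"
  shows "\<delta> = 0"
proof -
  have inj: "inj_on (\<lambda>s. s + \<delta>) S" by (simp add: inj_on_def)
  have "(\<lambda>s. s + \<delta>) ` S = S"
    using assms inj by (intro endo_inj_surj) auto
  then have "(\<Sum>s\<in>S. s) = (\<Sum>s\<in>S. s + \<delta>)"
    using sum.reindex[OF inj, of "\<lambda>s. s"] by (simp add: o_def)
  then have "(\<Sum>s\<in>S. \<delta>) = 0"
    by (simp add: sum.distrib)
  then have "scale (of_nat (card S)) \<delta> = 0"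
    by (simp only: sum_constant_scale)
  with assms show ?thesis by simp
qed

text \<open>
  The hypothesis says that the support of \<open>f\<close> is stable under a nonzero translation.
\<close>

lemma torus_translation_zero:
  assumes f: "f \<in> carrier H" and y: "y \<in> Y" "y \<noteq> y'"
    and fixed: "monom 0 y 1 \<star> f \<star> monom 0 (- y') 1 = f"
  shows "f = 0"
proof (rule ccontr)
  assume "f \<noteq> 0"
  let ?S = "snd ` Poly_Mapping.keys f"
  have keys: "Poly_Mapping.keys f = (\<lambda>(x, z). (0 + x + 0, y + z + - y')) ` Poly_Mapping.keys f"
    using keys_sandwich[of f 1 0 y 0 "- y'"] f y X_closed(1) fixed by simp
  have "y - y' = 0"
  proof (rule stable_under_translation[of ?S])
    fix s assume "s \<in> ?S"
    then obtain x where "(x, s) \<in> Poly_Mapping.keys f" by auto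
    then have "(0 + x + 0, y + s + - y') \<in> Poly_Mapping.keys f"
      by (subst keys) (rule image_eqI[of _ _ "(x, s)"], auto)
    then show "s + (y - y') \<in> ?S"
      by (auto simp: image_iff algebra_simps intro!: bexI[of _ "(x, y + s - y')"])
  qed (use \<open>f \<noteq> 0\<close> in auto)
  with y show False by simp
qed

lemma lookup_twisted_sandwich:
  assumes "F \<in> carrier A" "f \<in> carrier H" "g \<in> carrier H"
  shows "Poly_Mapping.lookup (twist id f \<odot>\<odot> F \<odot>\<odot> twist id g) w =
    f \<star> Poly_Mapping.lookup F w \<star> torus_act w g"
  using assms(1)
proof (induction F rule: twisted_induct)
  case (twist u h)
  then show ?case
    using assms(2,3)
    by (cases "u = w") (simp_all add: twisted_mult_twist torus_act_id[unfolded id_def] lookup_single when_def o_def)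
qed (simp_all add: twisted_mult_add lookup_add torus_mult_add)

lemma weyl_neg: "w \<in> W \<Longrightarrow> w (- v) = - w v"
  by (rule module_hom.neg[OF Vector_Spaces.linear.axioms(3)[OF weyl_linear]])

text \<open>
  The Weyl group acts by outer automorphisms, which is used as follows. In an element \<open>F\<close> of the ideal
  with fewest components pick a component \<open>u\<close>. The \<open>u\<close>-components of elements of the ideal supported
  inside the support of \<open>F\<close> form an ideal of the quantum torus, so some such \<open>G\<close> has \<open>u\<close>-component \<open>1\<close>. For
  \<open>y \<in> Y\<close>, multiplying \<open>G\<close> by \<open>e\<^sup>y\<close> on the left and by the monomial of \<open>- u\<^sup>-\<^sup>1 y\<close> on the right preserves that
  component, so by minimality it fixes \<open>G\<close>. For \<open>w \<noteq> u\<close> this makes the support of the \<open>w\<close>-component stable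
  under translation by \<open>y - w (u\<^sup>-\<^sup>1 y)\<close>, which is nonzero for some \<open>y\<close>. Hence \<open>G = 1 \<otimes> u\<close> is a unit.
\<close>

lemma one_in_twisted_ideal:
  assumes I: "ideal I A" and "F \<in> I" "F \<noteq> 0"
  shows "twist id (monom 0 0 1) \<in> I"
  using assms(2,3)
proof (induction "card (Poly_Mapping.keys F)" arbitrary: F rule: less_induct)
  case less
  interpret I: ideal I A by fact
  interpret Hring: ring H by (rule torus_ring)
  have sandwich: "twist id f \<odot>\<odot> G \<odot>\<odot> twist id g \<in> I" if "G \<in> I" "f \<in> carrier H" "g \<in> carrier H" for f G g
    using that weyl_id by (intro I.I_r_closed I.I_l_closed twist_closed)
  have diff: "G - K \<in> I" if "G \<in> I" "K \<in> I" for G K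
    using ideal_diff_closed[OF I] that by (simp add: twisted_record)
  have IA: "G \<in> carrier A" if "G \<in> I" for G using that I.a_subset by auto
  obtain u where u: "u \<in> Poly_Mapping.keys F"
    using less.prems(2) by (metis all_not_in_conv keys_eq_empty)
  have uW: "u \<in> W" using u IA[OF less.prems(1)] by (auto simp: twisted_record)
  define J where "J = {Poly_Mapping.lookup G u |G. G \<in> I \<and> Poly_Mapping.keys G \<subseteq> Poly_Mapping.keys F}"
  have "ideal J H"
  proof (rule idealI[OF torus_ring Hring.additive_subgroup_minusI])
    show "J \<subseteq> carrier H"
      using IA by (auto simp: J_def twisted_record)
    show "\<zero>\<^bsub>H\<^esub> \<in> J"
      using additive_subgroup.zero_closed[OF I.is_additive_subgroup] by (auto simp: J_def torus_record twisted_record intro!: exI[of _ 0])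
    show "x \<ominus>\<^bsub>H\<^esub> y \<in> J" if xy: "x \<in> J" "y \<in> J" for x y
    proof -
      obtain G K where GK: "x = Poly_Mapping.lookup G u" "y = Poly_Mapping.lookup K u" "G \<in> I" "K \<in> I"
        "Poly_Mapping.keys G \<subseteq> Poly_Mapping.keys F" "Poly_Mapping.keys K \<subseteq> Poly_Mapping.keys F"
        using xy by (auto simp: J_def)
      have "y \<in> carrier H" using GK IA by (auto simp: twisted_record)
      then have "\<ominus>\<^bsub>H\<^esub> y + y = 0" using Hring.l_neg[of y] by (simp add: torus_record)
      then have "x \<ominus>\<^bsub>H\<^esub> y = Poly_Mapping.lookup (G - K) u"
        by (simp add: a_minus_def torus_record GK lookup_minus eq_neg_iff_add_eq_0[symmetric])
      then show ?thesis
        using GK diff keys_diff[of G K] unfolding J_def by blast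
    qed
    show "f \<otimes>\<^bsub>H\<^esub> a \<in> J" "a \<otimes>\<^bsub>H\<^esub> f \<in> J" if a: "a \<in> J" and f: "f \<in> carrier H" for a f
    proof -
      obtain G where G: "a = Poly_Mapping.lookup G u" "G \<in> I" "Poly_Mapping.keys G \<subseteq> Poly_Mapping.keys F"
        using a by (auto simp: J_def)
      have Gu: "Poly_Mapping.lookup G u \<in> carrier H" using G IA by (auto simp: twisted_record)
      have mem: "g \<star> a \<star> torus_act u h \<in> J" if gh: "g \<in> carrier H" "h \<in> carrier H" for g h
      proof -
        note lk = lookup_twisted_sandwich[OF IA[OF G(2)] gh]
        have "Poly_Mapping.keys (twist id g \<odot>\<odot> G \<odot>\<odot> twist id h) \<subseteq> Poly_Mapping.keys G"
          by (auto simp: in_keys_iff lk)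
        with G sandwich[OF G(2) gh] lk[of u] show ?thesis
          unfolding J_def mem_Collect_eq
          by (intro exI[of _ "twist id g \<odot>\<odot> G \<odot>\<odot> twist id h"]) auto
      qed
      show "f \<otimes>\<^bsub>H\<^esub> a \<in> J"
        using mem[OF f torus_one_closed] uW f Gu
        by (simp add: G torus_record(2) torus_act_scalar torus_mult_one torus_mult_closed)
      \<comment> \<open>Right multiplication by \<open>h\<close> multiplies the component \<open>u\<close> by the image of \<open>h\<close> under \<open>u\<close>.\<close>
      show "a \<otimes>\<^bsub>H\<^esub> f \<in> J"
        using mem[OF torus_one_closed torus_act_closed[OF weyl_inv[OF uW] f]] uW f Gu
        by (simp add: G torus_record(2) torus_act_inv torus_mult_one)
    qed
  qed
  moreover have "Poly_Mapping.lookup F u \<in> J" "Poly_Mapping.lookup F u \<noteq> 0"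
    using less.prems(1) u by (auto simp: J_def in_keys_iff)
  ultimately have "monom 0 0 1 \<in> J" by (rule one_in_torus_ideal)
  then obtain G where G: "Poly_Mapping.lookup G u = monom 0 0 1" "G \<in> I"
      "Poly_Mapping.keys G \<subseteq> Poly_Mapping.keys F"
    by (auto simp: J_def)
  have lookup_G: "Poly_Mapping.lookup G w \<in> carrier H" for w
    using IA[OF G(2)] by (auto simp: twisted_record)
  define D where "D y = twist id (monom 0 y 1) \<odot>\<odot> G \<odot>\<odot> twist id (monom 0 (- inv_into UNIV u y) 1) - G" for y
  have lookup_D: "Poly_Mapping.lookup (D y) w =
      monom 0 y 1 \<star> Poly_Mapping.lookup G w \<star> monom 0 (- w (inv_into UNIV u y)) 1 - Poly_Mapping.lookup G w"
    if y: "y \<in> Y" and w: "w \<in> W" for y w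
  proof -
    have "- inv_into UNIV u y \<in> Y" using Y_invariant[OF weyl_inv[OF uW] y] Y_closed(3) by simp
    then have "Poly_Mapping.lookup (D y) w = monom 0 y 1 \<star> Poly_Mapping.lookup G w \<star>
        torus_act w (monom 0 (- inv_into UNIV u y) 1) - Poly_Mapping.lookup G w"
      using lookup_twisted_sandwich[OF IA[OF G(2)] monom_closed[OF X_closed(1) y]
          monom_closed[OF X_closed(1)]]
      by (simp add: D_def lookup_minus)
    also have "torus_act w (monom 0 (- inv_into UNIV u y) 1) = monom 0 (- w (inv_into UNIV u y)) 1"
      by (simp add: torus_act_monom weyl_neg[OF w]) (simp add: dual_act_def zero_fun_def o_def)
    finally show ?thesis .
  qed
  have D_I: "D y \<in> I" if y: "y \<in> Y" for y
    unfolding D_def using G(2) y Y_invariant[OF weyl_inv[OF uW] y]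
    by (intro diff sandwich monom_closed) (simp_all add: X_closed Y_closed)
  show ?case
  proof (cases "\<exists>y\<in>Y. D y \<noteq> 0")
    case True
    then obtain y where y: "y \<in> Y" "D y \<noteq> 0" by blast
    have "Poly_Mapping.lookup (D y) u = 0"
      using lookup_D[OF y(1) uW] G(1) weyl_inv_comp(1)[OF uW]
      by (simp add: fun_eq_iff torus_mult_monom q_exp_zero)
    moreover have "w \<in> Poly_Mapping.keys G" if w: "w \<in> Poly_Mapping.keys (D y)" for w
    proof -
      have "w \<in> W" using w IA[OF D_I[OF y(1)]] by (auto simp: twisted_record)
      with w show ?thesis by (auto simp: in_keys_iff lookup_D[OF y(1)])
    qed
    ultimately have "Poly_Mapping.keys (D y) \<subseteq> Poly_Mapping.keys F - {u}"
      using G(3) by (auto simp: in_keys_iff)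
    then have "card (Poly_Mapping.keys (D y)) < card (Poly_Mapping.keys F)"
      using u by (intro psubset_card_mono) auto
    then show ?thesis
      using less.hyps D_I[OF y(1)] y(2) by blast
  next
    case False
    have "Poly_Mapping.lookup G w = 0" if w: "w \<in> W" "w \<noteq> u" for w
    proof -
      have "w \<circ> inv_into UNIV u \<noteq> id"
      proof
        assume "w \<circ> inv_into UNIV u = id"
        then have "w \<circ> (inv_into UNIV u \<circ> u) = u" by (metis comp_assoc id_comp)
        then show False using w(2) weyl_inv_comp(2)[OF uW] by simp
      qed
      then obtain y where y: "y \<in> Y" "w (inv_into UNIV u y) \<noteq> y"
        using weyl_moves_lattice[OF weyl_comp[OF w(1) weyl_inv[OF uW]]] by auto
      have "monom 0 y 1 \<star> Poly_Mapping.lookup G w \<star> monom 0 (- w (inv_into UNIV u y)) 1 = Poly_Mapping.lookup G w"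
        using lookup_D[OF y(1) w(1)] False y(1) by simp
      then show ?thesis
        using y by (intro torus_translation_zero[OF lookup_G y(1)]) auto
    qed
    then have "Poly_Mapping.keys G \<subseteq> {u}"
      using IA[OF G(2)] by (auto simp: twisted_record in_keys_iff)
    moreover have "u \<in> Poly_Mapping.keys G" using G(1) by (simp add: in_keys_iff single_nonzero)
    ultimately have "Poly_Mapping.keys G = {u}" by auto
    then have "G = twist u (monom 0 0 1)"
      using poly_mapping_sum_singles[of G] G(1) by simp
    moreover have "twist u (monom 0 0 1) \<odot>\<odot> twist (inv_into UNIV u) (monom 0 0 1) = twist id (monom 0 0 1)"
      using uW by (simp add: twisted_mult_twist weyl_inv_comp torus_act_scalar torus_mult_one torus_one_closed)
    moreover have "G \<odot>\<odot> twist (inv_into UNIV u) (monom 0 0 1) \<in> I"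
      using I.I_r_closed[OF G(2)] twist_closed[OF weyl_inv[OF uW] torus_one_closed] by simp
    ultimately show ?thesis by simp
  qed
qed

theorem simple_twisted: "simple_ring A"
  unfolding simple_ring_def
proof (intro conjI allI impI twisted_ring)
  show "\<one>\<^bsub>A\<^esub> \<noteq> \<zero>\<^bsub>A\<^esub>" by (simp add: twisted_record single_nonzero)
  fix I assume I: "ideal I A"
  interpret I: ideal I A by fact
  show "I = {\<zero>\<^bsub>A\<^esub>} \<or> I = carrier A"
  proof (cases "\<exists>F\<in>I. F \<noteq> 0")
    case True
    then show ?thesis
      using one_in_twisted_ideal[OF I] ideal_eq_carrier[OF I] by (auto simp: twisted_record)
  next
    case False
    then show ?thesis using additive_subgroup.zero_closed[OF I.is_additive_subgroup] by (auto simp: twisted_record)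
  qed
qed

end

section \<open>The quantum torus as a bimodule\<close>

context quantum_torus_datum
begin

abbreviation "Ql \<equiv> torus_l H"
abbreviation "Pr \<equiv> torus_r H"
abbreviation lact :: "('k, 'v) twisted \<Rightarrow> ('k, 'v) torus \<Rightarrow> ('k, 'v) torus" where "lact \<equiv> smult Ql"
abbreviation ract_r :: "('k, 'v) torus \<Rightarrow> ('k, 'v) twisted \<Rightarrow> ('k, 'v) torus" where "ract_r \<equiv> ract Pr"

lemma bimodule_record:
  "carrier Ql = carrier H" "ring.add Ql = (+)" "\<zero>\<^bsub>Ql\<^esub> = 0" "ract Ql = torus_mult n qn"
  "carrier Pr = carrier H" "ring.add Pr = (+)" "\<zero>\<^bsub>Pr\<^esub> = 0" "smult Pr = torus_mult n qn"
  by (simp_all add: torus_l_def torus_r_def torus_record)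

lemma lact_extension: "lact F h = additive_extension (\<lambda>w f. f \<star> torus_act w h) F"
  by (simp add: torus_l_def torus_record additive_extension_def)

lemma lact_add: "lact (F + G) h = lact F h + lact G h" "lact F (h + h') = lact F h + lact F h'"
  by (simp_all add: lact_extension additive_extension_add additive_extension_fun_add torus_mult_add torus_act_add)

lemma lact_twist: "lact (twist w f) h = f \<star> torus_act w h"
  by (simp add: lact_extension additive_extension_single torus_mult_add)

lemma lact_zero [simp]: "lact 0 h = 0"
  by (simp add: torus_l_def)

lemma lact_sum: "lact (\<Sum>i\<in>I. F i) h = (\<Sum>i\<in>I. lact (F i) h)"
  by (rule additive_fun_sum, rule lact_add)

lemma ract_extension: "ract_r h F = additive_extension (\<lambda>w f. torus_act (inv_into UNIV w) (h \<star> f)) F"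
  by (simp add: torus_r_def torus_record additive_extension_def)

lemma ract_add: "ract_r h (F + G) = ract_r h F + ract_r h G" "ract_r (h + h') F = ract_r h F + ract_r h' F"
  by (simp_all add: ract_extension additive_extension_add additive_extension_fun_add torus_mult_add torus_act_add)

lemma ract_twist: "ract_r h (twist w f) = torus_act (inv_into UNIV w) (h \<star> f)"
  by (simp add: ract_extension additive_extension_single torus_mult_add torus_act_add)

lemma ract_zero [simp]: "ract_r h 0 = 0"
  by (simp add: torus_r_def)

lemma ract_sum: "ract_r h (\<Sum>i\<in>I. F i) = (\<Sum>i\<in>I. ract_r h (F i))"
  by (rule additive_fun_sum, rule ract_add)

lemma lact_closed: "\<lbrakk>F \<in> carrier A; h \<in> carrier H\<rbrakk> \<Longrightarrow> lact F h \<in> carrier H"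
  by (induction F rule: twisted_induct)
     (simp_all add: lact_add lact_twist torus_zero_closed torus_add_closed torus_mult_closed torus_act_closed)

lemma ract_r_closed: "\<lbrakk>F \<in> carrier A; h \<in> carrier H\<rbrakk> \<Longrightarrow> ract_r h F \<in> carrier H"
  by (induction F rule: twisted_induct)
     (simp_all add: ract_add ract_twist torus_zero_closed torus_add_closed torus_mult_closed torus_act_closed weyl_inv)

lemma lact_mult:
  assumes "F \<in> carrier A" "G \<in> carrier A" "h \<in> carrier H"
  shows "lact (F \<odot>\<odot> G) h = lact F (lact G h)"
  using assms(1,2)
proof (induction F rule: twisted_induct)
  case (twist w f)
  from twist(3) show ?case
    by (induction G rule: twisted_induct)
       (simp_all add: twist assms(3) twisted_mult_twist twisted_mult_add lact_add lact_twist torus_act_mult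
         torus_act_comp torus_act_add torus_mult_add torus_mult_assoc torus_act_closed)
qed (simp_all add: twisted_mult_add lact_add)

lemma torus_l_left_module: "left_module A Ql"
proof (intro left_module.intro left_module_axioms.intro twisted_ring)
  show "abelian_group Ql"
  proof (rule abelian_groupI)
    fix f assume "f \<in> carrier Ql"
    then show "\<exists>g\<in>carrier Ql. g \<oplus>\<^bsub>Ql\<^esub> f = \<zero>\<^bsub>Ql\<^esub>"
      using torus_diff_closed[OF torus_zero_closed]
      by (intro bexI[of _ "0 - f"]) (auto simp: bimodule_record)
  qed (simp_all add: bimodule_record torus_add_closed torus_zero_closed add_ac)
qed (simp_all add: bimodule_record lact_closed lact_add lact_mult twisted_record(2,4) lact_twist
      torus_mult_one torus_act_id)

lemma torus_r_left_module: "left_module HW Pr"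
proof (intro left_module.intro left_module_axioms.intro invariant_ring)
  show "abelian_group Pr"
  proof (rule abelian_groupI)
    fix f assume "f \<in> carrier Pr"
    then show "\<exists>g\<in>carrier Pr. g \<oplus>\<^bsub>Pr\<^esub> f = \<zero>\<^bsub>Pr\<^esub>"
      using torus_diff_closed[OF torus_zero_closed]
      by (intro bexI[of _ "0 - f"]) (auto simp: bimodule_record)
  qed (simp_all add: bimodule_record torus_add_closed torus_zero_closed add_ac)
qed (simp_all add: bimodule_record invariant_record torus_mult_closed torus_mult_add torus_mult_assoc torus_mult_one)

lemma lact_mult_invariant:
  assumes "F \<in> carrier A" "h \<in> carrier H" "s \<in> carrier HW"
  shows "lact F (h \<star> s) = lact F h \<star> s"
  using assms(1)
  by (induction F rule: twisted_induct)
     (use assms(2,3) in \<open>simp_all add: lact_add lact_twist torus_mult_add torus_act_mult torus_mult_assoc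
        torus_act_closed invariant_record\<close>)

lemma ract_mult_invariant:
  assumes "F \<in> carrier A" "h \<in> carrier H" "s \<in> carrier HW"
  shows "s \<star> ract_r h F = ract_r (s \<star> h) F"
  using assms(1)
  by (induction F rule: twisted_induct)
     (use assms(2,3) in \<open>simp_all add: ract_add ract_twist torus_mult_add torus_act_mult torus_mult_assoc
        torus_act_closed torus_mult_closed invariant_record weyl_inv\<close>)

lemma torus_l_bimodule: "bimodule_over A HW Ql"
  by (intro bimodule_over.intro bimodule_over_axioms.intro tensor_factor.intro tensor_factor_axioms.intro
        torus_l_left_module invariant_ring)
     (simp_all add: bimodule_record invariant_record(2-5) torus_mult_add torus_mult_one
        lact_mult_invariant, auto simp: invariant_record(1) torus_mult_closed torus_mult_assoc)

lemma torus_r_factor: "tensor_factor HW A Pr"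
  by (intro tensor_factor.intro tensor_factor_axioms.intro torus_r_left_module twisted_ring)
     (simp_all add: bimodule_record ract_r_closed ract_mult_invariant)

section \<open>The trace pairing and the twisted pairing\<close>

text \<open>
  Identifying \<open>\<H>\<^sup>l\<close> with \<open>A e\<close> and \<open>\<H>\<^sup>r\<close> with \<open>e A\<close>, where \<open>A\<close> is the twisted group ring and \<open>e\<close> is the
  averaging idempotent \<open>|W|\<^sup>-\<^sup>1 \<Sum> w\<close>, and \<open>\<H>\<^sup>W\<close> with \<open>e A e\<close>, the two pairings are, up to the factor \<open>|W|\<close>, the
  multiplication maps \<open>e A \<times> A e \<rightarrow> e A e\<close> and \<open>A e \<times> e A \<rightarrow> A\<close>.
\<close>

definition trace_pairing :: "('k, 'v) torus \<Rightarrow> ('k, 'v) torus \<Rightarrow> ('k, 'v) torus" where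
  "trace_pairing p r = trace (p \<star> r)"

definition twisted_pairing :: "('k, 'v) torus \<Rightarrow> ('k, 'v) torus \<Rightarrow> ('k, 'v) twisted" where
  "twisted_pairing r p = (\<Sum>w\<in>W. twist w (r \<star> torus_act w p))"

lemma trace_pairing_balanced:
  assumes "F \<in> carrier A" "p \<in> carrier H" "r \<in> carrier H"
  shows "trace_pairing (ract_r p F) r = trace_pairing p (lact F r)"
  using assms(1)
proof (induction F rule: twisted_induct)
  case (twist w f)
  have "trace (torus_act (inv_into UNIV w) (p \<star> f) \<star> r) =
      trace (torus_act w (torus_act (inv_into UNIV w) (p \<star> f) \<star> r))"
    using twist assms by (intro trace_of_act[symmetric] torus_mult_closed torus_act_closed weyl_inv)
  then show ?case
    using twist assms by (simp add: trace_pairing_def ract_twist lact_twist torus_act_mult torus_act_inv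
        torus_act_closed torus_mult_closed torus_mult_assoc weyl_inv)
qed (simp_all add: trace_pairing_def ract_add lact_add torus_mult_add trace_add)

lemma twisted_pairing_add:
  "twisted_pairing (r + r') p = twisted_pairing r p + twisted_pairing r' p"
  "twisted_pairing r (p + p') = twisted_pairing r p + twisted_pairing r p'"
  by (simp_all add: twisted_pairing_def torus_mult_add torus_act_add single_add sum.distrib)

lemma twisted_pairing_zero [simp]: "twisted_pairing 0 p = 0" "twisted_pairing r 0 = 0"
  by (simp_all add: twisted_pairing_def)

lemma twisted_pairing_closed:
  "\<lbrakk>r \<in> carrier H; p \<in> carrier H\<rbrakk> \<Longrightarrow> twisted_pairing r p \<in> carrier A"
  unfolding twisted_pairing_def
  by (intro twisted_sum_closed twist_closed torus_mult_closed torus_act_closed)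

lemma twisted_pairing_lact:
  assumes "F \<in> carrier A" "r \<in> carrier H" "p \<in> carrier H"
  shows "twisted_pairing (lact F r) p = F \<odot>\<odot> twisted_pairing r p"
  using assms(1)
proof (induction F rule: twisted_induct)
  case (twist v f)
  have "twist v f \<odot>\<odot> twisted_pairing r p = (\<Sum>w\<in>W. twist (v \<circ> w) (f \<star> torus_act v r \<star> torus_act (v \<circ> w) p))"
    using twist assms
    by (simp add: twisted_pairing_def twisted_mult_sum twisted_mult_twist torus_act_mult torus_act_closed
        torus_act_comp torus_mult_assoc cong: sum.cong)
  also have "\<dots> = twisted_pairing (lact (twist v f) r) p"
    using weyl_sum_translate(1)[OF twist(1), of "\<lambda>w. twist w (f \<star> torus_act v r \<star> torus_act w p)"]
    by (simp add: twisted_pairing_def lact_twist)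
  finally show ?case by simp
qed (simp_all add: lact_add twisted_pairing_add twisted_mult_add)

lemma twisted_pairing_ract:
  assumes "F \<in> carrier A" "r \<in> carrier H" "p \<in> carrier H"
  shows "twisted_pairing r (ract_r p F) = twisted_pairing r p \<odot>\<odot> F"
  using assms(1)
proof (induction F rule: twisted_induct)
  case (twist v f)
  let ?u = "torus_act (inv_into UNIV v) (p \<star> f)"
  have "twisted_pairing r (ract_r p (twist v f)) = (\<Sum>w\<in>W. twist (w \<circ> v) (r \<star> torus_act (w \<circ> v) ?u))"
    using weyl_sum_translate(2)[OF twist(1), of "\<lambda>w. twist w (r \<star> torus_act w ?u)"]
    by (simp add: twisted_pairing_def ract_twist)
  also have "\<dots> = (\<Sum>w\<in>W. twist (w \<circ> v) (r \<star> torus_act w p \<star> torus_act w f))"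
    using twist assms
    by (intro sum.cong refl)
       (simp add: torus_act_comp torus_act_closed torus_mult_closed torus_act_inv weyl_inv
          torus_act_mult torus_mult_assoc)
  also have "\<dots> = twisted_pairing r p \<odot>\<odot> twist v f"
    by (simp add: twisted_pairing_def twisted_mult_sum twisted_mult_twist)
  finally show ?case .
qed (simp_all add: ract_add twisted_pairing_add twisted_mult_add)

lemma ract_twisted_pairing:
  assumes "p \<in> carrier H" "r \<in> carrier H" "p' \<in> carrier H"
  shows "ract_r p (twisted_pairing r p') = trace_pairing p r \<star> p'"
proof -
  have "ract_r p (twisted_pairing r p') = (\<Sum>w\<in>W. torus_act (inv_into UNIV w) (p \<star> r) \<star> p')"
    unfolding twisted_pairing_def ract_sum
    using assms
    by (intro sum.cong refl)
       (simp add: ract_twist torus_mult_assoc[symmetric] torus_act_closed torus_mult_closed torus_act_inv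
          torus_act_mult[OF weyl_inv])
  also have "\<dots> = trace_pairing p r \<star> p'"
    using weyl_sum_translate(3)[OF weyl_id, of "\<lambda>w. torus_act w (p \<star> r) \<star> p'"]
    by (simp add: trace_pairing_def trace_def torus_mult_sum)
  finally show ?thesis .
qed

lemma lact_twisted_pairing:
  assumes "r \<in> carrier H" "p \<in> carrier H" "r' \<in> carrier H"
  shows "lact (twisted_pairing r p) r' = r \<star> trace_pairing p r'"
  using assms
  by (simp add: twisted_pairing_def lact_sum lact_twist trace_pairing_def trace_def torus_mult_sum
      torus_act_mult torus_mult_assoc torus_act_closed cong: sum.cong)

lemma trace_pairing_bilinear: "bilinear_pairing A HW Pr Ql trace_pairing"
proof (intro bilinear_pairing.intro bilinear_pairing_axioms.intro torus_r_factor)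
  show "tensor_factor A HW Ql"
    using torus_l_bimodule by (simp add: bimodule_over_def)
next
  fix s p r assume "s \<in> carrier HW" "p \<in> carrier Pr" "r \<in> carrier Ql"
  then show "trace_pairing (s \<odot>\<^bsub>Pr\<^esub> p) r = s \<otimes>\<^bsub>HW\<^esub> trace_pairing p r"
    "trace_pairing p (ract Ql r s) = trace_pairing p r \<otimes>\<^bsub>HW\<^esub> s"
    using trace_mult_invariant[of s "p \<star> r"]
    by (simp_all add: trace_pairing_def bimodule_record invariant_record torus_mult_closed torus_mult_assoc)
qed (simp_all add: trace_pairing_def[of _ "_ + _"] trace_pairing_def[of "_ + _"] bimodule_record
      trace_pairing_balanced, simp_all add: trace_pairing_def invariant_record(5) torus_mult_add trace_add
      trace_invariant torus_mult_closed)

lemma twisted_pairing_bilinear: "bilinear_pairing HW A Ql Pr twisted_pairing"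
proof (intro bilinear_pairing.intro bilinear_pairing_axioms.intro torus_r_factor)
  show "tensor_factor A HW Ql"
    using torus_l_bimodule by (simp add: bimodule_over_def)
next
  fix s r p assume "s \<in> carrier HW" "r \<in> carrier Ql" "p \<in> carrier Pr"
  then show "twisted_pairing (ract Ql r s) p = twisted_pairing r (s \<odot>\<^bsub>Pr\<^esub> p)"
    by (simp add: twisted_pairing_def bimodule_record invariant_record torus_act_mult torus_mult_assoc
        torus_act_closed cong: sum.cong)
qed (simp_all add: bimodule_record twisted_pairing_closed twisted_pairing_add twisted_record(4)
      twisted_pairing_lact twisted_pairing_ract)

lemma lookup_twisted_pairing_one:
  "Poly_Mapping.lookup (twisted_pairing (monom 0 0 1) (monom 0 0 1)) id = monom 0 0 1"
proof -
  have "twisted_pairing (monom 0 0 1) (monom 0 0 1) = (\<Sum>w\<in>W. twist w (monom 0 0 1))"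
    unfolding twisted_pairing_def
    by (intro sum.cong refl) (simp add: torus_act_scalar torus_mult_one torus_one_closed)
  then show ?thesis
    using weyl_id weyl_finite by (simp add: lookup_sum lookup_single when_def)
qed

text \<open>
  The trace pairing reaches \<open>1\<close> because \<open>|W|\<close> is invertible in the complex numbers. The twisted pairing
  does so because it is nonzero and the twisted group ring is simple.
\<close>

theorem torus_morita_context: "morita_context A HW Pr Ql trace_pairing twisted_pairing"
proof -
  interpret \<phi>: bilinear_pairing A HW Pr Ql trace_pairing by (rule trace_pairing_bilinear)
  interpret \<psi>: bilinear_pairing HW A Ql Pr twisted_pairing by (rule twisted_pairing_bilinear)
  have "twisted_pairing (monom 0 0 1) (monom 0 0 1) \<noteq> \<zero>\<^bsub>A\<^esub>"
    using lookup_twisted_pairing_one single_nonzero[of "1::complex" "(0, 0)"]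
    by (metis lookup_zero one_neq_zero twisted_record(3))
  then have one_\<psi>: "\<one>\<^bsub>A\<^esub> \<in> \<psi>.trace_ideal"
    by (intro \<psi>.one_in_trace_ideal[OF simple_twisted]) (simp_all add: bimodule_record torus_one_closed)
  have "card W \<noteq> 0"
    using weyl_finite weyl_id by auto
  then have "trace_pairing (monom 0 0 (1 / of_nat (card W))) (monom 0 0 1) = \<one>\<^bsub>HW\<^esub>"
    by (simp add: trace_pairing_def torus_mult_monom q_exp_zero trace_scalar invariant_record(3))
  moreover have "trace_pairing (monom 0 0 (1 / of_nat (card W))) (monom 0 0 1) \<in> \<phi>.trace_ideal"
    unfolding \<phi>.trace_ideal_def
    by (rule generate.incl) (use monom_closed[OF X_closed(1) Y_closed(1)] in \<open>auto simp: bimodule_record(1,5)\<close>)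
  ultimately have one_\<phi>: "\<one>\<^bsub>HW\<^esub> \<in> \<phi>.trace_ideal" by simp
  show ?thesis
    by (intro morita_context.intro morita_context_axioms.intro trace_pairing_bilinear
        twisted_pairing_bilinear one_\<phi> one_\<psi>)
       (simp_all add: bimodule_record ract_twisted_pairing lact_twisted_pairing)
qed

section \<open>Invariants\<close>

lemma invariants_record:
  "m \<in> carrier (invariants_module H W M) \<longleftrightarrow>
     m \<in> carrier M \<and> (\<forall>w\<in>W. twist w (monom 0 0 1) \<odot>\<^bsub>M\<^esub> m = m)"
  "\<zero>\<^bsub>invariants_module H W M\<^esub> = \<zero>\<^bsub>M\<^esub>" "ring.add (invariants_module H W M) = ring.add M"
  "h \<odot>\<^bsub>invariants_module H W M\<^esub> m = twist id h \<odot>\<^bsub>M\<^esub> m"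
  by (simp_all add: invariants_module_def torus_record)

lemma invariants_left_module:
  assumes "left_module A M"
  shows "left_module HW (invariants_module H W M)"
proof -
  interpret M: left_module A M by fact
  let ?N = "invariants_module H W M"
  have one: "twist w (monom 0 0 1) \<in> carrier A" if "w \<in> W" for w
    by (rule twist_closed[OF that torus_one_closed])
  have tw: "twist id h \<in> carrier A" if "h \<in> carrier HW" for h
    using that by (intro twist_closed weyl_id) (simp add: invariant_record)
  have add: "x \<oplus>\<^bsub>M\<^esub> y \<in> carrier ?N" if "x \<in> carrier ?N" "y \<in> carrier ?N" for x y
    using that by (simp add: invariants_record M.smult_r_distr one)
  have zero: "\<zero>\<^bsub>M\<^esub> \<in> carrier ?N"
    by (simp add: invariants_record one
        additive_zero[OF M.additive_smult M.M.abelian_group_axioms M.M.abelian_group_axioms])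
  have neg: "\<ominus>\<^bsub>M\<^esub> x \<in> carrier ?N" if "x \<in> carrier ?N" for x
    using that by (simp add: invariants_record one
        additive_neg[OF M.additive_smult M.M.abelian_group_axioms M.M.abelian_group_axioms])
  have act: "twist id h \<odot>\<^bsub>M\<^esub> x \<in> carrier ?N" if h: "h \<in> carrier HW" and x: "x \<in> carrier ?N" for h x
  proof -
    have "twist w (monom 0 0 1) \<odot>\<^bsub>M\<^esub> (twist id h \<odot>\<^bsub>M\<^esub> x) = twist id h \<odot>\<^bsub>M\<^esub> x" if w: "w \<in> W" for w
    proof -
      have "twist w (monom 0 0 1) \<odot>\<odot> twist id h = twist id h \<odot>\<odot> twist w (monom 0 0 1)"
        using h w by (simp add: twisted_mult_twist invariant_record torus_mult_one torus_act_scalar weyl_id)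
      then have "twist w (monom 0 0 1) \<odot>\<^bsub>M\<^esub> (twist id h \<odot>\<^bsub>M\<^esub> x) =
          twist id h \<odot>\<^bsub>M\<^esub> (twist w (monom 0 0 1) \<odot>\<^bsub>M\<^esub> x)"
        using x by (simp add: M.smult_assoc[symmetric] one[OF w] tw[OF h] invariants_record)
      with x w show ?thesis by (simp add: invariants_record)
    qed
    with x show ?thesis by (simp add: invariants_record M.smult_closed tw[OF h])
  qed
  have inM: "x \<in> carrier M" if "x \<in> carrier ?N" for x using that by (simp add: invariants_record)
  have tw_mult: "twist id (g \<star> h) = twist id g \<odot>\<odot> twist id h" if "h \<in> carrier HW" for g h
    using that by (simp add: twisted_mult_twist invariant_record weyl_id)
  show ?thesis
  proof (intro left_module.intro left_module_axioms.intro invariant_ring abelian_groupI)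
    fix x assume x: "x \<in> carrier ?N"
    show "\<exists>y\<in>carrier ?N. y \<oplus>\<^bsub>?N\<^esub> x = \<zero>\<^bsub>?N\<^esub>"
      by (rule bexI[OF _ neg[OF x]]) (simp add: invariants_record(2,3) M.M.l_neg inM[OF x])
    show "\<one>\<^bsub>HW\<^esub> \<odot>\<^bsub>?N\<^esub> x = x"
      using M.smult_one[OF inM[OF x]] by (simp add: invariants_record(4) invariant_record(3) twisted_record(2))
  qed (simp_all add: invariants_record(2-4) invariant_record(2,5) add zero act inM tw M.M.a_ac
        M.smult_r_distr single_add M.smult_l_distr[unfolded twisted_record(4)] tw_mult M.smult_assoc)
qed

lemma invariants_is_functor: "is_functor A HW (invariants_functor H W)"
proof -
  have res: "f m \<in> carrier (invariants_module H W N)"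
    if "f \<in> left_hom A M N" "m \<in> carrier (invariants_module H W M)" for M N f m
    using that
    by (auto simp: invariants_record left_hom_closed left_hom_smult[symmetric]
        twist_closed torus_one_closed)
  have "restrict f (carrier (invariants_module H W M)) \<in>
      left_hom HW (invariants_module H W M) (invariants_module H W N)"
    if M: "left_module A M" and f: "f \<in> left_hom A M N" for M N f
    by (rule left_hom_restrictI[OF invariants_left_module[OF M] additiveI])
       (use f res[OF f] in \<open>auto simp: invariants_record(2-4) additive_add[OF left_hom_additive[OF f]]
          left_hom_smult[OF f] invariants_record(1)[of _ M] invariant_record(1) twist_closed weyl_id\<close>)
  moreover have "restrict (compose (carrier M) g f) (carrier (invariants_module H W M)) =
      compose (carrier (invariants_module H W M)) (restrict g (carrier (invariants_module H W N)))
        (restrict f (carrier (invariants_module H W M)))"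
    if "f \<in> left_hom A M N" for M N f g
    using res[OF that] by (auto simp: compose_def fun_eq_iff restrict_def invariants_record(1)[of _ M])
  moreover have "restrict (\<lambda>x\<in>carrier M. x) (carrier (invariants_module H W M)) =
      (\<lambda>x\<in>carrier (invariants_module H W M). x)" for M
    by (auto simp: fun_eq_iff restrict_def invariants_record(1))
  ultimately show ?thesis
    unfolding is_functor_def invariants_functor_def mod_functor.simps
    using invariants_left_module by blast
qed

text \<open>
  The module \<open>\<H>\<^sup>l\<close> is generated by \<open>1\<close> subject to the relations \<open>w \<cdot> 1 = 1\<close>, so a homomorphism out of it
  is the same as an invariant element, its value at \<open>1\<close>.
\<close>

theorem hom_iso_invariants:
  "functorial_iso A HW (hom_functor A Ql :: (('k, 'v) twisted, 'm, ('k, 'v) torus, ('k, 'v) torus \<Rightarrow> 'm) mod_functor)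
     (invariants_functor H W)"
proof (rule functorial_isoI[where \<theta> = "\<lambda>M g. g (monom 0 0 1)"])
  show "is_functor A HW (hom_functor A Ql)"
    by (rule bimodule_over.hom_is_functor[OF torus_l_bimodule])
  show "is_functor A HW (invariants_functor H W)"
    by (rule invariants_is_functor)
  have fobj: "fobj (invariants_functor H W) M = invariants_module H W M" for M :: "(('k, 'v) twisted, 'm) module"
    by (simp add: invariants_functor_def)
  have one: "monom 0 0 1 \<in> carrier Ql" by (simp add: bimodule_record torus_one_closed)
  have at_one: "g (monom 0 0 1) \<in> carrier (invariants_module H W M)" if g: "g \<in> left_hom A Ql M"
    for g and M :: "(('k, 'v) twisted, 'm) module"
    using left_hom_smult[OF g twist_closed[OF _ torus_one_closed] one] left_hom_closed[OF g one]
    by (simp add: invariants_record(1) lact_twist torus_act_scalar torus_mult_one torus_one_closed)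
  have determined: "g h = twist id h \<odot>\<^bsub>M\<^esub> g (monom 0 0 1)" if g: "g \<in> left_hom A Ql M" and h: "h \<in> carrier H"
    for g h and M :: "(('k, 'v) twisted, 'm) module"
    using left_hom_smult[OF g twist_closed[OF weyl_id h] one] h
    by (simp add: lact_twist torus_act_scalar weyl_id torus_mult_one)
  fix M :: "(('k, 'v) twisted, 'm) module" assume M: "left_module A M"
  interpret M: left_module A M by fact
  show "additive_map (fobj (hom_functor A Ql) M) (fobj (invariants_functor H W) M) (\<lambda>g. g (monom 0 0 1))"
    by (rule additiveI) (use one at_one in \<open>simp_all add: fobj invariants_record(3) hom_module_def\<close>)
  show "(s \<odot>\<^bsub>fobj (hom_functor A Ql) M\<^esub> g) (monom 0 0 1) =
      s \<odot>\<^bsub>fobj (invariants_functor H W) M\<^esub> g (monom 0 0 1)"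
    if "s \<in> carrier HW" "g \<in> carrier (fobj (hom_functor A Ql) M)" for s g
    using that one determined[of g M s]
    by (simp add: fobj invariants_record(4) hom_module_def bimodule_record(4) invariant_record(1) torus_mult_one)
  show "bij_betw (\<lambda>g. g (monom 0 0 1)) (carrier (fobj (hom_functor A Ql) M)) (carrier (fobj (invariants_functor H W) M))"
  proof (rule bij_betw_imageI)
    show "inj_on (\<lambda>g. g (monom 0 0 1)) (carrier (fobj (hom_functor A Ql) M))"
    proof (rule inj_onI)
      fix g g' assume g: "g \<in> carrier (fobj (hom_functor A Ql) M)" "g' \<in> carrier (fobj (hom_functor A Ql) M)"
        and eq: "g (monom 0 0 1) = g' (monom 0 0 1)"
      then have hom: "g \<in> left_hom A Ql M" "g' \<in> left_hom A Ql M" by (simp_all add: hom_module_def)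
      show "g = g'"
        by (rule left_hom_eqI[OF hom])
           (simp add: determined[OF hom(1)] determined[OF hom(2)] eq bimodule_record(1))
    qed
    have "m \<in> (\<lambda>g. g (monom 0 0 1)) ` left_hom A Ql M" if m: "m \<in> carrier (invariants_module H W M)" for m
    proof -
      have mM: "m \<in> carrier M" using m by (simp add: invariants_record(1))
      have inv: "twist w f \<odot>\<^bsub>M\<^esub> m = twist id f \<odot>\<^bsub>M\<^esub> m" if "w \<in> W" "f \<in> carrier H" for w f
      proof -
        have "twist w f = twist id f \<odot>\<odot> twist w (monom 0 0 1)"
          using that by (simp add: twisted_mult_twist torus_act_scalar weyl_id torus_mult_one)
        then show ?thesis
          using that m mM by (simp add: M.smult_assoc twist_closed weyl_id torus_one_closed invariants_record(1))
      qed
      have lin: "twist id (lact F h) \<odot>\<^bsub>M\<^esub> m = F \<odot>\<^bsub>M\<^esub> (twist id h \<odot>\<^bsub>M\<^esub> m)"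
        if F: "F \<in> carrier A" and h: "h \<in> carrier H" for F h
        using F
      proof (induction F rule: twisted_induct)
        case zero
        show ?case
          using M.smult_closed[OF twist_closed[OF weyl_id h] mM] mM
            additive_zero[OF M.additive_scalar M.R.abelian_group_axioms M.M.abelian_group_axioms]
          by (simp add: twisted_record(3) id_def)
      next
        case (twist w f)
        have "twist w f \<odot>\<^bsub>M\<^esub> (twist id h \<odot>\<^bsub>M\<^esub> m) = twist w (f \<star> torus_act w h) \<odot>\<^bsub>M\<^esub> m"
          using twist h mM M.smult_assoc[of "twist w f" "twist id h" m]
          by (simp add: twist_closed weyl_id twisted_mult_twist)
        also have "\<dots> = twist id (f \<star> torus_act w h) \<odot>\<^bsub>M\<^esub> m"
          using twist h by (intro inv torus_mult_closed torus_act_closed)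
        finally show ?case by (simp add: lact_twist id_def)
      next
        case (add F G)
        then show ?case
          using h mM lact_closed M.smult_closed[OF twist_closed[OF weyl_id h] mM]
          by (simp add: lact_add single_add M.smult_l_distr[unfolded twisted_record(4)] twist_closed weyl_id[unfolded id_def] id_def)
      qed
      have "additive_map Ql M (\<lambda>h. twist id h \<odot>\<^bsub>M\<^esub> m)"
        by (rule additiveI)
           (simp_all add: bimodule_record mM M.smult_closed twist_closed weyl_id single_add
              M.smult_l_distr[unfolded twisted_record(4)])
      then have hom: "(\<lambda>h\<in>carrier Ql. twist id h \<odot>\<^bsub>M\<^esub> m) \<in> left_hom A Ql M"
        by (rule left_hom_restrictI[OF torus_l_left_module]) (simp add: lin bimodule_record(1))
      have "m = (\<lambda>h\<in>carrier Ql. twist id h \<odot>\<^bsub>M\<^esub> m) (monom 0 0 1)"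
        using one M.smult_one[OF mM] by (simp add: twisted_record(2))
      then show ?thesis using hom by (rule image_eqI)
    qed
    then show "(\<lambda>g. g (monom 0 0 1)) ` carrier (fobj (hom_functor A Ql) M) = carrier (fobj (invariants_functor H W) M)"
      using at_one by (auto simp: fobj hom_module_def)
  qed
next
  fix M N :: "(('k, 'v) twisted, 'm) module" and f g
  assume "left_module A M" "f \<in> left_hom A M N" "g \<in> carrier (fobj (hom_functor A Ql) M)"
  then show "fmap (hom_functor A Ql) M N f g (monom 0 0 1) = fmap (invariants_functor H W) M N f (g (monom 0 0 1))"
    using left_hom_smult[OF _ twist_closed[OF _ torus_one_closed], of g Ql M _ "monom 0 0 1"]
      left_hom_closed[of g A Ql M "monom 0 0 1"]
    by (simp add: hom_functor_def invariants_functor_def hom_module_def compose_def bimodule_record(1)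
        torus_one_closed invariants_record(1) lact_twist torus_act_scalar torus_mult_one)
qed

end

theorem proposition4p1:
  fixes scale :: "'k::field_char_0 \<Rightarrow> 'v::ab_group_add \<Rightarrow> 'v"
    and \<Delta> :: "'v set" and coroot :: "'v \<Rightarrow> 'v \<Rightarrow> 'k"
    and X :: "('v \<Rightarrow> 'k) set" and Y :: "'v set" and n :: nat and q qn :: complex
    and W :: "('v \<Rightarrow> 'v) set"
    and H HW :: "('k, 'v) torus ring" and A :: "('k, 'v) twisted ring"
  assumes "quantum_torus_datum scale \<Delta> coroot X Y n q qn"
    and "W = weyl_group scale \<Delta> coroot"
    and "H = quantum_torus X Y n qn"
    and "HW = invariant_subring H W"
    and "A = twisted_group_ring H W"
  shows "simple_ring A \<and> simple_ring HW \<and>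
         morita_equivalent_via TYPE('m) TYPE('n) A HW (torus_r H) (torus_l H) \<and>
         functorial_iso A HW
           (tensor_functor A (torus_r H))
           (hom_functor A (torus_l H) ::
             (('k, 'v) twisted, 'm, ('k, 'v) torus, ('k, 'v) torus \<Rightarrow> 'm) mod_functor) \<and>
         functorial_iso A HW
           (hom_functor A (torus_l H) ::
             (('k, 'v) twisted, 'm, ('k, 'v) torus, ('k, 'v) torus \<Rightarrow> 'm) mod_functor)
           (invariants_functor H W)"
proof -
  interpret D: quantum_torus_datum scale \<Delta> coroot X Y n q qn by (rule assms(1))
  note eqs = assms(5) assms(4) assms(3) assms(2)
  interpret C: morita_context A HW "torus_r H" "torus_l H" D.trace_pairing D.twisted_pairing
    unfolding eqs by (rule D.torus_morita_context)
  interpret C': morita_context HW A "torus_l H" "torus_r H" D.twisted_pairing D.trace_pairing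
    by (rule C.morita_context_swap)
  have A: "simple_ring A"
    unfolding eqs by (rule D.simple_twisted)
  moreover have "\<one>\<^bsub>HW\<^esub> \<noteq> \<zero>\<^bsub>HW\<^esub>"
    unfolding eqs by (simp add: D.invariant_record single_nonzero)
  then have "simple_ring HW"
    by (rule C.simple_ring_transfer[OF A])
  moreover have "morita_equivalent_via TYPE('m) TYPE('n) A HW (torus_r H) (torus_l H)"
    unfolding morita_equivalent_via_def
    by (intro conjI C.tensor_functors_inverse C'.tensor_functors_inverse
        C.\<phi>.P.tensor_is_functor C.\<phi>.Q.tensor_is_functor)
  moreover have "functorial_iso A HW (tensor_functor A (torus_r H))
      (hom_functor A (torus_l H) :: (('k, 'v) twisted, 'm, ('k, 'v) torus, ('k, 'v) torus \<Rightarrow> 'm) mod_functor)"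
    by (rule C.tensor_iso_hom) (unfold eqs, rule D.torus_l_bimodule)
  moreover have "functorial_iso A HW
      (hom_functor A (torus_l H) :: (('k, 'v) twisted, 'm, ('k, 'v) torus, ('k, 'v) torus \<Rightarrow> 'm) mod_functor)
      (invariants_functor H W)"
    unfolding eqs by (rule D.hom_iso_invariants)
  ultimately show ?thesis by blast
qed

end
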